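(* Let $\alpha\in C^{\log}_{\mathrm{loc}}(\mathbb{R}^n)$, $p\in\mathcal{P}^{\log}(\mathbb{R}^n)$ and $a>\frac{n}{p^-}$, where $p^-:=\operatorname{ess\,inf}_{x\in\mathbb{R}^n}p(x)$. Let $q\in\mathcal{P}(\mathbb{R})$ be log-Hölder continuous at the origin and let $\{\mathcal{F}\Phi,\mathcal{F}\varphi\}$ be a resolution of unity. Then $$\|f\|^{\blacktriangledown}_{\boldsymbol{B}^{\alpha(\cdot)}_{p(\cdot),q(\cdot)}}:=\|\Phi^{*,a}f\|_{p(\cdot)}+\Big\|\,\|\varphi_t^{*,a}t^{-\alpha(\cdot)}f\|_{p(\cdot)}\Big\|_{L^{q(\cdot)}((0,1],\frac{dt}{t})}$$ is an equivalent norm in $\boldsymbol{B}^{\alpha(\cdot)}_{p(\cdot),q(\cdot)}$; that is, there are constants $c,C>0$ with $c\|f\|_{\boldsymbol{B}^{\alpha(\cdot)}_{p(\cdot),q(\cdot)}}\le\|f\|^{\blacktriangledown}_{\boldsymbol{B}^{\alpha(\cdot)}_{p(\cdot),q(\cdot)}}\le C\|f\|_{\boldsymbol{B}^{\alpha(\cdot)}_{p(\cdot),q(\cdot)}}$ for all $f\in\boldsymbol{B}^{\alpha(\cdot)}_{p(\cdot),q(\cdot)}$.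
   Context: Exponents. $\mathcal{P}(\mathbb{R}^d)$ is the set of measurable functions $\mathbb{R}^d\to[1,\infty)$. For $p\in\mathcal{P}(\mathbb{R}^n)$, $\|f\|_{p(\cdot)}:=\inf\{\lambda>0:\int_{\mathbb{R}^n}|f(x)/\lambda|^{p(x)}dx\le1\}$. For $q\in\mathcal{P}(\mathbb{R})$ and measurable $g$ on an interval $I\subset(0,1]$, $\|g(t)\|_{L^{q(\cdot)}(I,dt/t)}:=\inf\{\lambda>0:\int_I|g(t)/\lambda|^{q(t)}\frac{dt}{t}\le1\}$. Log-Hölder conditions. $g\in C^{\log}_{\mathrm{loc}}(\mathbb{R}^n)$ means $g:\mathbb{R}^n\to\mathbb{R}$ and there is $c_{\log}(g)>0$ with $|g(x)-g(y)|\le\frac{c_{\log}(g)}{\log(e+1/|x-y|)}$ for all $x,y\in\mathbb{R}^n$. $g$ is log-Hölder continuous at the origin if there is $c>0$ with $|g(x)-g(0)|\le\frac{c}{\log(e+1/|x|)}$ for all $x$. $g\in C^{\log}(\mathbb{R}^n)$ if $g\in C^{\log}_{\mathrm{loc}}(\mathbb{R}^n)$ and there are $g_\infty\in\mathbb{R}$, $c>0$ with $|g(x)-g_\infty|\le\frac{c}{\log(e+|x|)}$ for all $x$. $\mathcal{P}^{\log}(\mathbb{R}^n):=\{p\in\mathcal{P}(\mathbb{R}^n):1/p\in C^{\log}(\mathbb{R}^n)\}$. Resolution of unity. $\mathcal{F}$ is the Fourier transform, normalised so that $\mathcal{F}(f*g)=\mathcal{F}f\,\mathcal{F}g$. A pair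 $\{\mathcal{F}\Phi,\mathcal{F}\varphi\}$ with $\Phi,\varphi\in\mathcal{S}(\mathbb{R}^n)$ is a resolution of unity if $\operatorname{supp}\mathcal{F}\Phi\subset\{|x|<2\}$, $\operatorname{supp}\mathcal{F}\varphi\subset\{\frac12<|x|<2\}$ and $\mathcal{F}\Phi(\xi)+\int_0^1\mathcal{F}\varphi(t\xi)\frac{dt}{t}=1$ for all $\xi\in\mathbb{R}^n$. Put $\varphi_t:=t^{-n}\varphi(\cdot/t)$. Besov space. $\boldsymbol{B}^{\alpha(\cdot)}_{p(\cdot),q(\cdot)}$ is the set of $f\in\mathcal{S}'(\mathbb{R}^n)$ with $$\|f\|_{\boldsymbol{B}^{\alpha(\cdot)}_{p(\cdot),q(\cdot)}}:=\|\Phi*f\|_{p(\cdot)}+\Big\|\,\|t^{-\alpha(\cdot)}(\varphi_t*f)\|_{p(\cdot)}\Big\|_{L^{q(\cdot)}((0,1],\frac{dt}{t})}<\infty.$$ Peetre maximal functions. For $a>0$, $f\in\mathcal{S}'(\mathbb{R}^n)$, $x\in\mathbb{R}^n$, $t>0$: $$\varphi_t^{*,a}t^{-\alpha(\cdot)}f(x):=\sup_{y\in\mathbb{R}^n}\frac{t^{-\alpha(y)}|\varphi_t*f(y)|}{(1+t^{-1}|x-y|)^a},\qquad \Phi^{*,a}f(x):=\sup_{y\in\mathbb{R}^n}\frac{|\Phi*f(y)|}{(1+|x-y|)^a}.$$ *)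

theory Defs
  imports "HOL-Analysis.Analysis"
begin

section \<open>Schwartz functions and tempered distributions\<close>

text \<open>A list of basis vectors plays the role of a multi-index.\<close>

primrec partials :: "'a::euclidean_space list \<Rightarrow> ('a \<Rightarrow> complex) \<Rightarrow> 'a \<Rightarrow> complex" where
  "partials [] f = f"
| "partials (b # bs) f = (\<lambda>x. frechet_derivative (partials bs f) (at x) b)"

definition schwartz :: "('a::euclidean_space \<Rightarrow> complex) set" where
  "schwartz = {f. \<forall>bs. set bs \<subseteq> Basis \<longrightarrow>
      (\<forall>x. partials bs f differentiable (at x)) \<and>
      (\<forall>N::nat. bounded (range (\<lambda>x. (1 + norm x) ^ N *\<^sub>R partials bs f x)))}"

text \<open>For Schwartz functions this supremum is finite: it is over finitely many derivatives.\<close>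

definition schwartz_seminorm :: "nat \<Rightarrow> ('a::euclidean_space \<Rightarrow> complex) \<Rightarrow> real" where
  "schwartz_seminorm N f =
     (SUP (bs, x) \<in> {bs. set bs \<subseteq> Basis \<and> length bs \<le> N} \<times> UNIV.
        (1 + norm x) ^ N * cmod (partials bs f x))"

text \<open>
  The continuous linear functionals on the Schwartz space. A functional is given the value 0
  outside the Schwartz space, so that equal distributions are equal functions.
\<close>

definition tempered_distribution :: "(('a::euclidean_space \<Rightarrow> complex) \<Rightarrow> complex) set" where
  "tempered_distribution = {T.
      (\<forall>f\<in>schwartz. \<forall>g\<in>schwartz. T (\<lambda>x. f x + g x) = T f + T g) \<and>
      (\<forall>f\<in>schwartz. \<forall>c. T (\<lambda>x. c * f x) = c * T f) \<and>
      (\<exists>C N. \<forall>f\<in>schwartz. cmod (T f) \<le> C * schwartz_seminorm N f) \<and>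
      (\<forall>f. f \<notin> schwartz \<longrightarrow> T f = 0)}"

definition conv :: "('a::euclidean_space \<Rightarrow> complex) \<Rightarrow> (('a \<Rightarrow> complex) \<Rightarrow> complex) \<Rightarrow> 'a \<Rightarrow> complex"
  where "conv \<phi> T x = T (\<lambda>y. \<phi> (x - y))"

definition dilate :: "('a::euclidean_space \<Rightarrow> complex) \<Rightarrow> real \<Rightarrow> 'a \<Rightarrow> complex" where
  "dilate \<phi> t x = \<phi> (x /\<^sub>R t) /\<^sub>R t ^ DIM('a)"

definition fourier :: "('a::euclidean_space \<Rightarrow> complex) \<Rightarrow> 'a \<Rightarrow> complex" where
  "fourier f \<xi> = (LINT x|lborel. exp (- (\<i> * of_real (x \<bullet> \<xi>))) * f x)"

definition supp :: "('a::topological_space \<Rightarrow> 'b::zero) \<Rightarrow> 'a set" where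
  "supp f = closure {x. f x \<noteq> 0}"

definition resolution_of_unity ::
    "('a::euclidean_space \<Rightarrow> complex) \<Rightarrow> ('a \<Rightarrow> complex) \<Rightarrow> bool" where
  "resolution_of_unity \<Phi> \<phi> \<longleftrightarrow>
     \<Phi> \<in> schwartz \<and> \<phi> \<in> schwartz \<and>
     supp (fourier \<Phi>) \<subseteq> {\<xi>. norm \<xi> < 2} \<and>
     supp (fourier \<phi>) \<subseteq> {\<xi>. 1/2 < norm \<xi> \<and> norm \<xi> < 2} \<and>
     (\<forall>\<xi>. fourier \<Phi> \<xi> + (LINT t:{0<..1}|lborel. fourier \<phi> (t *\<^sub>R \<xi>) /\<^sub>R t) = 1)"

section \<open>Variable exponents\<close>

definition var_exponent :: "('a::euclidean_space \<Rightarrow> real) set" where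
  "var_exponent = {p \<in> borel_measurable lebesgue. \<forall>x. 1 \<le> p x}"

definition ess_inf :: "('a::euclidean_space \<Rightarrow> real) \<Rightarrow> real" where
  "ess_inf p = Sup {c. AE x in lebesgue. c \<le> p x}"

text \<open>
  In the conditions below the case of a vanishing distance is harmless: the convention
  \<open>1 / 0 = 0\<close> makes the right-hand side \<open>c\<close>, while the left-hand side is 0.
\<close>

definition log_holder_loc :: "('a::euclidean_space \<Rightarrow> real) set" where
  "log_holder_loc = {g. \<exists>c>0. \<forall>x y. \<bar>g x - g y\<bar> \<le> c / ln (exp 1 + 1 / norm (x - y))}"

definition log_holder_origin :: "('a::euclidean_space \<Rightarrow> real) \<Rightarrow> bool" where
  "log_holder_origin g \<longleftrightarrow> (\<exists>c>0. \<forall>x. \<bar>g x - g 0\<bar> \<le> c / ln (exp 1 + 1 / norm x))"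

definition log_holder :: "('a::euclidean_space \<Rightarrow> real) set" where
  "log_holder = {g \<in> log_holder_loc.
     \<exists>g_inf. \<exists>c>0. \<forall>x. \<bar>g x - g_inf\<bar> \<le> c / ln (exp 1 + norm x)}"

definition var_exponent_log :: "('a::euclidean_space \<Rightarrow> real) set" where
  "var_exponent_log = {p \<in> var_exponent. (\<lambda>x. 1 / p x) \<in> log_holder}"

text \<open>Norms take values in the extended nonnegative reals; only exponents \<open>r > 0\<close> occur.\<close>

definition ennpowr :: "ennreal \<Rightarrow> real \<Rightarrow> ennreal" where
  "ennpowr x r = (if x = \<infinity> then \<infinity> else ennreal (enn2real x powr r))"

definition var_norm :: "('a::euclidean_space \<Rightarrow> real) \<Rightarrow> ('a \<Rightarrow> ennreal) \<Rightarrow> ennreal" where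
  "var_norm p f =
     Inf {ennreal l | l. l > 0 \<and> (\<integral>\<^sup>+ x. ennpowr (f x / ennreal l) (p x) \<partial>lebesgue) \<le> 1}"

definition var_norm_dt :: "(real \<Rightarrow> real) \<Rightarrow> real set \<Rightarrow> (real \<Rightarrow> ennreal) \<Rightarrow> ennreal" where
  "var_norm_dt q I g =
     Inf {ennreal l | l. l > 0 \<and>
       (\<integral>\<^sup>+ t\<in>I. ennpowr (g t / ennreal l) (q t) * ennreal (1 / t) \<partial>lebesgue) \<le> 1}"

section \<open>Besov spaces and Peetre maximal functions\<close>

type_synonym 'a distr = "('a \<Rightarrow> complex) \<Rightarrow> complex"

definition besov_norm ::
  "('a::euclidean_space \<Rightarrow> complex) \<Rightarrow> ('a \<Rightarrow> complex) \<Rightarrow> ('a \<Rightarrow> real) \<Rightarrow> ('a \<Rightarrow> real) \<Rightarrow>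
   (real \<Rightarrow> real) \<Rightarrow> 'a distr \<Rightarrow> ennreal" where
  "besov_norm \<Phi> \<phi> \<alpha> p q f =
     var_norm p (\<lambda>x. ennreal (cmod (conv \<Phi> f x))) +
     var_norm_dt q {0<..1}
       (\<lambda>t. var_norm p (\<lambda>x. ennreal (t powr (- \<alpha> x) * cmod (conv (dilate \<phi> t) f x))))"

definition besov_space ::
  "('a::euclidean_space \<Rightarrow> complex) \<Rightarrow> ('a \<Rightarrow> complex) \<Rightarrow> ('a \<Rightarrow> real) \<Rightarrow> ('a \<Rightarrow> real) \<Rightarrow>
   (real \<Rightarrow> real) \<Rightarrow> 'a distr set" where
  "besov_space \<Phi> \<phi> \<alpha> p q = {f \<in> tempered_distribution. besov_norm \<Phi> \<phi> \<alpha> p q f < \<infinity>}"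

definition peetre_local ::
  "('a::euclidean_space \<Rightarrow> complex) \<Rightarrow> real \<Rightarrow> ('a \<Rightarrow> real) \<Rightarrow> real \<Rightarrow> 'a distr \<Rightarrow> 'a \<Rightarrow> ennreal" where
  "peetre_local \<phi> a \<alpha> t f x =
     (SUP y. ennreal (t powr (- \<alpha> y) * cmod (conv (dilate \<phi> t) f y) /
                      (1 + norm (x - y) / t) powr a))"

definition peetre_global ::
  "('a::euclidean_space \<Rightarrow> complex) \<Rightarrow> real \<Rightarrow> 'a distr \<Rightarrow> 'a \<Rightarrow> ennreal" where
  "peetre_global \<Phi> a f x =
     (SUP y. ennreal (cmod (conv \<Phi> f y) / (1 + norm (x - y)) powr a))"

definition peetre_norm ::
  "('a::euclidean_space \<Rightarrow> complex) \<Rightarrow> ('a \<Rightarrow> complex) \<Rightarrow> real \<Rightarrow> ('a \<Rightarrow> real) \<Rightarrow> ('a \<Rightarrow> real) \<Rightarrow>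
   (real \<Rightarrow> real) \<Rightarrow> 'a distr \<Rightarrow> ennreal" where
  "peetre_norm \<Phi> \<phi> a \<alpha> p q f =
     var_norm p (peetre_global \<Phi> a f) +
     var_norm_dt q {0<..1} (\<lambda>t. var_norm p (peetre_local \<phi> a \<alpha> t f))"

end

theory Submission
  imports Defs "HOL-Probability.Probability"
begin

text \<open>
  The lower estimate is the choice \<open>y = x\<close> in the suprema; the upper one holds for every fixed \<open>t\<close>.
  The resolution of unity forces \<open>fourier \<Phi> = 1\<close> near the origin, hence the
  band-limited function \<open>F = \<phi>\<^sub>t * f\<close> is reproduced by convolution with a dilate of \<open>\<Phi>\<close>. Local
  log-Hoelder continuity moves the weight \<open>t powr (- \<alpha>)\<close> through this convolution, and Jensen's inequality
  with exponent \<open>r = p\<^sup>-\<close> bounds the \<open>r\<close>-th power of the Peetre maximal function by the convolution of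
  \<open>(t powr (- \<alpha>) * |F|) powr r\<close> with \<open>t\<^sup>-\<^sup>n (1 + |x| / t) powr (- a r)\<close>. As \<open>a r > n\<close>, this kernel is dominated
  by a geometric series of normalised ball indicators, and averages over balls are bounded on the space with
  exponent \<open>p / r \<ge> 1\<close>, uniformly in the radius.
\<close>

section \<open>Schwartz functions\<close>

text \<open>With \<open>r\<close> equal to the infimum of \<open>p\<close> the exponent
  \<open>p / r\<close> has infimum 1, the endpoint at which the Hardy-Littlewood maximal operator is
  unbounded. Hence balls of one radius are treated at a time: their averages preserve integrals by
  Fubini, and convexity in the summation index recombines the radii. Moreover \<open>p\<close> may
  be unbounded, since only \<open>1 / p\<close> is regular. A constant raised to the power
  \<open>p x\<close> is then not uniform in \<open>x\<close>, so constants stay inside powers, as in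
  \<open>(\<beta> * g) powr s x\<close>. The other obstacle is that the reproducing formula is
  applied to a distribution. The pairing is moved under the integral by Riemann sums on boxes, with
  errors controlled in Schwartz seminorms, as is the tail outside the box. The outcome is an
  inequality in the extended nonnegative reals, the form in which Jensen's inequality takes its
  input. The decay of the reproducing kernel can be prescribed: \<open>n + 1\<close> powers make it
  integrable, \<open>a\<close> powers turn a weight centred at \<open>y\<close> into one centred at
  \<open>x\<close>, and the rest pays for the variation of \<open>\<alpha>\<close>.\<close>

lemma schwartz_differentiable:
  assumes "f \<in> schwartz" "set bs \<subseteq> Basis"
  shows "partials bs f differentiable (at x)"
  using assms unfolding schwartz_def by blast

lemma schwartz_decay:
  assumes "f \<in> schwartz" "set bs \<subseteq> Basis"
  obtains C where "C > 0" "\<And>x. (1 + norm x) ^ N * cmod (partials bs f x) \<le> C"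
proof -
  have "bounded (range (\<lambda>x. (1 + norm x) ^ N *\<^sub>R partials bs f x))"
    using assms unfolding schwartz_def by blast
  then obtain C where "C > 0" "\<And>x. norm ((1 + norm x) ^ N *\<^sub>R partials bs f x) \<le> C"
    by (auto simp: bounded_pos)
  then show ?thesis by (intro that[of C]) simp_all
qed

lemma schwartzI:
  assumes "\<And>bs x. set bs \<subseteq> Basis \<Longrightarrow> partials bs f differentiable (at x)"
    and "\<And>bs N. set bs \<subseteq> Basis \<Longrightarrow> \<exists>C. \<forall>x. (1 + norm x) ^ N * cmod (partials bs f x) \<le> C"
  shows "f \<in> schwartz"
  unfolding schwartz_def bounded_iff
  using assms by fastforce

lemma partials_append: "partials (bs @ cs) f = partials bs (partials cs f)"
  by (induction bs) auto

lemma schwartz_partials: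
  assumes "f \<in> schwartz" "set cs \<subseteq> Basis"
  shows "partials cs f \<in> schwartz"
proof (rule schwartzI)
  fix bs :: "'a list" and x N assume "set bs \<subseteq> Basis"
  then have s: "set (bs @ cs) \<subseteq> Basis" using assms by simp
  show "partials bs (partials cs f) differentiable (at x)"
    using schwartz_differentiable[OF assms(1) s] by (simp add: partials_append)
  show "\<exists>C. \<forall>x. (1 + norm x) ^ N * cmod (partials bs (partials cs f) x) \<le> C"
    using schwartz_decay[OF assms(1) s, of N] by (metis partials_append)
qed

lemma schwartz_has_derivative:
  assumes "f \<in> schwartz"
  shows "(f has_derivative (\<lambda>v. \<Sum>b\<in>Basis. (v \<bullet> b) *\<^sub>R partials [b] f x)) (at x)"
proof -
  have d: "(f has_derivative frechet_derivative f (at x)) (at x)"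
    using schwartz_differentiable[OF assms, of "[]"] frechet_derivative_works by auto
  then have l: "linear (frechet_derivative f (at x))"
    by (rule has_derivative_linear)
  have "frechet_derivative f (at x) v = (\<Sum>b\<in>Basis. (v \<bullet> b) *\<^sub>R partials [b] f x)" for v
  proof -
    have "frechet_derivative f (at x) v = frechet_derivative f (at x) (\<Sum>b\<in>Basis. (v \<bullet> b) *\<^sub>R b)"
      by (simp add: euclidean_representation)
    also have "\<dots> = (\<Sum>b\<in>Basis. (v \<bullet> b) *\<^sub>R frechet_derivative f (at x) b)"
      using l by (simp add: linear_sum linear_scale)
    finally show ?thesis by simp
  qed
  then have "frechet_derivative f (at x) = (\<lambda>v. \<Sum>b\<in>Basis. (v \<bullet> b) *\<^sub>R partials [b] f x)" by blast
  with d show ?thesis by (rule has_derivative_eq_rhs)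
qed

lemma schwartz_continuous:
  assumes "f \<in> schwartz"
  shows "continuous_on A f"
  by (intro continuous_at_imp_continuous_on ballI has_derivative_continuous[OF schwartz_has_derivative[OF assms]])

lemma schwartz_borel: "f \<in> schwartz \<Longrightarrow> f \<in> borel_measurable borel"
  by (simp add: borel_measurable_continuous_onI schwartz_continuous)

lemma schwartz_bounded:
  assumes "f \<in> schwartz"
  obtains C where "C > 0" "\<And>x. (1 + norm x) ^ N * cmod (f x) \<le> C"
  using schwartz_decay[OF assms, of "[]" N] by auto

text \<open>Peetre's inequality: the triangle inequality and 1 + a + b \<le> (1 + a) (1 + b). It
  moves a polynomial weight from one variable to another.\<close>

lemma one_plus_norm_le:
  fixes y z :: "'a::real_normed_vector"
  shows "1 + norm y \<le> (1 + norm z) * (1 + norm (z - y))"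
proof -
  have "norm y \<le> norm z + norm (z - y)" by (metis norm_minus_commute norm_triangle_sub)
  then show ?thesis
    by (simp add: algebra_simps) (smt (verit) mult_nonneg_nonneg norm_ge_zero)
qed

lemma weighted_translate_le:
  fixes g :: "'a::real_normed_vector \<Rightarrow> complex"
  assumes "\<And>u. (1 + norm u) ^ N * cmod (g u) \<le> C"
  shows "(1 + norm y) ^ N * cmod (g (z - y)) \<le> C * (1 + norm z) ^ N"
proof -
  have "(1 + norm y) ^ N \<le> (1 + norm z) ^ N * (1 + norm (z - y)) ^ N"
    unfolding power_mult_distrib[symmetric] by (intro power_mono one_plus_norm_le) simp
  then have "(1 + norm y) ^ N * cmod (g (z - y)) \<le> ((1 + norm z) ^ N * (1 + norm (z - y)) ^ N) * cmod (g (z - y))"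
    by (intro mult_right_mono) auto
  also have "\<dots> = (1 + norm z) ^ N * ((1 + norm (z - y)) ^ N * cmod (g (z - y)))" by simp
  also have "\<dots> \<le> (1 + norm z) ^ N * C" by (intro mult_left_mono assms) auto
  finally show ?thesis by (simp add: mult.commute)
qed

text \<open>Mean value estimate on the ball of radius \<open>R\<close>, where Peetre's inequality
  trades the weight in \<open>y\<close> for the decay of the gradient at a fixed cost. It makes the
  translates of \<open>g\<close> locally Lipschitz in the shift for every Schwartz seminorm.\<close>

lemma schwartz_translate_lipschitz:
  assumes "g \<in> schwartz"
  obtains C where "C > 0"
    "\<And>z z' y. norm z \<le> R \<Longrightarrow> norm z' \<le> R \<Longrightarrow>
       (1 + norm y) ^ N * cmod (g (z - y) - g (z' - y)) \<le> C * norm (z - z')"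
proof -
  have "\<exists>C. C > 0 \<and> (\<forall>x. (1 + norm x) ^ N * cmod (partials [b] g x) \<le> C)" if "b \<in> Basis" for b
    using schwartz_decay[OF assms, of "[b]" N] that by auto
  then obtain D where D: "\<And>b. b \<in> Basis \<Longrightarrow> D b > 0"
      "\<And>b x. b \<in> Basis \<Longrightarrow> (1 + norm x) ^ N * cmod (partials [b] g x) \<le> D b"
    by metis
  \<comment> \<open>\<open>\<bar>R\<bar>\<close> instead of \<open>R\<close> keeps the constant
    positive when \<open>R\<close> is negative and the claim is vacuous.\<close>
  define C where "C = (\<Sum>b\<in>Basis. D b) * (1 + \<bar>R\<bar>) ^ N"
  have "C > 0" unfolding C_def using D by (intro mult_pos_pos sum_pos) auto
  moreover have "(1 + norm y) ^ N * cmod (g (z - y) - g (z' - y)) \<le> C * norm (z - z')"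
    if z: "norm z \<le> R" "norm z' \<le> R" for z z' y
  proof -
    let ?w = "(1 + norm y) ^ N"
    have w: "?w > 0" by (simp add: add_pos_nonneg)
    have "norm (g (z - y) - g (z' - y)) \<le> (C / ?w) * norm (z - z')"
    proof (rule differentiable_bound[where S = "cball 0 R" and f = "\<lambda>z. g (z - y)" and
            f' = "\<lambda>x v. \<Sum>b\<in>Basis. (v \<bullet> b) *\<^sub>R partials [b] g (x - y)"])
      fix u :: 'a assume u: "u \<in> cball 0 R"
      have "((\<lambda>z. g (z - y)) has_derivative (\<lambda>v. \<Sum>b\<in>Basis. (v \<bullet> b) *\<^sub>R partials [b] g (u - y))) (at u)"
        by (rule has_derivative_compose[where f = "\<lambda>z. z - y" and g = g and f' = "\<lambda>v. v",
              OF _ schwartz_has_derivative[OF assms]]) (auto intro!: derivative_eq_intros)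
      then show "((\<lambda>z. g (z - y)) has_derivative (\<lambda>v. \<Sum>b\<in>Basis. (v \<bullet> b) *\<^sub>R partials [b] g (u - y)))
          (at u within cball 0 R)"
        by (rule has_derivative_at_withinI)
      show "onorm (\<lambda>v. \<Sum>b\<in>Basis. (v \<bullet> b) *\<^sub>R partials [b] g (u - y)) \<le> C / ?w"
      proof (rule onorm_le)
        fix v :: 'a
        have "norm (\<Sum>b\<in>Basis. (v \<bullet> b) *\<^sub>R partials [b] g (u - y)) \<le>
            (\<Sum>b\<in>Basis. norm v * (D b * (1 + \<bar>R\<bar>) ^ N / ?w))"
        proof (rule sum_norm_le)
          fix b :: 'a assume b: "b \<in> Basis"
          have "?w * cmod (partials [b] g (u - y)) \<le> D b * (1 + norm u) ^ N"
            by (rule weighted_translate_le) (rule D[OF b])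
          also have "\<dots> \<le> D b * (1 + \<bar>R\<bar>) ^ N"
            using D(1)[OF b] u by (intro mult_left_mono power_mono) auto
          finally have "cmod (partials [b] g (u - y)) \<le> D b * (1 + \<bar>R\<bar>) ^ N / ?w"
            using w by (simp add: pos_le_divide_eq mult.commute)
          then show "norm ((v \<bullet> b) *\<^sub>R partials [b] g (u - y)) \<le> norm v * (D b * (1 + \<bar>R\<bar>) ^ N / ?w)"
            using Basis_le_norm[OF b, of v] by (simp only: norm_scaleR real_norm_def) (intro mult_mono; simp)
        qed
        also have "\<dots> = C / ?w * norm v"
          by (simp add: C_def sum_distrib_left sum_distrib_right sum_divide_distrib mult_ac)
        finally show "norm (\<Sum>b\<in>Basis. (v \<bullet> b) *\<^sub>R partials [b] g (u - y)) \<le> C / ?w * norm v" .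
      qed
    qed (use z in auto)
    then show ?thesis using w by (simp add: field_simps)
  qed
  ultimately show ?thesis by (rule that)
qed

lemma schwartz_lipschitz:
  assumes "g \<in> schwartz"
  obtains L where "L > 0" "\<And>x y. cmod (g x - g y) \<le> L * norm (x - y)"
proof -
  have "\<exists>C. C > 0 \<and> (\<forall>x. (1 + norm x) ^ 0 * cmod (partials [b] g x) \<le> C)" if "b \<in> Basis" for b
    using schwartz_decay[OF assms, of "[b]" 0] that by auto
  then obtain D where D: "\<And>b. b \<in> Basis \<Longrightarrow> D b > 0"
      "\<And>b x. b \<in> Basis \<Longrightarrow> cmod (partials [b] g x) \<le> D b"
    by simp metis
  have "cmod (g x - g y) \<le> (\<Sum>b\<in>Basis. D b) * norm (x - y)" for x y
  proof (rule differentiable_bound[OF convex_UNIV schwartz_has_derivative[OF assms]])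
    show "onorm (\<lambda>v. \<Sum>b\<in>Basis. (v \<bullet> b) *\<^sub>R partials [b] g u) \<le> (\<Sum>b\<in>Basis. D b)" for u
    proof (rule onorm_le)
      fix v :: 'a
      have "norm (\<Sum>b\<in>Basis. (v \<bullet> b) *\<^sub>R partials [b] g u) \<le> (\<Sum>b\<in>Basis. norm v * D b)"
        by (rule sum_norm_le, simp only: norm_scaleR real_norm_def)
          (intro mult_mono D Basis_le_norm; simp)
      then show "norm (\<Sum>b\<in>Basis. (v \<bullet> b) *\<^sub>R partials [b] g u) \<le> (\<Sum>b\<in>Basis. D b) * norm v"
        by (simp add: sum_distrib_left sum_distrib_right mult_ac)
    qed
  qed auto
  moreover have "(\<Sum>b\<in>Basis. D b) > 0" using D by (intro sum_pos) auto
  ultimately show ?thesis using that by blast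
qed

text \<open>The remainder is quadratic uniformly in the base point \<open>x\<close>. Integrated
  against an integrable weight it stays quadratic, which gives differentiation under the integral
  sign.\<close>

lemma schwartz_taylor:
  assumes "g \<in> schwartz"
  obtains K where "K > 0"
    "\<And>x v. cmod (g (x + v) - g x - (\<Sum>b\<in>Basis. (v \<bullet> b) *\<^sub>R partials [b] g x)) \<le> K * (norm v)\<^sup>2"
proof -
  have "\<exists>L. L > 0 \<and> (\<forall>x y. cmod (partials [b] g x - partials [b] g y) \<le> L * norm (x - y))" if "b \<in> Basis" for b
  proof -
    have "partials [b] g \<in> schwartz" by (rule schwartz_partials[OF assms]) (simp add: that)
    then show ?thesis by (elim schwartz_lipschitz) blast
  qed
  then obtain D where D: "\<And>b. b \<in> Basis \<Longrightarrow> D b > 0"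
      "\<And>b x y. b \<in> Basis \<Longrightarrow> cmod (partials [b] g x - partials [b] g y) \<le> D b * norm (x - y)"
    by metis
  define K where "K = (\<Sum>b\<in>Basis. D b)"
  have "K > 0" unfolding K_def using D by (intro sum_pos) auto
  moreover have "cmod (g (x + v) - g x - (\<Sum>b\<in>Basis. (v \<bullet> b) *\<^sub>R partials [b] g x)) \<le> K * (norm v)\<^sup>2" for x v
  proof -
    \<comment> \<open>With the linear part at \<open>x\<close> removed, the derivative of
      \<open>?h\<close> at \<open>u\<close> is a difference of gradients, at most
      \<open>K * norm v\<close> on the ball of radius \<open>norm v\<close>; the mean value estimate
      adds the second factor \<open>norm v\<close>.\<close>
    let ?h = "\<lambda>u. g (x + u) - (\<Sum>b\<in>Basis. (u \<bullet> b) *\<^sub>R partials [b] g x)"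
    have "norm (?h v - ?h 0) \<le> (K * norm v) * norm (v - 0)"
    proof (rule differentiable_bound[where S = "cball 0 (norm v)" and
          f' = "\<lambda>u w. \<Sum>b\<in>Basis. (w \<bullet> b) *\<^sub>R (partials [b] g (x + u) - partials [b] g x)"])
      fix u :: 'a assume u: "u \<in> cball 0 (norm v)"
      have "((\<lambda>z. g (x + z)) has_derivative (\<lambda>v. \<Sum>b\<in>Basis. (v \<bullet> b) *\<^sub>R partials [b] g (x + u))) (at u)"
        by (rule has_derivative_compose[where f = "\<lambda>z. x + z" and g = g and f' = "\<lambda>v. v",
              OF _ schwartz_has_derivative[OF assms]]) (auto intro!: derivative_eq_intros)
      moreover have "((\<lambda>u. \<Sum>b\<in>Basis. (u \<bullet> b) *\<^sub>R partials [b] g x) has_derivative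
          (\<lambda>u. \<Sum>b\<in>Basis. (u \<bullet> b) *\<^sub>R partials [b] g x)) (at u)"
        by (auto intro!: derivative_eq_intros)
      ultimately have "(?h has_derivative (\<lambda>w. (\<Sum>b\<in>Basis. (w \<bullet> b) *\<^sub>R partials [b] g (x + u)) -
          (\<Sum>b\<in>Basis. (w \<bullet> b) *\<^sub>R partials [b] g x))) (at u)"
        by (rule has_derivative_diff)
      then show "(?h has_derivative (\<lambda>w. \<Sum>b\<in>Basis. (w \<bullet> b) *\<^sub>R (partials [b] g (x + u) - partials [b] g x)))
          (at u within cball 0 (norm v))"
        by (simp only: sum_subtractf scaleR_diff_right) (rule has_derivative_at_withinI)
      show "onorm (\<lambda>w. \<Sum>b\<in>Basis. (w \<bullet> b) *\<^sub>R (partials [b] g (x + u) - partials [b] g x)) \<le> K * norm v"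
      proof (rule onorm_le)
        fix w :: 'a
        have "norm (\<Sum>b\<in>Basis. (w \<bullet> b) *\<^sub>R (partials [b] g (x + u) - partials [b] g x)) \<le>
            (\<Sum>b\<in>Basis. norm w * (D b * norm v))"
        proof (rule sum_norm_le)
          fix b :: 'a assume b: "b \<in> Basis"
          have "cmod (partials [b] g (x + u) - partials [b] g x) \<le> D b * norm u"
            using D(2)[OF b, of "x + u" x] by simp
          also have "\<dots> \<le> D b * norm v" using D(1)[OF b] u by (intro mult_left_mono) auto
          finally show "norm ((w \<bullet> b) *\<^sub>R (partials [b] g (x + u) - partials [b] g x)) \<le> norm w * (D b * norm v)"
            using Basis_le_norm[OF b, of w] by (simp only: norm_scaleR real_norm_def) (intro mult_mono; simp)
        qed
        then show "norm (\<Sum>b\<in>Basis. (w \<bullet> b) *\<^sub>R (partials [b] g (x + u) - partials [b] g x)) \<le> K * norm v * norm w"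
          by (simp add: K_def sum_distrib_left sum_distrib_right mult_ac)
      qed
    qed auto
    then show ?thesis by (simp add: power2_eq_square algebra_simps)
  qed
  ultimately show ?thesis by (rule that)
qed

lemma has_derivative_quadratic:
  fixes F :: "'a::real_normed_vector \<Rightarrow> 'b::real_normed_vector"
  assumes "bounded_linear D" and "\<And>v. norm (F (y + v) - F y - D v) \<le> K * (norm v)\<^sup>2"
  shows "(F has_derivative D) (at y)"
  unfolding has_derivative_at
proof (intro conjI assms(1))
  show "(\<lambda>h. norm (F (y + h) - F y - D h) / norm h) \<midarrow>0\<rightarrow> 0"
  proof (rule Lim_null_comparison)
    show "\<forall>\<^sub>F h in at 0. norm (norm (F (y + h) - F y - D h) / norm h) \<le> K * norm h"
      unfolding eventually_at_topological
      using assms(2) by (intro exI[of _ UNIV]) (auto simp: divide_le_eq power2_eq_square mult.assoc)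
    show "((\<lambda>h. K * norm h) \<longlongrightarrow> 0) (at 0)"
      by (auto intro!: tendsto_eq_intros)
  qed
qed

lemma schwartz_component_bounded_linear:
  "bounded_linear (\<lambda>v::'a::euclidean_space. \<Sum>b\<in>Basis. (v \<bullet> b) *\<^sub>R (c b :: complex))"
  by (intro bounded_linear_sum bounded_linear_scaleR_left[THEN bounded_linear_compose] bounded_linear_inner_left)

section \<open>Linear operations and affine substitutions on Schwartz functions\<close>

lemma partials_has_frechet_derivative:
  assumes "f \<in> schwartz" "set bs \<subseteq> Basis"
  shows "(partials bs f has_derivative frechet_derivative (partials bs f) (at x)) (at x)"
  using schwartz_differentiable[OF assms] by (simp add: frechet_derivative_works)

lemma partials_add:
  assumes "f \<in> schwartz" "g \<in> schwartz" "set bs \<subseteq> Basis"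
  shows "partials bs (\<lambda>x. f x + g x) = (\<lambda>x. partials bs f x + partials bs g x)"
  using assms(3)
proof (induction bs)
  case (Cons b bs)
  have "frechet_derivative (\<lambda>x. partials bs f x + partials bs g x) (at x) =
      (\<lambda>v. frechet_derivative (partials bs f) (at x) v + frechet_derivative (partials bs g) (at x) v)" for x
    using Cons.prems assms(1,2)
    by (intro frechet_derivative_at[symmetric] has_derivative_add)
       (auto intro!: partials_has_frechet_derivative)
  with Cons show ?case by simp
qed simp

lemma partials_cmult:
  assumes "f \<in> schwartz" "set bs \<subseteq> Basis"
  shows "partials bs (\<lambda>x. c * f x) = (\<lambda>x. c * partials bs f x)"
  using assms(2)
proof (induction bs)
  case (Cons b bs)
  have "frechet_derivative (\<lambda>x. c * partials bs f x) (at x) =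
      (\<lambda>v. c * frechet_derivative (partials bs f) (at x) v)" for x
    using Cons.prems assms(1)
    by (intro frechet_derivative_at[symmetric] has_derivative_mult_right)
       (auto intro!: partials_has_frechet_derivative)
  with Cons show ?case by simp
qed simp

lemma schwartz_add:
  assumes "f \<in> schwartz" "g \<in> schwartz"
  shows "(\<lambda>x. f x + g x) \<in> schwartz"
proof (rule schwartzI)
  fix bs :: "'a list" and x N assume bs: "set bs \<subseteq> Basis"
  show "partials bs (\<lambda>x. f x + g x) differentiable at x"
    using assms bs by (simp add: partials_add differentiable_add schwartz_differentiable)
  obtain C where C: "\<And>x. (1 + norm x) ^ N * cmod (partials bs f x) \<le> C"
    using schwartz_decay[OF assms(1) bs] by blast
  obtain D where D: "\<And>x. (1 + norm x) ^ N * cmod (partials bs g x) \<le> D"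
    using schwartz_decay[OF assms(2) bs] by blast
  have "(1 + norm x) ^ N * cmod (partials bs f x + partials bs g x) \<le> C + D" for x
  proof -
    have "(1 + norm x) ^ N * cmod (partials bs f x + partials bs g x) \<le>
        (1 + norm x) ^ N * (cmod (partials bs f x) + cmod (partials bs g x))"
      by (intro mult_left_mono norm_triangle_ineq) auto
    also have "\<dots> \<le> C + D" using C[of x] D[of x] by (simp add: distrib_left)
    finally show ?thesis .
  qed
  then show "\<exists>C. \<forall>x. (1 + norm x) ^ N * cmod (partials bs (\<lambda>x. f x + g x) x) \<le> C"
    using assms bs by (auto simp: partials_add)
qed

lemma schwartz_cmult:
  assumes "f \<in> schwartz"
  shows "(\<lambda>x. c * f x) \<in> schwartz"
proof (rule schwartzI)
  fix bs :: "'a list" and x N assume bs: "set bs \<subseteq> Basis"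
  show "partials bs (\<lambda>x. c * f x) differentiable at x"
    using assms bs by (simp add: partials_cmult differentiable_mult schwartz_differentiable)
  obtain C where C: "\<And>x. (1 + norm x) ^ N * cmod (partials bs f x) \<le> C"
    using schwartz_decay[OF assms(1) bs] by blast
  have "(1 + norm x) ^ N * cmod (c * partials bs f x) \<le> cmod c * C" for x
    using mult_left_mono[OF C[of x], of "cmod c"] by (simp add: norm_mult mult_ac)
  then show "\<exists>C. \<forall>x. (1 + norm x) ^ N * cmod (partials bs (\<lambda>x. c * f x) x) \<le> C"
    using assms bs by (auto simp: partials_cmult)
qed

lemma schwartz_diff:
  assumes "f \<in> schwartz" "g \<in> schwartz"
  shows "(\<lambda>x. f x - g x) \<in> schwartz"
  using schwartz_add[OF assms(1) schwartz_cmult[OF assms(2), of "-1"]] by simp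

lemma partials_diff:
  assumes "f \<in> schwartz" "g \<in> schwartz" "set bs \<subseteq> Basis"
  shows "partials bs (\<lambda>x. f x - g x) = (\<lambda>x. partials bs f x - partials bs g x)"
  using partials_add[OF assms(1) schwartz_cmult[OF assms(2), of "-1"] assms(3)]
    partials_cmult[OF assms(2,3), of "-1"] by simp

lemma partials_affine:
  assumes "f \<in> schwartz" "set bs \<subseteq> Basis"
  shows "partials bs (\<lambda>x. f (a + c *\<^sub>R x)) = (\<lambda>x. of_real (c ^ length bs) * partials bs f (a + c *\<^sub>R x))"
  using assms(2)
proof (induction bs)
  case (Cons b bs)
  have "frechet_derivative (\<lambda>x. of_real (c ^ length bs) * partials bs f (a + c *\<^sub>R x)) (at x) b =
      of_real (c ^ length (b # bs)) * frechet_derivative (partials bs f) (at (a + c *\<^sub>R x)) b" for x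
  proof -
    have d: "(partials bs f has_derivative frechet_derivative (partials bs f) (at (a + c *\<^sub>R x))) (at (a + c *\<^sub>R x))"
      using Cons.prems assms(1) by (intro partials_has_frechet_derivative) auto
    have "((\<lambda>x. partials bs f (a + c *\<^sub>R x)) has_derivative
        (\<lambda>v. frechet_derivative (partials bs f) (at (a + c *\<^sub>R x)) (c *\<^sub>R v))) (at x)"
      by (rule has_derivative_compose[where g = "partials bs f" and f = "\<lambda>x. a + c *\<^sub>R x" and f' = "\<lambda>v. c *\<^sub>R v", OF _ d]) (auto intro!: derivative_eq_intros)
    from frechet_derivative_at[OF has_derivative_mult_right[OF this, of "of_real (c ^ length bs)"], symmetric]
    show ?thesis
      using has_derivative_linear[OF d] by (simp add: linear_scale scaleR_conv_of_real)
  qed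
  with Cons show ?case by simp
qed simp

lemma one_plus_norm_affine_le:
  fixes x :: "'a::real_normed_vector"
  assumes "c \<noteq> 0"
  shows "1 + norm x \<le> (1 + norm a) * (1 + 1 / \<bar>c\<bar>) * (1 + norm (a + c *\<^sub>R x))"
proof -
  let ?u = "a + c *\<^sub>R x" and ?k = "1 / \<bar>c\<bar>"
  have "x = (1 / c) *\<^sub>R (?u - a)" using assms by simp
  then have "norm x = ?k * norm (?u - a)" by (metis abs_divide abs_one norm_scaleR)
  also have "\<dots> \<le> ?k * (norm ?u + norm a)" by (intro mult_left_mono norm_triangle_ineq4) auto
  finally have "1 + norm x \<le> 1 + ?k * (norm ?u + norm a)" by simp
  also have "\<dots> \<le> (1 + ?k) * (1 + norm ?u + norm a)" by (simp add: algebra_simps)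
  also have "\<dots> \<le> (1 + ?k) * ((1 + norm a) * (1 + norm ?u))"
    by (intro mult_left_mono) (auto simp: algebra_simps)
  finally show ?thesis by (simp add: mult_ac)
qed

lemma schwartz_affine:
  assumes "f \<in> schwartz" "c \<noteq> 0"
  shows "(\<lambda>x. f (a + c *\<^sub>R x)) \<in> schwartz"
proof (rule schwartzI)
  fix bs :: "'a list" and x N assume bs: "set bs \<subseteq> Basis"
  have "(\<lambda>x. partials bs f (a + c *\<^sub>R x)) differentiable at x"
    by (rule differentiable_compose[OF schwartz_differentiable[OF assms(1) bs]]) simp
  then show "partials bs (\<lambda>x. f (a + c *\<^sub>R x)) differentiable at x"
    using assms bs by (simp add: partials_affine differentiable_mult)
  obtain C where C: "C > 0" "\<And>x. (1 + norm x) ^ N * cmod (partials bs f x) \<le> C"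
    using schwartz_decay[OF assms(1) bs] by blast
  let ?K = "((1 + norm a) * (1 + 1 / \<bar>c\<bar>)) ^ N"
  have "(1 + norm x) ^ N * cmod (of_real (c ^ length bs) * partials bs f (a + c *\<^sub>R x))
      \<le> \<bar>c\<bar> ^ length bs * (?K * C)" for x
  proof -
    let ?u = "a + c *\<^sub>R x"
    have "(1 + norm x) ^ N \<le> ?K * (1 + norm ?u) ^ N"
      unfolding power_mult_distrib[symmetric] by (intro power_mono one_plus_norm_affine_le assms) simp
    then have "(1 + norm x) ^ N * cmod (partials bs f ?u) \<le> ?K * (1 + norm ?u) ^ N * cmod (partials bs f ?u)"
      by (intro mult_right_mono) auto
    also have "\<dots> \<le> ?K * C" unfolding mult.assoc by (intro mult_left_mono C) auto
    finally have "\<bar>c\<bar> ^ length bs * ((1 + norm x) ^ N * cmod (partials bs f ?u)) \<le> \<bar>c\<bar> ^ length bs * (?K * C)"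
      by (intro mult_left_mono) auto
    then show ?thesis by (simp add: norm_mult norm_power mult_ac)
  qed
  then show "\<exists>C. \<forall>x. (1 + norm x) ^ N * cmod (partials bs (\<lambda>x. f (a + c *\<^sub>R x)) x) \<le> C"
    using assms bs by (auto simp: partials_affine)
qed

lemma partials_reflect:
  assumes "f \<in> schwartz" "set bs \<subseteq> Basis"
  shows "partials bs (\<lambda>y. f (x - y)) = (\<lambda>y. (-1) ^ length bs * partials bs f (x - y))"
  using partials_affine[OF assms, of x "-1"] by simp

lemma schwartz_reflect: "f \<in> schwartz \<Longrightarrow> (\<lambda>y. f (x - y)) \<in> schwartz"
  using schwartz_affine[of f "-1" x] by simp

lemma schwartz_dilate:
  fixes f :: "'a::euclidean_space \<Rightarrow> complex"
  assumes "f \<in> schwartz" "t \<noteq> 0"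
  shows "dilate f t \<in> schwartz"
proof -
  have "(\<lambda>x. of_real (1 / t ^ DIM('a)) * f (0 + (1 / t) *\<^sub>R x)) \<in> schwartz"
    using assms by (intro schwartz_cmult schwartz_affine) auto
  moreover have "dilate f t = (\<lambda>x. of_real (1 / t ^ DIM('a)) * f (0 + (1 / t) *\<^sub>R x))"
    by (auto simp: dilate_def scaleR_conv_of_real field_simps)
  ultimately show ?thesis by simp
qed

text \<open>The superposition of the translates \<open>g (z - y)\<close> with density
  \<open>w\<close>. The orientation matches \<open>conv\<close>: applying \<open>T\<close> in
  \<open>y\<close> under the integral gives the integral of \<open>w z * conv g T z\<close>. For
  \<open>w z = \<psi> (x - z)\<close> the value is the convolution of \<open>\<psi>\<close> and
  \<open>g\<close> at \<open>x - y\<close>.\<close>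

definition smear :: "('a::euclidean_space \<Rightarrow> complex) \<Rightarrow> ('a \<Rightarrow> complex) \<Rightarrow> 'a \<Rightarrow> complex" where
  "smear w g y = (LINT z|lborel. w z * g (z - y))"

lemma integrable_mult_schwartz:
  assumes "integrable lborel w" "g \<in> schwartz"
  shows "integrable lborel (\<lambda>z. w z * g (z - y))"
proof -
  obtain C where C: "C > 0" "\<And>x. (1 + norm x) ^ 0 * cmod (g x) \<le> C"
    using schwartz_bounded[OF assms(2)] by blast
  note [measurable] = schwartz_borel[OF assms(2)] borel_measurable_integrable[OF assms(1)]
  show ?thesis
  proof (rule Bochner_Integration.integrable_bound)
    show "integrable lborel (\<lambda>z. C *\<^sub>R w z)" using assms(1) by simp
    show "AE z in lborel. norm (w z * g (z - y)) \<le> norm (C *\<^sub>R w z)"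
      using C by (intro AE_I2) (simp add: norm_mult mult.commute[of C] mult_left_mono)
  qed measurable
qed

lemma smear_has_derivative:
  assumes w: "integrable lborel w" and g: "g \<in> schwartz"
  shows "(smear w g has_derivative (\<lambda>v. \<Sum>b\<in>Basis. (v \<bullet> b) *\<^sub>R (- smear w (partials [b] g) y))) (at y)"
proof -
  obtain K where K: "K > 0"
    "\<And>x v. cmod (g (x + v) - g x - (\<Sum>b\<in>Basis. (v \<bullet> b) *\<^sub>R partials [b] g x)) \<le> K * (norm v)\<^sup>2"
    using schwartz_taylor[OF g] by blast
  have i: "integrable lborel (\<lambda>z. w z * partials [b] g (z - y))" if "b \<in> Basis" for b
    using that by (intro integrable_mult_schwartz w schwartz_partials g) auto
  show ?thesis
  proof (rule has_derivative_quadratic[OF schwartz_component_bounded_linear])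
    fix v
    \<comment> \<open>The argument \<open>z - y\<close> moves by \<open>- v\<close>, hence the sign
      inside the Taylor remainder.\<close>
    let ?r = "\<lambda>z. w z * (g (z - (y + v)) - g (z - y) - (\<Sum>b\<in>Basis. (- v \<bullet> b) *\<^sub>R partials [b] g (z - y)))"
    have eq: "?r z = w z * g (z - (y + v)) - w z * g (z - y)
        - (\<Sum>b\<in>Basis. (v \<bullet> b) *\<^sub>R - (w z * partials [b] g (z - y)))" for z
      by (simp add: algebra_simps sum_negf sum_distrib_left scaleR_conv_of_real del: partials.simps)
    have "smear w g (y + v) - smear w g y - (\<Sum>b\<in>Basis. (v \<bullet> b) *\<^sub>R (- smear w (partials [b] g) y))
        = (LINT z|lborel. ?r z)"
      unfolding eq smear_def using i integrable_mult_schwartz[OF w g]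
      by (simp add: Bochner_Integration.integral_sum Bochner_Integration.integral_diff sum_negf del: partials.simps)
    also have "norm \<dots> \<le> (LINT z|lborel. (K * (norm v)\<^sup>2) * norm (w z))"
    proof (rule Bochner_Integration.integral_norm_bound_integral)
      show "integrable lborel ?r"
        unfolding eq using i integrable_mult_schwartz[OF w g]
        by (intro Bochner_Integration.integrable_diff Bochner_Integration.integrable_sum
            integrable_scaleR_right integrable_minus) auto
      show "integrable lborel (\<lambda>z. (K * (norm v)\<^sup>2) * norm (w z))" using w by simp
      show "norm (?r z) \<le> (K * (norm v)\<^sup>2) * norm (w z)" for z
        using K(2)[of "z - y" "- v"]
        by (simp add: norm_mult mult.commute mult_left_mono diff_diff_eq del: partials.simps)
    qed
    also have "\<dots> = (K * (LINT z|lborel. norm (w z))) * (norm v)\<^sup>2" by simp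
    finally show "norm (smear w g (y + v) - smear w g y - (\<Sum>b\<in>Basis. (v \<bullet> b) *\<^sub>R (- smear w (partials [b] g) y)))
        \<le> (K * (LINT z|lborel. norm (w z))) * (norm v)\<^sup>2" .
  qed
qed

lemma partials_smear:
  assumes w: "integrable lborel w" and g: "g \<in> schwartz" and "set bs \<subseteq> Basis"
  shows "partials bs (smear w g) = (\<lambda>y. (-1) ^ length bs * smear w (partials bs g) y)"
  using assms(3)
proof (induction bs)
  case (Cons b bs)
  then have b: "b \<in> Basis" and bs: "set bs \<subseteq> Basis" by auto
  have "frechet_derivative (\<lambda>y. (-1) ^ length bs * smear w (partials bs g) y) (at y) b =
      (-1) ^ length (b # bs) * smear w (partials (b # bs) g) y" for y
  proof -
    note d = has_derivative_mult_right[OF smear_has_derivative[OF w schwartz_partials[OF g bs], of y], of "(-1) ^ length bs"]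
    have "(\<Sum>c\<in>Basis. (b \<bullet> c) *\<^sub>R (- smear w (partials [c] (partials bs g)) y)) =
       (\<Sum>c\<in>Basis. if c = b then - smear w (partials (b # bs) g) y else 0)"
      using b by (intro sum.cong) (auto simp: inner_Basis)
    also have "\<dots> = - smear w (partials (b # bs) g) y" using b by simp
    finally show ?thesis
      using fun_cong[OF frechet_derivative_at[OF d, symmetric], of b] by simp
  qed
  with Cons.IH bs show ?case by (simp only: partials.simps)
qed simp

text \<open>Peetre's inequality moves the weight from \<open>y\<close> onto \<open>w\<close> and
  \<open>h\<close>. The bound is linear in the weighted integral of \<open>w\<close>, so restricting
  \<open>w\<close> to the complement of a large box makes every seminorm small.\<close>

lemma smear_weighted_bound:
  assumes w: "integrable lborel w" "integrable lborel (\<lambda>z. (1 + norm z) ^ N * cmod (w z))"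
    and "h \<in> schwartz" and h: "\<And>u. (1 + norm u) ^ N * cmod (h u) \<le> C"
  shows "(1 + norm y) ^ N * cmod (smear w h y) \<le> C * (LINT z|lborel. (1 + norm z) ^ N * cmod (w z))"
proof -
  have "cmod (smear w h y) * (1 + norm y) ^ N = norm (LINT z|lborel. (1 + norm y) ^ N *\<^sub>R (w z * h (z - y)))"
    by (simp add: smear_def)
  also have "\<dots> \<le> (LINT z|lborel. C * ((1 + norm z) ^ N * cmod (w z)))"
  proof (rule Bochner_Integration.integral_norm_bound_integral)
    show "integrable lborel (\<lambda>z. C * ((1 + norm z) ^ N * cmod (w z)))" using w(2) by simp
    show "integrable lborel (\<lambda>z. (1 + norm y) ^ N *\<^sub>R (w z * h (z - y)))"
      by (intro integrable_scaleR_right integrable_mult_schwartz assms)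
    show "norm ((1 + norm y) ^ N *\<^sub>R (w z * h (z - y))) \<le> C * ((1 + norm z) ^ N * cmod (w z))" for z
      using mult_right_mono[OF weighted_translate_le[OF h, of y z], of "cmod (w z)"]
      by (simp add: norm_mult mult_ac)
  qed
  finally show ?thesis by (simp add: mult.commute)
qed

lemma smear_schwartz:
  assumes w: "integrable lborel w" "\<And>N. integrable lborel (\<lambda>z. (1 + norm z) ^ N * cmod (w z))"
    and g: "g \<in> schwartz"
  shows "smear w g \<in> schwartz"
proof (rule schwartzI)
  fix bs :: "'a list" and x N assume bs: "set bs \<subseteq> Basis"
  have "smear w (partials bs g) differentiable at x"
    using smear_has_derivative[OF w(1) schwartz_partials[OF g bs]] differentiable_def by blast
  then show "partials bs (smear w g) differentiable at x"
    by (simp add: partials_smear[OF w(1) g bs] differentiable_mult)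
  obtain C where C: "\<And>x. (1 + norm x) ^ N * cmod (partials bs g x) \<le> C"
    using schwartz_decay[OF g bs] by blast
  show "\<exists>C. \<forall>x. (1 + norm x) ^ N * cmod (partials bs (smear w g) x) \<le> C"
    using smear_weighted_bound[OF w schwartz_partials[OF g bs] C]
    by (auto simp: partials_smear[OF w(1) g bs] norm_mult norm_power)
qed

section \<open>Radial kernels and tempered distributions\<close>

text \<open>The single term with the least \<open>j\<close> such that
  \<open>norm x / t < 2 ^ j\<close> suffices: unless \<open>j = 0\<close>, the quotient is at least
  half of \<open>2 ^ j\<close>, and the factor \<open>2 powr m\<close> pays for this half.\<close>

lemma kernel_le_dyadic:
  fixes x :: "'a::real_normed_vector"
  assumes "m \<ge> 0" "t > 0"
  shows "ennreal ((1 + norm x / t) powr - m) \<le>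
    (\<Sum>j. ennreal (2 powr m * (2 powr - m) ^ j) * indicator (ball 0 (2 ^ j * t)) x)"
proof -
  obtain j0 where "norm x / t < 2 ^ j0" using real_arch_pow[of 2] by auto
  define j where "j = (LEAST j. norm x / t < 2 ^ j)"
  have j: "norm x / t < 2 ^ j" unfolding j_def using \<open>norm x / t < 2 ^ j0\<close> by (rule LeastI)
  have "(1 + norm x / t) powr - m \<le> 2 powr m * (2 powr - m) ^ j"
  proof (cases j)
    case 0
    have "(1 + norm x / t) powr - m \<le> 1 powr - m" using assms by (intro powr_mono2') auto
    also have "\<dots> \<le> 2 powr m" using assms by (simp add: ge_one_powr_ge_zero)
    finally show ?thesis using 0 by simp
  next
    case (Suc i)
    then have "\<not> norm x / t < 2 ^ i" unfolding j_def using not_less_Least[of i] by (metis lessI)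
    then have "(1 + norm x / t) powr - m \<le> (2 ^ i) powr - m" using assms by (intro powr_mono2') auto
    also have "\<dots> = 2 powr m * (2 powr - m) ^ j"
    proof -
      have "(2 ^ i) powr - m = (2 powr real i) powr - m" by (simp add: powr_realpow)
      also have "\<dots> = 2 powr (m + - m * real j)" by (simp add: powr_powr Suc algebra_simps)
      also have "\<dots> = 2 powr m * (2 powr - m) powr real j" by (simp only: powr_add powr_powr)
      also have "\<dots> = 2 powr m * (2 powr - m) ^ j" by (subst powr_realpow) auto
      finally show ?thesis .
    qed
    finally show ?thesis .
  qed
  then have "ennreal ((1 + norm x / t) powr - m) \<le>
      ennreal (2 powr m * (2 powr - m) ^ j) * indicator (ball 0 (2 ^ j * t)) x"
    using j assms by (auto simp: indicator_def divide_less_eq intro!: ennreal_leI)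
  also have "\<dots> = sum (\<lambda>j. ennreal (2 powr m * (2 powr - m) ^ j) * indicator (ball 0 (2 ^ j * t)) x) {j}"
    by (subst sum.insert) (simp_all only: finite.emptyI empty_iff sum.empty add_0_right not_False_eq_True)
  also have "\<dots> \<le> (\<Sum>j. ennreal (2 powr m * (2 powr - m) ^ j) * indicator (ball 0 (2 ^ j * t)) x)"
    by (intro sum_le_suminf) auto
  finally show ?thesis .
qed

lemma nn_integral_kernel:
  fixes m :: real
  assumes "m > DIM('a::euclidean_space)"
  obtains K where "K > 0"
    "\<And>t (x::'a). t > 0 \<Longrightarrow> (\<integral>\<^sup>+z. ennreal ((1 + norm (x - z) / t) powr - m) \<partial>lborel) \<le> ennreal (K * t ^ DIM('a))"
proof -
  let ?n = "DIM('a)"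
  \<comment> \<open>The ratio of the dyadic series: each step multiplies the volume of the ball by
    \<open>2 ^ ?n\<close> and the coefficient by \<open>2 powr - m\<close>. It is less than 1
    because \<open>m > ?n\<close>.\<close>
  define q where "q = 2 powr (?n - m)"
  have q: "0 < q" "q < 1" unfolding q_def using assms by (auto intro: powr_less_one)
  define K where "K = 2 powr m * unit_ball_vol ?n / (1 - q)"
  have "K > 0" unfolding K_def using q by simp
  moreover have "(\<integral>\<^sup>+z. ennreal ((1 + norm (x - z) / t) powr - m) \<partial>lborel) \<le> ennreal (K * t ^ ?n)"
    if t: "t > 0" for t and x :: 'a
  proof -
    let ?c = "2 powr m * unit_ball_vol ?n * t ^ ?n"
    have "(\<integral>\<^sup>+z. ennreal ((1 + norm (x - z) / t) powr - m) \<partial>lborel) \<le>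
        (\<integral>\<^sup>+z. (\<Sum>j. ennreal (2 powr m * (2 powr - m) ^ j) * indicator (ball x (2 ^ j * t)) z) \<partial>lborel)"
    proof (rule nn_integral_mono)
      fix z
      have "indicator (ball 0 (2 ^ j * t)) (x - z) = (indicator (ball x (2 ^ j * t)) z :: ennreal)" for j
        by (simp add: indicator_def dist_norm norm_minus_commute)
      then show "ennreal ((1 + norm (x - z) / t) powr - m) \<le>
          (\<Sum>j. ennreal (2 powr m * (2 powr - m) ^ j) * indicator (ball x (2 ^ j * t)) z)"
        using kernel_le_dyadic[of m t "x - z"] assms t by simp
    qed
    also have "\<dots> = (\<Sum>j. \<integral>\<^sup>+z. ennreal (2 powr m * (2 powr - m) ^ j) * indicator (ball x (2 ^ j * t)) z \<partial>lborel)"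
      by (rule nn_integral_suminf)
        (intro borel_measurable_times_ennreal borel_measurable_const borel_measurable_indicator, simp)
    also have "\<dots> = (\<Sum>j. ennreal (?c * q ^ j))"
    proof (rule suminf_cong)
      fix j
      have "q = 2 ^ ?n * 2 powr - m"
        unfolding q_def using powr_add[of 2 "real ?n" "- m"] powr_realpow[of 2 ?n] by simp
      then have "(2 powr - m) ^ j * (2 ^ j) ^ ?n = q ^ j"
        by (simp only: power_mult_distrib power_mult[symmetric] mult.commute[of ?n j] mult.commute[of "_ ^ _" "(2 powr - m) ^ j"])
      moreover have "2 powr m * (2 powr - m) ^ j * (unit_ball_vol ?n * (2 ^ j * t) ^ ?n) =
          ?c * ((2 powr - m) ^ j * (2 ^ j) ^ ?n)"
        by (simp only: power_mult_distrib mult_ac)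
      ultimately have e: "2 powr m * (2 powr - m) ^ j * (unit_ball_vol ?n * (2 ^ j * t) ^ ?n) = ?c * q ^ j"
        by (simp only:)
      show "(\<integral>\<^sup>+z. ennreal (2 powr m * (2 powr - m) ^ j) * indicator (ball x (2 ^ j * t)) z \<partial>lborel) = ennreal (?c * q ^ j)"
        using t by (subst nn_integral_cmult_indicator) (simp_all add: emeasure_ball ennreal_mult'[symmetric] e)
    qed
    also have "\<dots> = ennreal (K * t ^ ?n)"
    proof (rule suminf_ennreal_eq)
      have "(\<lambda>j. ?c * q ^ j) sums (?c * (1 / (1 - q)))"
        by (intro sums_mult geometric_sums) (use q in auto)
      then show "(\<lambda>j. ?c * q ^ j) sums (K * t ^ ?n)" by (simp add: K_def field_simps)
    qed (use q t in auto)
    finally show ?thesis .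
  qed
  ultimately show ?thesis by (rule that)
qed

lemma schwartz_weighted_integrable:
  fixes f :: "'a::euclidean_space \<Rightarrow> complex"
  assumes "f \<in> schwartz"
  shows "integrable lborel (\<lambda>z. (1 + norm z) ^ N * cmod (f z))"
proof (rule integrableI_bounded)
  let ?n = "DIM('a)"
  note [measurable] = schwartz_borel[OF assms]
  show "(\<lambda>z. (1 + norm z) ^ N * cmod (f z)) \<in> borel_measurable lborel" by measurable
  \<comment> \<open>The \<open>?n + 1\<close> extra powers of decay leave an integrable kernel
    behind.\<close>
  obtain C where C: "C > 0" "\<And>x. (1 + norm x) ^ (N + (?n + 1)) * cmod (f x) \<le> C"
    using schwartz_bounded[OF assms, of "N + (?n + 1)"] by metis
  obtain K where K: "K > 0" "\<And>t (x::'a). t > 0 \<Longrightarrow>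
      (\<integral>\<^sup>+z. ennreal ((1 + norm (x - z) / t) powr - (real ?n + 1)) \<partial>lborel) \<le> ennreal (K * t ^ ?n)"
    using nn_integral_kernel[of "real ?n + 1", where 'a='a] by auto
  have "(1 + norm z) ^ N * cmod (f z) \<le> C * (1 + norm z) powr - (real ?n + 1)" for z
  proof -
    have p: "(1 + norm z) ^ (?n + 1) > 0" by (intro zero_less_power add_pos_nonneg) auto
    have "(1 + norm z) powr - (real ?n + 1) = 1 / (1 + norm z) ^ (?n + 1)"
      by (metis add_pos_nonneg less_numeral_extra(1) norm_ge_zero of_nat_1 of_nat_add powr_minus_divide powr_realpow)
    moreover have "(1 + norm z) ^ N * cmod (f z) \<le> C / (1 + norm z) ^ (?n + 1)"
      using C(2)[of z] p by (simp only: pos_le_divide_eq power_add mult_ac)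
    ultimately show ?thesis by simp
  qed
  note le = this
  have "(\<integral>\<^sup>+z. ennreal (norm ((1 + norm z) ^ N * cmod (f z))) \<partial>lborel) \<le>
     (\<integral>\<^sup>+(z::'a). ennreal C * ennreal ((1 + norm (0 - z) / 1) powr - (real ?n + 1)) \<partial>lborel)"
  proof (rule nn_integral_mono)
    fix z :: 'a
    have "norm ((1 + norm z) ^ N * cmod (f z)) \<le> C * (1 + norm (0 - z) / 1) powr - (real ?n + 1)"
      using le[of z] by (simp add: abs_mult)
    then show "ennreal (norm ((1 + norm z) ^ N * cmod (f z))) \<le>
        ennreal C * ennreal ((1 + norm (0 - z) / 1) powr - (real ?n + 1))"
      unfolding ennreal_mult'[OF less_imp_le[OF C(1)], symmetric] by (rule ennreal_leI)
  qed
  also have "\<dots> = ennreal C * (\<integral>\<^sup>+(z::'a). ennreal ((1 + norm (0 - z) / 1) powr - (real ?n + 1)) \<partial>lborel)"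
    by (rule nn_integral_cmult) simp
  also have "\<dots> \<le> ennreal C * ennreal (K * 1 ^ ?n)" by (intro mult_left_mono K) auto
  also have "\<dots> < \<infinity>" by (simp add: ennreal_mult_less_top)
  finally show "(\<integral>\<^sup>+z. ennreal (norm ((1 + norm z) ^ N * cmod (f z))) \<partial>lborel) < \<infinity>" .
qed

lemma schwartz_integrable:
  assumes "f \<in> schwartz"
  shows "integrable lborel f"
proof -
  note [measurable] = schwartz_borel[OF assms]
  have "integrable lborel (\<lambda>z. cmod (f z))" using schwartz_weighted_integrable[OF assms, of 0] by simp
  then show ?thesis by (simp add: integrable_norm_iff)
qed

section \<open>Seminorm bounds and linearity for tempered distributions\<close>

definition multi_indices :: "nat \<Rightarrow> 'a::euclidean_space list set" where
  "multi_indices N = {bs. set bs \<subseteq> Basis \<and> length bs \<le> N}"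

lemma finite_multi_indices: "finite (multi_indices N)"
  unfolding multi_indices_def by (rule finite_lists_length_le) simp

text \<open>The seminorm is a real supremum, meaningful only for bounded families; finitely many
  bounds \<open>B bs\<close>, one per multi-index, bound it by their sum. Estimates can then be made
  one derivative at a time. The constant of the distribution may be negative, hence
  \<open>\<bar>C\<bar>\<close>.\<close>

lemma tempered_bound:
  fixes T :: "('a::euclidean_space \<Rightarrow> complex) \<Rightarrow> complex"
  assumes "T \<in> tempered_distribution"
  obtains K N where "K \<ge> 0"
    "\<And>f B. f \<in> schwartz \<Longrightarrow>
      (\<And>bs y. bs \<in> multi_indices N \<Longrightarrow> (1 + norm y) ^ N * cmod (partials bs f y) \<le> B bs) \<Longrightarrow>
      cmod (T f) \<le> K * (\<Sum>bs\<in>multi_indices N. B bs)"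
proof -
  obtain C N where C: "\<And>f. f \<in> schwartz \<Longrightarrow> cmod (T f) \<le> C * schwartz_seminorm N f"
    using assms unfolding tempered_distribution_def by blast
  have "cmod (T f) \<le> \<bar>C\<bar> * (\<Sum>bs\<in>multi_indices N. B bs)"
    if f: "f \<in> schwartz" and B: "\<And>bs y. bs \<in> multi_indices N \<Longrightarrow> (1 + norm y) ^ N * cmod (partials bs f y) \<le> B bs"
    for f :: "'a \<Rightarrow> complex" and B
  proof -
    let ?S = "{bs::'a list. set bs \<subseteq> Basis \<and> length bs \<le> N} \<times> UNIV"
    have B0: "B bs \<ge> 0" if "bs \<in> multi_indices N" for bs
      by (rule order_trans[OF _ B[OF that, of 0]]) simp
    have le: "(1 + norm x) ^ N * cmod (partials bs f x) \<le> (\<Sum>bs\<in>multi_indices N. B bs)"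
      if "(bs, x) \<in> ?S" for bs x
    proof -
      have bs: "bs \<in> multi_indices N" using that by (simp add: multi_indices_def)
      have "B bs \<le> (\<Sum>bs\<in>multi_indices N. B bs)"
        using B0 by (intro member_le_sum[OF bs] finite_multi_indices) auto
      then show ?thesis using B[OF bs, of x] by linarith
    qed
    define F where "F = (\<lambda>z. (1 + norm (snd z)) ^ N * cmod (partials (fst z) f (snd z)))"
    have sup: "schwartz_seminorm N f = Sup (F ` ?S)"
      unfolding schwartz_seminorm_def F_def case_prod_unfold ..
    have nil: "([], 0) \<in> ?S" by simp
    have F: "F z \<le> (\<Sum>bs\<in>multi_indices N. B bs)" if "z \<in> ?S" for z
      unfolding F_def using le[of "fst z" "snd z"] that by (simp only: prod.collapse)
    have "schwartz_seminorm N f \<le> (\<Sum>bs\<in>multi_indices N. B bs)"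
      unfolding sup by (rule cSUP_least[OF _ F]) (use nil in blast)
    moreover have "0 \<le> schwartz_seminorm N f"
    proof -
      have "0 \<le> F ([], 0)" by (simp add: F_def)
      also have "\<dots> \<le> schwartz_seminorm N f"
        unfolding sup by (rule cSUP_upper[OF nil bdd_aboveI2[OF F]])
      finally show ?thesis .
    qed
    ultimately have "C * schwartz_seminorm N f \<le> \<bar>C\<bar> * (\<Sum>bs\<in>multi_indices N. B bs)"
      by (intro mult_mono) auto
    with C[OF f] show ?thesis by linarith
  qed
  then show ?thesis by (intro that[of "\<bar>C\<bar>" N]) auto
qed

lemma tempered_cmult:
  "T \<in> tempered_distribution \<Longrightarrow> f \<in> schwartz \<Longrightarrow> T (\<lambda>x. c * f x) = c * T f"
  unfolding tempered_distribution_def by simp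

lemma tempered_add:
  "T \<in> tempered_distribution \<Longrightarrow> f \<in> schwartz \<Longrightarrow> g \<in> schwartz \<Longrightarrow> T (\<lambda>x. f x + g x) = T f + T g"
  unfolding tempered_distribution_def by simp

lemma tempered_diff:
  assumes "T \<in> tempered_distribution" "f \<in> schwartz" "g \<in> schwartz"
  shows "T (\<lambda>x. f x - g x) = T f - T g"
proof -
  have "T (\<lambda>x. f x + (- 1) * g x) = T f + T (\<lambda>x. (- 1) * g x)"
    by (rule tempered_add[OF assms(1,2) schwartz_cmult[OF assms(3)]])
  also have "T (\<lambda>x. (- 1) * g x) = (- 1) * T g"
    using assms by (simp only: tempered_cmult)
  finally show ?thesis by simp
qed

text \<open>Additivity of \<open>T\<close> is available on \<open>schwartz\<close> only, so
  membership of the partial sums is part of the induction.\<close>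

lemma tempered_sum:
  assumes "T \<in> tempered_distribution" "\<And>i. i \<in> I \<Longrightarrow> f i \<in> schwartz" "finite I"
  shows "T (\<lambda>x. \<Sum>i\<in>I. f i x) = (\<Sum>i\<in>I. T (f i)) \<and> (\<lambda>x. \<Sum>i\<in>I. f i x) \<in> schwartz"
  using assms(3,2)
proof (induction I)
  case empty
  have z: "(\<lambda>x::'a. 0 :: complex) \<in> schwartz"
  proof (rule schwartzI)
    have e: "partials bs (\<lambda>x::'a. 0 :: complex) = (\<lambda>x. 0)" for bs
      by (induction bs) (auto simp: frechet_derivative_const)
    show "partials bs (\<lambda>x::'a. 0 :: complex) differentiable at x" for bs and x :: 'a
      by (simp add: e)
    show "\<exists>C. \<forall>x. (1 + norm x) ^ N * cmod (partials bs (\<lambda>x::'a. 0 :: complex) x) \<le> C" for bs N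
      by (auto simp: e)
  qed
  then show ?case using tempered_cmult[OF assms(1) z, of 0] by simp
next
  case (insert i I)
  then show ?case
    using schwartz_add[of "f i" "\<lambda>x. \<Sum>i\<in>I. f i x"] tempered_add[OF assms(1), of "f i" "\<lambda>x. \<Sum>i\<in>I. f i x"]
    by simp
qed

text \<open>Finitely many seminorms control \<open>T\<close>, and the translates of \<open>g\<close>
  are Lipschitz for each of them near \<open>z0\<close>. Convolutions with \<open>T\<close> thereby
  become measurable, and integrable on boxes.\<close>

lemma tempered_translate_continuous:
  assumes T: "T \<in> tempered_distribution" and g: "g \<in> schwartz"
  shows "continuous_on UNIV (\<lambda>z. T (\<lambda>y. g (z - y)))"
proof -
  obtain K N where K: "K \<ge> 0" "\<And>f B. f \<in> schwartz \<Longrightarrow>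
      (\<And>bs y. bs \<in> multi_indices N \<Longrightarrow> (1 + norm y) ^ N * cmod (partials bs f y) \<le> B bs) \<Longrightarrow>
      cmod (T f) \<le> K * (\<Sum>bs\<in>multi_indices N. B bs)"
    using tempered_bound[OF T] by metis
  have "isCont (\<lambda>z. T (\<lambda>y. g (z - y))) z0" for z0
  proof -
    let ?R = "norm z0 + 1"
    have "\<exists>C. C > 0 \<and> (\<forall>z z' y. norm z \<le> ?R \<longrightarrow> norm z' \<le> ?R \<longrightarrow>
       (1 + norm y) ^ N * cmod (partials bs g (z - y) - partials bs g (z' - y)) \<le> C * norm (z - z'))"
      if "set bs \<subseteq> Basis" for bs
      using schwartz_translate_lipschitz[OF schwartz_partials[OF g that], of ?R N] by metis
    then obtain L where L: "\<And>bs. set bs \<subseteq> Basis \<Longrightarrow> L bs > 0"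
       "\<And>bs z z' y. set bs \<subseteq> Basis \<Longrightarrow> norm z \<le> ?R \<Longrightarrow> norm z' \<le> ?R \<Longrightarrow>
       (1 + norm y) ^ N * cmod (partials bs g (z - y) - partials bs g (z' - y)) \<le> L bs * norm (z - z')"
      by metis
    have "norm (T (\<lambda>y. g (z - y)) - T (\<lambda>y. g (z0 - y))) \<le> K * (\<Sum>bs\<in>multi_indices N. L bs * norm (z - z0))"
      if z: "norm z \<le> ?R" for z
    proof -
      have "cmod (T (\<lambda>y. g (z - y) - g (z0 - y))) \<le> K * (\<Sum>bs\<in>multi_indices N. L bs * norm (z - z0))"
      proof (rule K(2))
        show "(\<lambda>y. g (z - y) - g (z0 - y)) \<in> schwartz" by (intro schwartz_diff schwartz_reflect g)
        fix bs :: "'a list" and y assume "bs \<in> multi_indices N"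
        then have bs: "set bs \<subseteq> Basis" by (simp add: multi_indices_def)
        show "(1 + norm y) ^ N * cmod (partials bs (\<lambda>y. g (z - y) - g (z0 - y)) y) \<le> L bs * norm (z - z0)"
          using L(2)[OF bs z, of z0 y] bs
          by (simp add: partials_diff schwartz_reflect g partials_reflect right_diff_distrib[symmetric] norm_mult norm_power)
      qed
      then show ?thesis by (simp add: tempered_diff[OF T] schwartz_reflect g)
    qed
    moreover have "\<forall>\<^sub>F z in at z0. norm z \<le> ?R"
      unfolding eventually_at by (intro exI[of _ 1]) (auto simp: dist_norm, smt (verit) norm_triangle_sub)
    ultimately have "\<forall>\<^sub>F z in at z0. norm (T (\<lambda>y. g (z - y)) - T (\<lambda>y. g (z0 - y))) \<le>
        K * (\<Sum>bs\<in>multi_indices N. L bs * norm (z - z0))"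
      by (rule eventually_mono[rotated])
    moreover have "((\<lambda>z. K * (\<Sum>bs\<in>multi_indices N. L bs * norm (z - z0))) \<longlongrightarrow> 0) (at z0)"
      by (auto intro!: tendsto_eq_intros)
    ultimately have "((\<lambda>z. T (\<lambda>y. g (z - y)) - T (\<lambda>y. g (z0 - y))) \<longlongrightarrow> 0) (at z0)"
      by (rule Lim_null_comparison)
    then show ?thesis unfolding isCont_def by (rule LIM_zero_cancel)
  qed
  then show ?thesis by (simp add: continuous_at_imp_continuous_on)
qed

section \<open>Moving a distribution under an integral by Riemann sums\<close>

lemma integrable_indicator_mult:
  fixes w :: "'a::euclidean_space \<Rightarrow> complex"
  assumes "S \<in> sets lborel" "integrable lborel w"
  shows "integrable lborel (\<lambda>z. indicator S z * w z)"
proof -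
  note [measurable] = borel_measurable_integrable[OF assms(2)] assms(1)
  show ?thesis
    by (rule Bochner_Integration.integrable_bound[OF assms(2)]) (auto simp: indicator_def)
qed

lemma weighted_integrable_indicator_mult:
  fixes w :: "'a::euclidean_space \<Rightarrow> complex"
  assumes S: "S \<in> sets lborel" and w: "integrable lborel w"
    and wN: "integrable lborel (\<lambda>z. (1 + norm z) ^ N * cmod (w z))"
  shows "integrable lborel (\<lambda>z. (1 + norm z) ^ N * cmod (indicator S z * w z))"
proof -
  note [measurable] = borel_measurable_integrable[OF w] S
  show ?thesis
    by (rule Bochner_Integration.integrable_bound[OF wN]) (auto simp: indicator_def)
qed

lemma indicator_scaleR_complex: "indicat_real S z *\<^sub>R (x :: complex) = indicator S z * x"
  by (simp add: indicator_def)

text \<open>On a box the Lebesgue integral is also a gauge integral, so it can be split along tagged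
  divisions.\<close>

lemma smear_cbox:
  assumes w: "integrable lborel w" and g: "g \<in> schwartz"
  shows "(\<lambda>z. w z * g (z - y)) integrable_on cbox a b"
    and "smear (\<lambda>z. indicator (cbox a b) z * w z) g y = integral (cbox a b) (\<lambda>z. w z * g (z - y))"
proof -
  have "set_integrable lborel (cbox a b) (\<lambda>z. w z * g (z - y))"
    unfolding set_integrable_def
    using integrable_mult_schwartz[OF integrable_indicator_mult[OF _ w, of "cbox a b"] g, of y]
    by (simp add: indicator_scaleR_complex mult.assoc)
  from set_borel_integral_eq_integral[OF this]
  show "(\<lambda>z. w z * g (z - y)) integrable_on cbox a b"
    and "smear (\<lambda>z. indicator (cbox a b) z * w z) g y = integral (cbox a b) (\<lambda>z. w z * g (z - y))"
    by (auto simp: smear_def set_lebesgue_integral_def indicator_scaleR_complex mult.assoc)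
qed

text \<open>The integrand of \<open>smear\<close> oscillates little on small cells, with a bound
  that survives the weight in \<open>y\<close>; this is the error of one term of a Riemann
  sum.\<close>

lemma mult_translate_lipschitz:
  fixes w h :: "'a::euclidean_space \<Rightarrow> complex"
  assumes w: "w \<in> schwartz" and h: "h \<in> schwartz"
  obtains L where "L > 0"
    "\<And>z z' y. norm z \<le> R \<Longrightarrow> norm z' \<le> R \<Longrightarrow>
       (1 + norm y) ^ N * cmod (w z * h (z - y) - w z' * h (z' - y)) \<le> L * norm (z - z')"
proof -
  obtain A where A: "A > 0" "\<And>z z' y. norm z \<le> R \<Longrightarrow> norm z' \<le> R \<Longrightarrow>
       (1 + norm y) ^ N * cmod (h (z - y) - h (z' - y)) \<le> A * norm (z - z')"
    using schwartz_translate_lipschitz[OF h] by metis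
  obtain B where B: "B > 0" "\<And>x. (1 + norm x) ^ N * cmod (h x) \<le> B"
    using schwartz_bounded[OF h] by metis
  obtain C where C: "C > 0" "\<And>x. (1 + norm x) ^ 0 * cmod (w x) \<le> C"
    using schwartz_bounded[OF w] by metis
  obtain D where D: "D > 0" "\<And>x y. cmod (w x - w y) \<le> D * norm (x - y)"
    using schwartz_lipschitz[OF w] by metis
  define L where "L = C * A + D * (B * (1 + \<bar>R\<bar>) ^ N)"
  have "(1 + \<bar>R\<bar>) ^ N > 0" by (rule zero_less_power) simp
  then have "L > 0" unfolding L_def using A(1) B(1) C(1) D(1) by (intro add_pos_pos mult_pos_pos)
  moreover have "(1 + norm y) ^ N * cmod (w z * h (z - y) - w z' * h (z' - y)) \<le> L * norm (z - z')"
    if z: "norm z \<le> R" "norm z' \<le> R" for z z' y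
  proof -
    let ?W = "(1 + norm y) ^ N"
    have "w z * h (z - y) - w z' * h (z' - y) = w z * (h (z - y) - h (z' - y)) + (w z - w z') * h (z' - y)"
      by (simp add: algebra_simps)
    then have "cmod (w z * h (z - y) - w z' * h (z' - y)) \<le>
        cmod (w z) * cmod (h (z - y) - h (z' - y)) + cmod (w z - w z') * cmod (h (z' - y))"
      by (metis norm_mult norm_triangle_ineq)
    then have "?W * cmod (w z * h (z - y) - w z' * h (z' - y)) \<le>
        ?W * (cmod (w z) * cmod (h (z - y) - h (z' - y)) + cmod (w z - w z') * cmod (h (z' - y)))"
      by (intro mult_left_mono) auto
    also have "\<dots> = cmod (w z) * (?W * cmod (h (z - y) - h (z' - y))) + cmod (w z - w z') * (?W * cmod (h (z' - y)))"
      by (simp add: algebra_simps)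
    also have "\<dots> \<le> C * (A * norm (z - z')) + (D * norm (z - z')) * (B * (1 + \<bar>R\<bar>) ^ N)"
    proof (rule add_mono)
      show "cmod (w z) * (?W * cmod (h (z - y) - h (z' - y))) \<le> C * (A * norm (z - z'))"
        using C(2)[of z] A(2)[OF z, of y] C(1) by (intro mult_mono[where c = "_ * _"]) auto
      have "?W * cmod (h (z' - y)) \<le> B * (1 + norm z') ^ N" by (rule weighted_translate_le) (rule B)
      also have "\<dots> \<le> B * (1 + \<bar>R\<bar>) ^ N" using B z by (intro mult_left_mono power_mono) auto
      finally show "cmod (w z - w z') * (?W * cmod (h (z' - y))) \<le>
          D * norm (z - z') * (B * (1 + \<bar>R\<bar>) ^ N)"
        using D(2)[of z z'] D(1) by (intro mult_mono[where a = "cmod _"]) auto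
    qed
    also have "\<dots> = L * norm (z - z')" by (simp add: L_def algebra_simps)
    finally show ?thesis .
  qed
  ultimately show ?thesis by (rule that)
qed

text \<open>Replacing the integrand on a cell by its value at the tag changes each seminorm by at
  most a constant times \<open>\<delta>\<close> times the volume of the cell. Proportionality to the
  volume lets the errors of a whole division add up.\<close>

lemma tempered_smear_cell:
  fixes w g :: "'a::euclidean_space \<Rightarrow> complex"
  assumes T: "T \<in> tempered_distribution" and w: "w \<in> schwartz" and g: "g \<in> schwartz"
  obtains L where "L > 0"
    "\<And>z0 c d \<delta>. z0 \<in> cbox c d \<Longrightarrow> cbox c d \<subseteq> cball 0 R \<Longrightarrow> cbox c d \<subseteq> cball z0 \<delta> \<Longrightarrow>
       cmod (measure lborel (cbox c d) *\<^sub>R (w z0 * T (\<lambda>y. g (z0 - y))) -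
         T (smear (\<lambda>z. indicator (cbox c d) z * w z) g)) \<le> L * \<delta> * measure lborel (cbox c d)"
proof -
  obtain K N where K: "K \<ge> 0" "\<And>f B. f \<in> schwartz \<Longrightarrow>
      (\<And>bs y. bs \<in> multi_indices N \<Longrightarrow> (1 + norm y) ^ N * cmod (partials bs f y) \<le> B bs) \<Longrightarrow>
      cmod (T f) \<le> K * (\<Sum>bs\<in>multi_indices N. B bs)"
    using tempered_bound[OF T] by metis
  have "\<exists>L. L > 0 \<and> (\<forall>z z' y. norm z \<le> R \<longrightarrow> norm z' \<le> R \<longrightarrow>
     (1 + norm y) ^ N * cmod (w z * partials bs g (z - y) - w z' * partials bs g (z' - y)) \<le> L * norm (z - z'))"
    if "set bs \<subseteq> Basis" for bs
    using mult_translate_lipschitz[OF w schwartz_partials[OF g that], of R N] by metis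
  then obtain M where M: "\<And>bs. set bs \<subseteq> Basis \<Longrightarrow> M bs > 0"
     "\<And>bs z z' y. set bs \<subseteq> Basis \<Longrightarrow> norm z \<le> R \<Longrightarrow> norm z' \<le> R \<Longrightarrow>
     (1 + norm y) ^ N * cmod (w z * partials bs g (z - y) - w z' * partials bs g (z' - y)) \<le> M bs * norm (z - z')"
    by metis
  \<comment> \<open>The summand 1 secures \<open>L > 0\<close> also when
    \<open>K = 0\<close>.\<close>
  define L where "L = 1 + K * (\<Sum>bs\<in>multi_indices N. M bs)"
  have "(\<Sum>bs\<in>multi_indices N. M bs) \<ge> 0"
    using M(1) by (intro sum_nonneg less_imp_le) (auto simp: multi_indices_def)
  with K(1) have "L > 0" by (simp add: L_def add_pos_nonneg)
  moreover have "cmod (measure lborel (cbox c d) *\<^sub>R (w z0 * T (\<lambda>y. g (z0 - y))) -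
         T (smear (\<lambda>z. indicator (cbox c d) z * w z) g)) \<le> L * \<delta> * measure lborel (cbox c d)"
    if z0: "z0 \<in> cbox c d" and R: "cbox c d \<subseteq> cball 0 R" and \<delta>: "cbox c d \<subseteq> cball z0 \<delta>" for z0 c d \<delta>
  proof -
    let ?k = "cbox c d"
    let ?u = "\<lambda>z. indicator ?k z * w z"
    let ?a = "of_real (measure lborel ?k) * w z0"
    have "\<delta> \<ge> 0" using z0 \<delta> by force
    have iw: "integrable lborel w" by (rule schwartz_integrable[OF w])
    have iu: "integrable lborel ?u" by (intro integrable_indicator_mult iw) simp
    have su: "smear ?u g \<in> schwartz"
      by (intro smear_schwartz iu g weighted_integrable_indicator_mult iw schwartz_weighted_integrable w) simp
    have sg: "(\<lambda>y. g (z0 - y)) \<in> schwartz" by (rule schwartz_reflect[OF g])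
    let ?f = "\<lambda>y. ?a * g (z0 - y) - smear ?u g y"
    have sa: "(\<lambda>y. ?a * g (z0 - y)) \<in> schwartz" by (rule schwartz_cmult[OF sg])
    have "cmod (T ?f) \<le> K * (\<Sum>bs\<in>multi_indices N. M bs * \<delta> * measure lborel ?k)"
    proof (rule K(2))
      show "?f \<in> schwartz" by (rule schwartz_diff[OF sa su])
      fix bs :: "'a list" and y :: 'a assume "bs \<in> multi_indices N"
      then have bs: "set bs \<subseteq> Basis" by (simp add: multi_indices_def)
      note h = schwartz_partials[OF g bs]
      let ?h = "partials bs g"
      let ?W = "(1 + norm y) ^ N"
      have W: "?W > 0" by (intro zero_less_power add_pos_nonneg) auto
      have "partials bs ?f y = (-1) ^ length bs * (?a * ?h (z0 - y) - smear ?u ?h y)"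
        by (simp only: partials_diff[OF sa su bs] partials_cmult[OF sg bs] partials_reflect[OF g bs]
            partials_smear[OF iu g bs]) (simp add: algebra_simps)
      then have "?W * cmod (partials bs ?f y) = ?W * cmod (?a * ?h (z0 - y) - smear ?u ?h y)"
        by (simp add: norm_mult norm_power)
      also have "\<dots> \<le> ?W * (M bs * \<delta> / ?W * measure lborel ?k)"
      proof (intro mult_left_mono)
        have "((\<lambda>z. w z0 * ?h (z0 - y) - w z * ?h (z - y)) has_integral
            measure lborel ?k *\<^sub>R (w z0 * ?h (z0 - y)) - smear ?u ?h y) ?k"
          unfolding smear_cbox(2)[OF iw h]
          by (intro has_integral_diff has_integral_const integrable_integral smear_cbox(1)[OF iw h])
        then have "cmod (measure lborel ?k *\<^sub>R (w z0 * ?h (z0 - y)) - smear ?u ?h y) \<le> (M bs * \<delta> / ?W) * measure lborel ?k"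
        proof (rule has_integral_bound[rotated])
          show "0 \<le> M bs * \<delta> / ?W" using M(1)[OF bs] \<open>\<delta> \<ge> 0\<close> W by (intro divide_nonneg_pos mult_nonneg_nonneg) auto
          fix z assume z: "z \<in> ?k"
          have "?W * cmod (w z0 * ?h (z0 - y) - w z * ?h (z - y)) \<le> M bs * norm (z0 - z)"
            using z z0 R by (intro M(2)[OF bs]) auto
          also have "\<dots> \<le> M bs * \<delta>" using z \<delta> M(1)[OF bs] by (intro mult_left_mono) (auto simp: dist_norm)
          finally show "cmod (w z0 * ?h (z0 - y) - w z * ?h (z - y)) \<le> M bs * \<delta> / ?W"
            using W by (simp only: pos_le_divide_eq mult.commute)
        qed
        then show "cmod (?a * ?h (z0 - y) - smear ?u ?h y) \<le> M bs * \<delta> / ?W * measure lborel ?k"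
          by (simp only: scaleR_conv_of_real mult.assoc)
      qed (use W in simp)
      also have "\<dots> = M bs * \<delta> * measure lborel ?k"
        using nonzero_mult_div_cancel_left[of ?W "M bs * \<delta>"] W by (simp only: mult.assoc[symmetric] times_divide_eq_right)
      finally show "?W * cmod (partials bs ?f y) \<le> M bs * \<delta> * measure lborel ?k" .
    qed
    also have "\<dots> = (K * (\<Sum>bs\<in>multi_indices N. M bs)) * (\<delta> * measure lborel ?k)"
      by (simp add: sum_distrib_right[symmetric] mult.assoc)
    also have "\<dots> \<le> L * (\<delta> * measure lborel ?k)" using \<open>\<delta> \<ge> 0\<close> unfolding L_def by (intro mult_right_mono) auto
    finally have "cmod (T ?f) \<le> L * \<delta> * measure lborel ?k" by (simp only: mult.assoc)
    moreover have "T ?f = measure lborel ?k *\<^sub>R (w z0 * T (\<lambda>y. g (z0 - y))) - T (smear ?u g)"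
      unfolding tempered_diff[OF T sa su] tempered_cmult[OF T sg] by (simp only: scaleR_conv_of_real mult.assoc)
    ultimately show ?thesis by simp
  qed
  ultimately show ?thesis by (rule that)
qed

text \<open>The interval function that sends a cell to \<open>T\<close> of the smear with
  \<open>w\<close> cut off to this cell is additive over divisions, and it agrees with each Riemann
  term up to \<open>L * \<delta>\<close> times the volume. This is the definition of the gauge
  integral, with a constant gauge.\<close>

lemma tempered_smear_has_integral:
  fixes w g :: "'a::euclidean_space \<Rightarrow> complex"
  assumes T: "T \<in> tempered_distribution" and w: "w \<in> schwartz" and g: "g \<in> schwartz"
  shows "((\<lambda>z. w z * T (\<lambda>y. g (z - y))) has_integral T (smear (\<lambda>z. indicator (cbox a b) z * w z) g)) (cbox a b)"
proof -
  let ?I = "\<lambda>k. T (smear (\<lambda>z. indicator k z * w z) g)"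
  obtain R where R: "cbox a b \<subseteq> cball 0 R"
    using bounded_cbox[of a b] by (auto simp: bounded_iff subset_eq)
  obtain L where L: "L > 0"
    "\<And>z0 c d \<delta>. z0 \<in> cbox c d \<Longrightarrow> cbox c d \<subseteq> cball 0 R \<Longrightarrow> cbox c d \<subseteq> cball z0 \<delta> \<Longrightarrow>
       cmod (measure lborel (cbox c d) *\<^sub>R (w z0 * T (\<lambda>y. g (z0 - y))) - ?I (cbox c d)) \<le> L * \<delta> * measure lborel (cbox c d)"
    by (rule tempered_smear_cell[OF T w g, of R]) blast
  have iw: "integrable lborel w" by (rule schwartz_integrable[OF w])
  \<comment> \<open>The cells of a tagged division overlap in null sets, so the cut-off smears add
    up pointwise in \<open>y\<close>; linearity of \<open>T\<close> does the rest.\<close>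
  have add: "?I (cbox a b) = (\<Sum>(x, k)\<in>D. ?I k)" if D: "D tagged_division_of (cbox a b)" for D
  proof -
    have f: "finite D" using D by blast
    have box: "\<exists>c d. snd xk = cbox c d" if "xk \<in> D" for xk
      using tagged_division_ofD(4)[OF D, of "fst xk" "snd xk"] that by simp
    have "smear (\<lambda>z. indicator (cbox a b) z * w z) g y =
        (\<Sum>xk\<in>D. smear (\<lambda>z. indicator (snd xk) z * w z) g y)" for y
    proof -
      have "smear (\<lambda>z. indicator (cbox a b) z * w z) g y = (\<Sum>(x, k)\<in>D. integral k (\<lambda>z. w z * g (z - y)))"
        unfolding smear_cbox(2)[OF iw g]
        by (rule integral_combine_tagged_division_topdown[OF smear_cbox(1)[OF iw g] D])
      also have "\<dots> = (\<Sum>xk\<in>D. smear (\<lambda>z. indicator (snd xk) z * w z) g y)"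
        unfolding case_prod_unfold
      proof (rule sum.cong[OF refl])
        fix xk assume "xk \<in> D"
        then obtain c d where "snd xk = cbox c d" using box by blast
        then show "integral (snd xk) (\<lambda>z. w z * g (z - y)) = smear (\<lambda>z. indicator (snd xk) z * w z) g y"
          by (simp add: smear_cbox(2)[OF iw g])
      qed
      finally show ?thesis .
    qed
    then have "?I (cbox a b) = T (\<lambda>y. \<Sum>xk\<in>D. smear (\<lambda>z. indicator (snd xk) z * w z) g y)"
      by (intro arg_cong[of _ _ T] ext)
    also have "\<dots> = (\<Sum>xk\<in>D. ?I (snd xk))"
    proof (rule tempered_sum[OF T _ f, THEN conjunct1])
      fix xk assume "xk \<in> D"
      then obtain c d where "snd xk = cbox c d" using box by blast
      then show "smear (\<lambda>z. indicator (snd xk) z * w z) g \<in> schwartz"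
        by (simp only:) (intro smear_schwartz integrable_indicator_mult g weighted_integrable_indicator_mult
              iw schwartz_weighted_integrable w; simp)
    qed
    finally show ?thesis by (simp add: case_prod_unfold)
  qed
  show ?thesis
    unfolding has_integral
  proof (intro allI impI)
    fix e :: real assume e: "e > 0"
    \<comment> \<open>The \<open>+ 1\<close> covers boxes of measure zero, and the factor 2 makes
      the final inequality strict.\<close>
    define \<delta> where "\<delta> = e / (2 * L * (measure lborel (cbox a b) + 1))"
    have \<delta>: "\<delta> > 0" unfolding \<delta>_def using e L(1) by (intro divide_pos_pos mult_pos_pos) (auto simp: add_nonneg_pos)
    show "\<exists>\<gamma>. gauge \<gamma> \<and> (\<forall>D. D tagged_division_of cbox a b \<and> \<gamma> fine D \<longrightarrow>
        norm ((\<Sum>(x, k)\<in>D. measure lborel k *\<^sub>R (w x * T (\<lambda>y. g (x - y)))) - ?I (cbox a b)) < e)"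
    proof (intro exI[of _ "\<lambda>x. ball x \<delta>"] conjI allI impI)
      show "gauge (\<lambda>x. ball x \<delta>)" using \<delta> by (rule gauge_ball)
      fix D assume "D tagged_division_of cbox a b \<and> (\<lambda>x. ball x \<delta>) fine D"
      then have D: "D tagged_division_of cbox a b" and fine: "(\<lambda>x. ball x \<delta>) fine D" by auto
      have "norm ((\<Sum>(x, k)\<in>D. measure lborel k *\<^sub>R (w x * T (\<lambda>y. g (x - y)))) - ?I (cbox a b)) =
          norm (\<Sum>xk\<in>D. measure lborel (snd xk) *\<^sub>R (w (fst xk) * T (\<lambda>y. g (fst xk - y))) - ?I (snd xk))"
        by (simp add: add[OF D] case_prod_unfold sum_subtractf)
      also have "\<dots> \<le> (\<Sum>xk\<in>D. L * \<delta> * measure lborel (snd xk))"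
      proof (rule sum_norm_le)
        fix xk assume xk: "xk \<in> D"
        then have xk': "(fst xk, snd xk) \<in> D" by simp
        obtain c d where k: "snd xk = cbox c d" using tagged_division_ofD(4)[OF D xk'] by blast
        have "snd xk \<subseteq> ball (fst xk) \<delta>" using fine xk' unfolding fine_def by blast
        then have "snd xk \<subseteq> cball (fst xk) \<delta>" by (meson ball_subset_cball subset_trans)
        then show "norm (measure lborel (snd xk) *\<^sub>R (w (fst xk) * T (\<lambda>y. g (fst xk - y))) - ?I (snd xk)) \<le>
            L * \<delta> * measure lborel (snd xk)"
          using tagged_division_ofD(2,3)[OF D xk'] R unfolding k by (intro L(2)) auto
      qed
      also have "\<dots> = L * \<delta> * measure lborel (cbox a b)"
        using additive_content_tagged_division[OF D] by (simp add: case_prod_unfold sum_distrib_left[symmetric])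
      also have "\<dots> < e"
      proof -
        have "L * \<delta> * measure lborel (cbox a b) \<le> L * \<delta> * (measure lborel (cbox a b) + 1)"
          using L(1) \<delta> by (intro mult_left_mono) auto
        also have "\<dots> = e / 2"
        proof -
          have "L * (e / (2 * L * c)) * c = e / 2" if "c > 0" for c using that L(1) by simp
          then show ?thesis unfolding \<delta>_def by (metis add_nonneg_pos measure_nonneg zero_less_one)
        qed
        also have "\<dots> < e" using e by simp
        finally show ?thesis .
      qed
      finally show "norm ((\<Sum>(x, k)\<in>D. measure lborel k *\<^sub>R (w x * T (\<lambda>y. g (x - y)))) - ?I (cbox a b)) < e" .
    qed
  qed
qed

text \<open>The integrand is continuous, so its gauge integral over the box is a Lebesgue integral,
  to which the triangle inequality applies.\<close>

lemma tempered_smear_cbox_le: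
  fixes w g :: "'a::euclidean_space \<Rightarrow> complex"
  assumes T: "T \<in> tempered_distribution" and w: "w \<in> schwartz" and g: "g \<in> schwartz"
  shows "ennreal (cmod (T (smear (\<lambda>z. indicator (cbox a b) z * w z) g))) \<le>
    (\<integral>\<^sup>+z. ennreal (cmod (w z) * cmod (T (\<lambda>y. g (z - y)))) \<partial>lborel)"
proof -
  let ?f = "\<lambda>z. w z * T (\<lambda>y. g (z - y))"
  have "continuous_on (cbox a b) ?f"
    by (intro continuous_intros schwartz_continuous w
        continuous_on_subset[OF tempered_translate_continuous[OF T g]]) auto
  then have i: "integrable lborel (\<lambda>z. indicator (cbox a b) z *\<^sub>R ?f z)"
    by (intro borel_integrable_compact) auto
  have "T (smear (\<lambda>z. indicator (cbox a b) z * w z) g) = integral (cbox a b) ?f"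
    using tempered_smear_has_integral[OF T w g] by (metis integral_unique)
  also have "\<dots> = (LINT z|lborel. indicator (cbox a b) z *\<^sub>R ?f z)"
    using set_borel_integral_eq_integral(2)[of "cbox a b" ?f] i
    by (simp add: set_integrable_def set_lebesgue_integral_def)
  finally have "ennreal (cmod (T (smear (\<lambda>z. indicator (cbox a b) z * w z) g))) \<le>
      (\<integral>\<^sup>+z. ennreal (cmod (indicator (cbox a b) z *\<^sub>R ?f z)) \<partial>lborel)"
    using integral_norm_bound_ennreal[OF i] by simp
  also have "\<dots> \<le> (\<integral>\<^sup>+z. ennreal (cmod (w z) * cmod (T (\<lambda>y. g (z - y)))) \<partial>lborel)"
    by (intro nn_integral_mono ennreal_leI) (auto simp: indicator_def norm_mult)
  finally show ?thesis .
qed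

text \<open>Dominated convergence: each point eventually lies in the boxes.\<close>

lemma tendsto_weighted_integral_outside_cbox:
  fixes w :: "'a::euclidean_space \<Rightarrow> complex"
  assumes w: "w \<in> schwartz"
  shows "(\<lambda>m::nat. LINT z|lborel. (1 + norm z) ^ N *
    cmod (indicator (- cbox (- (real m *\<^sub>R One)) (real m *\<^sub>R One)) z * w z)) \<longlonglongrightarrow> 0"
proof -
  note [measurable] = schwartz_borel[OF w]
  let ?B = "\<lambda>m::nat. cbox (- (real m *\<^sub>R One)) (real m *\<^sub>R One) :: 'a set"
  have "(\<lambda>m. LINT z|lborel. (1 + norm z) ^ N * cmod (indicator (- ?B m) z * w z)) \<longlonglongrightarrow> (LINT z::'a|lborel. 0::real)"
  proof (rule integral_dominated_convergence[where w = "\<lambda>z::'a. (1 + norm z) ^ N * cmod (w z)"])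
    show "integrable lborel (\<lambda>z. (1 + norm z) ^ N * cmod (w z))"
      by (rule schwartz_weighted_integrable[OF w])
    show "AE z in lborel. (\<lambda>m. (1 + norm z) ^ N * cmod (indicator (- ?B m) z * w z)) \<longlonglongrightarrow> 0"
    proof (intro AE_I2 tendsto_eventually)
      fix z :: 'a
      obtain m0 where m0: "norm z \<le> real m0" using real_arch_simple by blast
      show "\<forall>\<^sub>F m in sequentially. (1 + norm z) ^ N * cmod (indicator (- ?B m) z * w z) = 0"
        using eventually_ge_at_top[of m0]
      proof eventually_elim
        case (elim m)
        have "\<bar>z \<bullet> i\<bar> \<le> real m" if "i \<in> Basis" for i
          using Basis_le_norm[OF that, of z] m0 elim by linarith
        then have "z \<in> ?B m" by (auto simp: mem_box abs_le_iff minus_le_iff)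
        then show ?case by simp
      qed
    qed
  qed (auto simp: indicator_def)
  then show ?thesis by simp
qed

text \<open>Formally \<open>T\<close> is applied to the reproducing formula and the triangle
  inequality follows. An infinite right-hand side is trivial. Otherwise the density is cut off at a
  box: the inner part is bounded by the right-hand side for every box, and the outer part tends to 0
  in the seminorms that control \<open>T\<close>.\<close>

lemma tempered_reproducing_le:
  fixes \<psi> g :: "'a::euclidean_space \<Rightarrow> complex"
  assumes T: "T \<in> tempered_distribution" and \<psi>: "\<psi> \<in> schwartz" and g: "g \<in> schwartz"
    and rep: "\<And>u. g u = (LINT z|lborel. \<psi> (u - z) * g z)"
  shows "ennreal (cmod (T (\<lambda>y. g (x - y)))) \<le>
    (\<integral>\<^sup>+z. ennreal (cmod (\<psi> (x - z)) * cmod (T (\<lambda>y. g (z - y)))) \<partial>lborel)" (is "_ \<le> ?J")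
proof (cases "?J = \<infinity>")
  case False
  then obtain j where j: "?J = ennreal j" "j \<ge> 0" by (cases ?J) auto
  define w where "w = (\<lambda>z. \<psi> (x - z))"
  have w: "w \<in> schwartz" unfolding w_def by (rule schwartz_reflect[OF \<psi>])
  note iw = schwartz_integrable[OF w]
  have w_J: "?J = (\<integral>\<^sup>+z. ennreal (cmod (w z) * cmod (T (\<lambda>y. g (z - y)))) \<partial>lborel)"
    by (simp only: w_def)
  let ?B = "\<lambda>m::nat. cbox (- (real m *\<^sub>R One)) (real m *\<^sub>R One) :: 'a set"
  \<comment> \<open>After the shift of \<open>z\<close> by \<open>y\<close> this is
    \<open>rep\<close> at the point \<open>x - y\<close>.\<close>
  have sm: "smear w g = (\<lambda>y. g (x - y))"
  proof
    fix y
    have "smear w g y = (LINT z|distr lborel borel ((+) y). \<psi> (x - z) * g (z - y))"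
      by (simp add: smear_def w_def lborel_distr_plus)
    also have "\<dots> = (LINT z|lborel. \<psi> (x - y - z) * g z)"
    proof -
      note [measurable] = schwartz_borel[OF g] schwartz_borel[OF \<psi>]
      show ?thesis by (subst integral_distr) (auto simp: algebra_simps)
    qed
    finally show "smear w g y = g (x - y)" by (simp add: rep[of "x - y"])
  qed
  obtain K N where K: "K \<ge> 0" "\<And>f B. f \<in> schwartz \<Longrightarrow>
      (\<And>bs y. bs \<in> multi_indices N \<Longrightarrow> (1 + norm y) ^ N * cmod (partials bs f y) \<le> B bs) \<Longrightarrow>
      cmod (T f) \<le> K * (\<Sum>bs\<in>multi_indices N. B bs)"
    by (rule tempered_bound[OF T]) blast
  have "\<exists>C. \<forall>y. (1 + norm y) ^ N * cmod (partials bs g y) \<le> C" if "set bs \<subseteq> Basis" for bs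
    by (rule schwartz_decay[OF g that]) blast
  then obtain C where C: "\<And>bs y. set bs \<subseteq> Basis \<Longrightarrow> (1 + norm y) ^ N * cmod (partials bs g y) \<le> C bs"
    by metis
  define I where "I m = (LINT z|lborel. (1 + norm z) ^ N * cmod (indicator (- ?B m) z * w z))" for m
  have "cmod (T (\<lambda>y. g (x - y))) \<le> j + K * (\<Sum>bs\<in>multi_indices N. C bs * I m)" for m
  proof -
    let ?u = "\<lambda>z. indicator (?B m) z * w z" and ?v = "\<lambda>z. indicator (- ?B m) z * w z"
    have iu: "integrable lborel ?u" and iv: "integrable lborel ?v"
      by (intro integrable_indicator_mult iw; simp)+
    have vN: "integrable lborel (\<lambda>z. (1 + norm z) ^ n * cmod (?v z))" for n
      by (intro weighted_integrable_indicator_mult iw schwartz_weighted_integrable w) simp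
    have su: "smear ?u g \<in> schwartz" and sv: "smear ?v g \<in> schwartz"
      by (intro smear_schwartz g iu iv weighted_integrable_indicator_mult iw schwartz_weighted_integrable w; simp)+
    have "smear w g = (\<lambda>y. smear ?u g y + smear ?v g y)"
    proof
      fix y
      have "w z * g (z - y) = ?u z * g (z - y) + ?v z * g (z - y)" for z
        by (simp add: indicator_def)
      then show "smear w g y = smear ?u g y + smear ?v g y"
        unfolding smear_def
        by (simp only: Bochner_Integration.integral_add[OF integrable_mult_schwartz[OF iu g] integrable_mult_schwartz[OF iv g]])
    qed
    then have "T (\<lambda>y. g (x - y)) = T (smear ?u g) + T (smear ?v g)"
      using tempered_add[OF T su sv] sm by simp
    then have "cmod (T (\<lambda>y. g (x - y))) \<le> cmod (T (smear ?u g)) + cmod (T (smear ?v g))"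
      by (simp only: norm_triangle_ineq)
    moreover have "cmod (T (smear ?u g)) \<le> j"
      using tempered_smear_cbox_le[OF T w g, of "- (real m *\<^sub>R One)" "real m *\<^sub>R One", folded w_J] j
      by (simp only: ennreal_le_iff)
    moreover have "cmod (T (smear ?v g)) \<le> K * (\<Sum>bs\<in>multi_indices N. C bs * I m)"
    proof (rule K(2)[OF sv])
      fix bs :: "'a list" and y :: 'a assume "bs \<in> multi_indices N"
      then have bs: "set bs \<subseteq> Basis" by (simp add: multi_indices_def)
      show "(1 + norm y) ^ N * cmod (partials bs (smear ?v g) y) \<le> C bs * I m"
        using smear_weighted_bound[OF iv vN schwartz_partials[OF g bs] C[OF bs], of y]
        unfolding I_def partials_smear[OF iv g bs] by (simp only: norm_mult norm_power norm_minus_cancel norm_one power_one mult_1)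
    qed
    ultimately show ?thesis by linarith
  qed
  moreover have "(\<lambda>m. j + K * (\<Sum>bs\<in>multi_indices N. C bs * I m)) \<longlonglongrightarrow> j + K * (\<Sum>bs\<in>(multi_indices N :: 'a list set). C bs * 0)"
    unfolding I_def by (intro tendsto_intros tendsto_weighted_integral_outside_cbox w)
  ultimately have "cmod (T (\<lambda>y. g (x - y))) \<le> j + K * (\<Sum>bs\<in>(multi_indices N :: 'a list set). C bs * 0)"
    by (intro LIMSEQ_le_const) auto
  then show ?thesis using j by (simp add: ennreal_leI)
qed simp

section \<open>Fourier injectivity and reproducing formulas\<close>

lemma integral_lborel_affine:
  fixes f :: "'a::euclidean_space \<Rightarrow> 'b::{banach, second_countable_topology}"
  assumes [measurable]: "f \<in> borel_measurable borel" and "c \<noteq> 0"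
  shows "(LINT x|lborel. f x) = \<bar>c\<bar> ^ DIM('a) *\<^sub>R (LINT x|lborel. f (t + c *\<^sub>R x))"
  by (subst lborel_affine[OF assms(2), of t])
    (simp add: integral_density integral_distr)

lemma integrable_lborel_affine:
  fixes f :: "'a::euclidean_space \<Rightarrow> 'b::{banach, second_countable_topology}"
  assumes f: "integrable lborel f" and "c \<noteq> 0"
  shows "integrable lborel (\<lambda>x. f (t + c *\<^sub>R x))"
proof -
  note [measurable] = borel_measurable_integrable[OF f]
  have "integrable (density (distr lborel borel (\<lambda>x. t + c *\<^sub>R x)) (\<lambda>_. \<bar>c\<bar>^DIM('a))) f"
    using f lborel_affine[OF assms(2), of t] by simp
  then have "integrable lborel (\<lambda>x. \<bar>c\<bar> ^ DIM('a) *\<^sub>R f (t + c *\<^sub>R x))"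
    by (simp add: integrable_density integrable_distr_eq)
  from integrable_scaleR_right[OF this, of "inverse (\<bar>c\<bar> ^ DIM('a))"] show ?thesis
    using assms(2) by simp
qed

section \<open>The Gaussian and its Fourier transform\<close>

definition gaussian :: "'a::euclidean_space \<Rightarrow> real" where
  "gaussian u = (\<Prod>b\<in>Basis. std_normal_density (u \<bullet> b))"

lemma gaussian_measurable [measurable]: "gaussian \<in> borel_measurable borel"
  unfolding gaussian_def by measurable

lemma gaussian_nonneg: "gaussian u \<ge> 0"
  unfolding gaussian_def by (intro prod_nonneg) auto

lemma std_normal_fourier:
  "integrable lborel (\<lambda>x. of_real (std_normal_density x) * exp (\<i> * of_real (s * x)))"
  "(LINT x|lborel. of_real (std_normal_density x) * exp (\<i> * of_real (s * x))) =
     of_real (sqrt (2 * pi) * std_normal_density s)"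
proof -
  have i: "integrable lborel (\<lambda>x. of_real (std_normal_density x) :: complex)"
    by (intro integrable_of_real integrable_normal_density) simp
  show "integrable lborel (\<lambda>x. of_real (std_normal_density x) * exp (\<i> * of_real (s * x)))"
    by (rule Bochner_Integration.integrable_bound[OF i]) (auto simp: norm_mult norm_exp_i_times)
  have "(LINT x|lborel. of_real (std_normal_density x) * exp (\<i> * of_real (s * x))) = char std_normal_distribution s"
    unfolding char_def by (subst integral_density) (auto simp: scaleR_conv_of_real)
  also have "\<dots> = of_real (sqrt (2 * pi) * std_normal_density s)"
  proof -
    have "sqrt (2 * pi) * std_normal_density s = exp (- s\<^sup>2 / 2)"
      by (simp add: std_normal_density_def)
    then show ?thesis by (simp only: char_std_normal_distribution)
  qed
  finally show "(LINT x|lborel. of_real (std_normal_density x) * exp (\<i> * of_real (s * x))) =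
     of_real (sqrt (2 * pi) * std_normal_density s)" .
qed

text \<open>Density and character both factor over the coordinates, so Fubini on the product measure
  behind \<open>lborel\<close> reduces the claim to the characteristic function of the standard
  normal distribution.\<close>

lemma gaussian_fourier:
  fixes u :: "'a::euclidean_space"
  shows "integrable lborel (\<lambda>\<xi>. of_real (gaussian \<xi>) * exp (\<i> * of_real (u \<bullet> \<xi>)))"
    and "(LINT \<xi>|lborel. of_real (gaussian \<xi>) * exp (\<i> * of_real (u \<bullet> \<xi>))) =
      of_real (sqrt (2 * pi) ^ DIM('a) * gaussian u)"
proof -
  interpret product_sigma_finite "\<lambda>_::'a. lborel :: real measure" ..
  let ?F = "\<lambda>\<xi>. of_real (gaussian \<xi>) * exp (\<i> * of_real (u \<bullet> \<xi>))"
  let ?g = "\<lambda>f. \<Prod>b\<in>Basis. of_real (std_normal_density (f b)) * exp (\<i> * of_real ((u \<bullet> b) * f b)) :: complex"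
  have eq: "?F (\<Sum>b\<in>Basis. f b *\<^sub>R b) = ?g f" for f :: "'a \<Rightarrow> real"
  proof -
    have "of_real (u \<bullet> (\<Sum>b\<in>Basis. f b *\<^sub>R b)) * \<i> = (\<Sum>b\<in>Basis. \<i> * of_real ((u \<bullet> b) * f b))"
      by (simp add: inner_sum_right sum_distrib_left mult_ac)
    then show ?thesis
      by (simp add: gaussian_def prod.distrib exp_sum[symmetric] mult.commute of_real_prod)
  qed
  have m: "(\<lambda>f. \<Sum>b\<in>Basis. f b *\<^sub>R b) \<in> (\<Pi>\<^sub>M b\<in>(Basis::'a set). lborel) \<rightarrow>\<^sub>M (borel :: 'a measure)"
    by measurable
  have "integrable (\<Pi>\<^sub>M b\<in>(Basis::'a set). lborel) ?g"
    by (rule product_integrable_prod) (simp_all add: std_normal_fourier(1) del: of_real_mult)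
  then show "integrable lborel ?F"
    by (subst lborel_eq, subst integrable_distr_eq[OF m]) (auto simp: eq)
  have "(LINT \<xi>|lborel. ?F \<xi>) = (LINT f|(\<Pi>\<^sub>M b\<in>(Basis::'a set). lborel). ?g f)"
    by (subst lborel_eq, subst integral_distr[OF m]) (auto simp: eq)
  also have "\<dots> = (\<Prod>b\<in>(Basis::'a set). of_real (sqrt (2 * pi) * std_normal_density (u \<bullet> b)))"
    by (subst product_integral_prod) (simp_all add: std_normal_fourier del: of_real_mult)
  also have "\<dots> = of_real (sqrt (2 * pi) ^ DIM('a) * gaussian u)"
    by (simp add: gaussian_def prod.distrib of_real_prod)
  finally show "(LINT \<xi>|lborel. ?F \<xi>) = of_real (sqrt (2 * pi) ^ DIM('a) * gaussian u)" .
qed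

lemma gaussian_integrable: "integrable lborel (gaussian :: 'a::euclidean_space \<Rightarrow> real)"
proof -
  have "integrable lborel (\<lambda>\<xi>::'a. of_real (gaussian \<xi>) :: complex)" using gaussian_fourier(1)[of "0::'a"] by simp
  then show ?thesis by (simp add: complex_of_real_integrable_eq)
qed

lemma gaussian_integral: "(LINT u|lborel. of_real (gaussian (u::'a::euclidean_space)) :: complex) \<noteq> 0"
  using gaussian_fourier(2)[of "0::'a"] by (simp add: gaussian_def std_normal_density_def)

lemma integrable_pair_phase:
  fixes a b :: "'a::euclidean_space \<Rightarrow> complex"
  assumes a: "integrable lborel a" and b: "integrable lborel b"
    and e [measurable]: "case_prod e \<in> borel_measurable (lborel \<Otimes>\<^sub>M lborel)" and e1: "\<And>x y. cmod (e x y) \<le> 1"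
  shows "integrable (lborel \<Otimes>\<^sub>M lborel) (\<lambda>(x, y). e x y * a x * b y)"
proof -
  note [measurable] = borel_measurable_integrable[OF a] borel_measurable_integrable[OF b]
  have i: "integrable (lborel \<Otimes>\<^sub>M lborel) (\<lambda>(x, y). a x * b y)"
  proof (rule lborel_pair.Fubini_integrable)
    show "integrable lborel (\<lambda>x. LINT y|lborel. norm (case (x, y) of (x, y) \<Rightarrow> a x * b y))"
      using a by (simp add: norm_mult)
    show "AE x in lborel. integrable lborel (\<lambda>y. case (x, y) of (x, y) \<Rightarrow> a x * b y)"
      using b by simp
  qed measurable
  show ?thesis
  proof (rule Bochner_Integration.integrable_bound[OF i])
    show "AE z in lborel \<Otimes>\<^sub>M lborel. norm (case z of (x, y) \<Rightarrow> e x y * a x * b y) \<le>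
        norm (case z of (x, y) \<Rightarrow> a x * b y)"
      by (intro AE_I2) (auto simp: norm_mult mult.assoc intro!: mult_left_le_one_le e1)
  qed measurable
qed

text \<open>Averages of \<open>h\<close> against small Gaussians vanish since the Gaussian is itself a Fourier transform.\<close>

lemma fourier_injective:
  fixes h :: "'a::euclidean_space \<Rightarrow> complex"
  assumes h: "integrable lborel h" and c: "continuous_on UNIV h" and B: "\<And>x. cmod (h x) \<le> B"
    and 0: "\<And>\<xi>. fourier h \<xi> = 0"
  shows "h x = 0"
proof -
  have [measurable]: "h \<in> borel_measurable borel" using h by measurable
  let ?s = "complex_of_real (sqrt (2 * pi) ^ DIM('a))"
  have avg: "(LINT u|lborel. of_real (gaussian u) * h (x - e *\<^sub>R u)) = 0" if e: "e > 0" for e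
  proof -
    have ih: "integrable lborel (\<lambda>u. h (x - e *\<^sub>R u))"
      using integrable_lborel_affine[OF h, of "- e" x] e by simp
    \<comment> \<open>The substitution \<open>y = x - e *\<^sub>R u\<close> turns this integral into
      a multiple of the Fourier transform of \<open>h\<close> at
      \<open>\<xi> /\<^sub>R e\<close>.\<close>
    have inner: "(LINT u|lborel. exp (\<i> * of_real (u \<bullet> \<xi>)) * h (x - e *\<^sub>R u)) = 0" for \<xi>
    proof -
      let ?f = "\<lambda>y. exp (\<i> * of_real (((x - y) \<bullet> \<xi>) / e)) * h y"
      have "?f y = exp (\<i> * of_real ((x \<bullet> \<xi>) / e)) * (exp (- (\<i> * of_real (y \<bullet> (\<xi> /\<^sub>R e)))) * h y)" for y
        by (simp add: exp_add[symmetric] inner_diff_left diff_divide_distrib field_simps exp_minus exp_diff)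
      then have "(LINT y|lborel. ?f y) = exp (\<i> * of_real ((x \<bullet> \<xi>) / e)) * fourier h (\<xi> /\<^sub>R e)"
        by (simp only: fourier_def integral_mult_right_zero)
      then have "0 = (LINT y|lborel. ?f y)" using 0 by simp
      also have "\<dots> = \<bar>- e\<bar> ^ DIM('a) *\<^sub>R (LINT u|lborel. ?f (x + (- e) *\<^sub>R u))"
        by (rule integral_lborel_affine) (use e in auto)
      finally show ?thesis using e by simp
    qed
    have "?s * (LINT u|lborel. of_real (gaussian u) * h (x - e *\<^sub>R u)) =
        (LINT u|lborel. (LINT \<xi>|lborel. exp (\<i> * of_real (u \<bullet> \<xi>)) * of_real (gaussian \<xi>) * h (x - e *\<^sub>R u)))"
    proof -
      have "?s * (LINT u|lborel. of_real (gaussian u) * h (x - e *\<^sub>R u)) =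
          (LINT u|lborel. of_real (sqrt (2 * pi) ^ DIM('a) * gaussian u) * h (x - e *\<^sub>R u))"
        by (simp add: mult.assoc flip: integral_mult_right_zero)
      also have "\<dots> = (LINT u|lborel. (LINT \<xi>|lborel. exp (\<i> * of_real (u \<bullet> \<xi>)) * of_real (gaussian \<xi>) * h (x - e *\<^sub>R u)))"
        by (simp only: gaussian_fourier(2)[symmetric] integral_mult_left_zero mult.commute[of "exp _"])
      finally show ?thesis .
    qed
    also have "\<dots> = (LINT \<xi>|lborel. (LINT u|lborel. exp (\<i> * of_real (u \<bullet> \<xi>)) * of_real (gaussian \<xi>) * h (x - e *\<^sub>R u)))"
    proof (rule lborel_pair.Fubini_integral)
      show "integrable (lborel \<Otimes>\<^sub>M lborel) (\<lambda>(\<xi>, u). exp (\<i> * of_real (u \<bullet> \<xi>)) * of_real (gaussian \<xi>) * h (x - e *\<^sub>R u))"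
        by (rule integrable_pair_phase[OF _ ih])
          (auto simp: norm_exp_i_times complex_of_real_integrable_eq gaussian_integrable)
    qed
    also have "\<dots> = (LINT \<xi>|lborel. of_real (gaussian (\<xi>::'a)) * (LINT u|lborel. exp (\<i> * of_real (u \<bullet> \<xi>)) * h (x - e *\<^sub>R u)))"
      by (simp add: mult_ac flip: integral_mult_right_zero)
    also have "\<dots> = 0" by (simp add: inner)
    finally show ?thesis by simp
  qed
  \<comment> \<open>As the scale tends to 0, continuity at \<open>x\<close> and the bound
    \<open>B\<close> let the averages converge to \<open>h x\<close> times the integral of the
    Gaussian, which is not 0.\<close>
  have "(\<lambda>k. LINT u|lborel. of_real (gaussian u) * h (x - inverse (real (Suc k)) *\<^sub>R u)) \<longlonglongrightarrow>
      (LINT u::'a|lborel. of_real (gaussian u) * h x)"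
  proof (rule integral_dominated_convergence[where w = "\<lambda>u::'a. B * gaussian u"])
    show "integrable lborel (\<lambda>u::'a. B * gaussian u)" by (intro integrable_mult_right gaussian_integrable)
    show "AE u in lborel. (\<lambda>k. of_real (gaussian u) * h (x - inverse (real (Suc k)) *\<^sub>R u)) \<longlonglongrightarrow> of_real (gaussian u) * h x"
    proof (intro AE_I2 tendsto_intros)
      fix u :: 'a
      have "(\<lambda>k. x - inverse (real (Suc k)) *\<^sub>R u) \<longlonglongrightarrow> x - 0 *\<^sub>R u"
        by (intro tendsto_intros LIMSEQ_inverse_real_of_nat)
      then show "(\<lambda>k. h (x - inverse (real (Suc k)) *\<^sub>R u)) \<longlonglongrightarrow> h x"
        using c by (auto simp: continuous_on_eq_continuous_at isCont_def intro!: isCont_tendsto_compose[of x h])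
    qed
    show "AE u in lborel. norm (of_real (gaussian u) * h (x - inverse (real (Suc k)) *\<^sub>R u)) \<le> B * gaussian u" for k
      using B by (intro AE_I2) (simp add: norm_mult abs_of_nonneg[OF gaussian_nonneg] gaussian_nonneg mult.commute[of B] mult_left_mono)
  qed measurable
  moreover have "(\<lambda>k. LINT u|lborel. of_real (gaussian u) * h (x - inverse (real (Suc k)) *\<^sub>R u)) = (\<lambda>k. 0)"
    by (intro ext avg) simp
  ultimately have "0 = (LINT u|lborel. of_real (gaussian (u::'a)) * h x)"
    by (simp only: LIMSEQ_const_iff)
  then show ?thesis using gaussian_integral[where 'a='a] by simp
qed

lemma fourier_dilate:
  fixes f :: "'a::euclidean_space \<Rightarrow> complex"
  assumes [measurable]: "f \<in> borel_measurable borel" and t: "t > 0"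
  shows "fourier (dilate f t) \<xi> = fourier f (t *\<^sub>R \<xi>)"
proof -
  have "fourier (dilate f t) \<xi> = t ^ DIM('a) *\<^sub>R
      (LINT x|lborel. exp (- (\<i> * of_real ((0 + t *\<^sub>R x) \<bullet> \<xi>))) * (f ((0 + t *\<^sub>R x) /\<^sub>R t) /\<^sub>R t ^ DIM('a)))"
    unfolding fourier_def dilate_def
    using integral_lborel_affine[of "\<lambda>x. exp (- (\<i> * of_real (x \<bullet> \<xi>))) * (f (x /\<^sub>R t) /\<^sub>R t ^ DIM('a))" t 0] t
    by simp
  also have "\<dots> = fourier f (t *\<^sub>R \<xi>)"
    using t by (simp add: fourier_def)
  finally show ?thesis .
qed

text \<open>By the convolution theorem and \<open>one\<close>, the convolution and \<open>g\<close>
  have the same Fourier transform. Injectivity is applied to their difference; the convolution is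
  continuous because \<open>\<psi>\<close> is Lipschitz and \<open>g\<close> integrable.\<close>

lemma schwartz_reproducing:
  fixes \<psi> g :: "'a::euclidean_space \<Rightarrow> complex"
  assumes \<psi>: "\<psi> \<in> schwartz" and g: "g \<in> schwartz"
    and one: "\<And>\<xi>. fourier g \<xi> \<noteq> 0 \<Longrightarrow> fourier \<psi> \<xi> = 1"
  shows "g u = (LINT z|lborel. \<psi> (u - z) * g z)"
proof -
  note [measurable] = schwartz_borel[OF g] schwartz_borel[OF \<psi>]
  note ig = schwartz_integrable[OF g] and i\<psi> = schwartz_integrable[OF \<psi>]
  obtain C where C: "\<And>x. cmod (\<psi> x) \<le> C"
    by (rule schwartz_bounded[OF \<psi>, of 0]) auto
  obtain D where D: "\<And>x. cmod (g x) \<le> D"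
    by (rule schwartz_bounded[OF g, of 0]) auto
  obtain L where L: "L > 0" "\<And>x y. cmod (\<psi> x - \<psi> y) \<le> L * norm (x - y)"
    by (rule schwartz_lipschitz[OF \<psi>]) blast
  define c where "c x = (LINT z|lborel. \<psi> (x - z) * g z)" for x
  have ic: "integrable lborel (\<lambda>z. \<psi> (x - z) * g z)" for x
    by (rule Bochner_Integration.integrable_bound[of _ "\<lambda>z. C *\<^sub>R g z"])
      (auto intro!: mult_mono order_trans[OF C abs_ge_self] simp: norm_mult ig)
  have shift: "integrable lborel (\<lambda>x. \<psi> (x - z))" for z
    using integrable_lborel_affine[OF i\<psi>, of 1 "- z"] by simp
  have shift_norm: "(LINT x|lborel. cmod (\<psi> (x - z))) = (LINT x|lborel. cmod (\<psi> x))" for z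
    using integral_lborel_affine[of "\<lambda>x. cmod (\<psi> x)" 1 "- z"] by simp
  \<comment> \<open>The unimodular factor \<open>e\<close> serves two cases: \<open>e = 1\<close>
    gives integrability of the convolution, a character the exchange of integrals in its Fourier
    transform.\<close>
  have ip: "integrable (lborel \<Otimes>\<^sub>M lborel) (\<lambda>(z, x). e x * (\<psi> (x - z) * g z))"
    if [measurable]: "e \<in> borel_measurable borel" and e: "\<And>x. cmod (e x) = 1" for e
  proof (rule lborel_pair.Fubini_integrable)
    show "(\<lambda>(z, x). e x * (\<psi> (x - z) * g z)) \<in> borel_measurable (lborel \<Otimes>\<^sub>M lborel)" by measurable
    show "integrable lborel (\<lambda>z. LINT x|lborel. norm (case (z, x) of (z, x) \<Rightarrow> e x * (\<psi> (x - z) * g z)))"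
      using ig by (simp add: norm_mult e shift_norm)
    show "AE z in lborel. integrable lborel (\<lambda>x. case (z, x) of (z, x) \<Rightarrow> e x * (\<psi> (x - z) * g z))"
    proof (intro AE_I2)
      fix z
      show "integrable lborel (\<lambda>x. case (z, x) of (z, x) \<Rightarrow> e x * (\<psi> (x - z) * g z))"
        by (rule Bochner_Integration.integrable_bound[of _ "\<lambda>x. \<psi> (x - z) * g z"]) (auto simp: shift norm_mult e)
    qed
  qed
  have i: "integrable lborel c"
    using lborel_pair.integrable_snd[OF ip[of "\<lambda>_. 1"]] by (simp add: c_def[abs_def])
  have fc: "fourier c \<xi> = fourier \<psi> \<xi> * fourier g \<xi>" for \<xi>
  proof -
    let ?e = "\<lambda>x. exp (- (\<i> * of_real (x \<bullet> \<xi>)))"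
    have "fourier c \<xi> = (LINT x|lborel. LINT z|lborel. ?e x * (\<psi> (x - z) * g z))"
      by (simp add: fourier_def c_def)
    also have "\<dots> = (LINT z|lborel. LINT x|lborel. ?e x * (\<psi> (x - z) * g z))"
      by (rule lborel_pair.Fubini_integral, rule ip) (auto simp: norm_exp_i_times simp flip: mult_minus_right of_real_minus)
    also have "\<dots> = (LINT z|lborel. fourier \<psi> \<xi> * (?e z * g z))"
    proof (rule Bochner_Integration.integral_cong[OF refl])
      fix z
      have "(LINT x|lborel. ?e x * (\<psi> (x - z) * g z)) = (LINT x|lborel. ?e (z + 1 *\<^sub>R x) * (\<psi> (z + 1 *\<^sub>R x - z) * g z))"
        using integral_lborel_affine[of "\<lambda>x. ?e x * (\<psi> (x - z) * g z)" 1 z] by simp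
      also have "\<dots> = (LINT x|lborel. (?e x * \<psi> x) * (?e z * g z))"
        by (rule Bochner_Integration.integral_cong[OF refl])
          (simp add: inner_add_left exp_add[symmetric] algebra_simps exp_diff exp_minus divide_inverse)
      also have "\<dots> = fourier \<psi> \<xi> * (?e z * g z)" by (simp only: fourier_def integral_mult_left_zero)
      finally show "(LINT x|lborel. ?e x * (\<psi> (x - z) * g z)) = fourier \<psi> \<xi> * (?e z * g z)" .
    qed
    also have "\<dots> = fourier \<psi> \<xi> * fourier g \<xi>" by (simp only: fourier_def integral_mult_right_zero)
    finally show ?thesis .
  qed
  have "c u - g u = 0"
  proof (rule fourier_injective[of "\<lambda>u. c u - g u"])
    show "integrable lborel (\<lambda>u. c u - g u)" using i ig by simp
    have lip: "norm (c x - c y) \<le> (L * (LINT z|lborel. cmod (g z))) * norm (x - y)" for x y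
    proof -
      have "c x - c y = (LINT z|lborel. (\<psi> (x - z) - \<psi> (y - z)) * g z)"
        unfolding c_def by (subst Bochner_Integration.integral_diff[symmetric, OF ic ic]) (simp add: algebra_simps)
      also have "norm \<dots> \<le> (LINT z|lborel. (L * norm (x - y)) * cmod (g z))"
      proof (rule Bochner_Integration.integral_norm_bound_integral)
        show "integrable lborel (\<lambda>z. (\<psi> (x - z) - \<psi> (y - z)) * g z)"
          using Bochner_Integration.integrable_diff[OF ic[of x] ic[of y]] by (simp add: algebra_simps)
        show "norm ((\<psi> (x - z) - \<psi> (y - z)) * g z) \<le> (L * norm (x - y)) * cmod (g z)" for z
          using L(2)[of "x - z" "y - z"] by (simp add: norm_mult mult_right_mono)
      qed (use ig in simp)
      finally show ?thesis by (simp add: mult_ac)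
    qed
    have "continuous_on UNIV c"
    proof (rule continuous_at_imp_continuous_on, intro ballI)
      fix x
      have "((\<lambda>y. c y - c x) \<longlongrightarrow> 0) (at x)"
      proof (rule Lim_null_comparison)
        show "\<forall>\<^sub>F y in at x. norm (c y - c x) \<le> (L * (LINT z|lborel. cmod (g z))) * norm (y - x)"
          by (intro always_eventually allI lip)
        show "((\<lambda>y. (L * (LINT z|lborel. cmod (g z))) * norm (y - x)) \<longlongrightarrow> 0) (at x)"
          by (auto intro!: tendsto_eq_intros)
      qed
      then show "isCont c x" unfolding isCont_def by (rule LIM_zero_cancel)
    qed
    then show "continuous_on UNIV (\<lambda>u. c u - g u)" by (rule continuous_on_diff[OF _ schwartz_continuous[OF g]])
    show "cmod (c x - g x) \<le> C * (LINT z|lborel. cmod (g z)) + D" for x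
    proof -
      have "cmod (c x) \<le> (LINT z|lborel. C * cmod (g z))"
        unfolding c_def
        by (rule Bochner_Integration.integral_norm_bound_integral) (auto simp: ic ig norm_mult intro!: mult_right_mono C)
      then show ?thesis using D[of x] norm_triangle_ineq4[of "c x" "g x"] by simp
    qed
    show "fourier (\<lambda>u. c u - g u) \<xi> = 0" for \<xi>
    proof -
      have "fourier (\<lambda>u. c u - g u) \<xi> = fourier c \<xi> - fourier g \<xi>"
        unfolding fourier_def right_diff_distrib
        by (intro Bochner_Integration.integral_diff Bochner_Integration.integrable_bound[OF i]
            Bochner_Integration.integrable_bound[OF ig])
          (use i in \<open>auto simp: norm_mult norm_exp_i_times simp flip: mult_minus_right of_real_minus\<close>)
      then show ?thesis using one[of \<xi>] by (cases "fourier g \<xi> = 0") (auto simp: fc)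
    qed
  qed
  then show ?thesis by (simp add: c_def)
qed

section \<open>Reproducing formulas from the resolution of unity\<close>

lemma in_suppI: "f \<xi> \<noteq> 0 \<Longrightarrow> \<xi> \<in> supp f"
  unfolding supp_def by (rule subsetD[OF closure_subset]) simp

text \<open>For \<open>t \<le> 1\<close> the point \<open>t *\<^sub>R \<xi>\<close> stays in the
  closed ball of radius 1/2, which the support of \<open>fourier \<phi>\<close> avoids, so the
  integral in the partition identity vanishes.\<close>

lemma resolution_fourier_eq_one:
  fixes \<Phi> \<phi> :: "'a::euclidean_space \<Rightarrow> complex"
  assumes r: "resolution_of_unity \<Phi> \<phi>" and \<xi>: "norm \<xi> \<le> 1/2"
  shows "fourier \<Phi> \<xi> = 1"
proof -
  have z: "indicator {0<..1} t *\<^sub>R (fourier \<phi> (t *\<^sub>R \<xi>) /\<^sub>R t) = 0" for t :: real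
  proof (cases "t \<in> {0<..1}")
    case True
    have "norm (t *\<^sub>R \<xi>) \<le> 1 * (1/2)" unfolding norm_scaleR using True \<xi> by (intro mult_mono) auto
    moreover have "supp (fourier \<phi>) \<subseteq> {\<xi>. 1/2 < norm \<xi> \<and> norm \<xi> < 2}"
      using r unfolding resolution_of_unity_def by blast
    ultimately have "fourier \<phi> (t *\<^sub>R \<xi>) = 0" using in_suppI[of "fourier \<phi>" "t *\<^sub>R \<xi>"] by force
    then show ?thesis by simp
  qed simp
  have "fourier \<Phi> \<xi> + (LINT t:{0<..1}|lborel. fourier \<phi> (t *\<^sub>R \<xi>) /\<^sub>R t) = 1"
    using r unfolding resolution_of_unity_def by blast
  then show ?thesis by (simp only: set_lebesgue_integral_def z) simp
qed

text \<open>Origin of \<open>t / 4\<close>: on the spectrum of \<open>dilate g t\<close> the norm of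
  \<open>t *\<^sub>R \<xi>\<close> is less than 2, so that of \<open>(t / 4) *\<^sub>R \<xi>\<close>
  is less than 1/2, where \<open>fourier \<Phi>\<close> equals 1. The spectrum of \<open>g\<close>
  enters through its outer radius, so \<open>g\<close> can be \<open>\<Phi>\<close> as well as
  \<open>\<phi>\<close>.\<close>

lemma resolution_reproducing:
  fixes \<Phi> \<phi> g :: "'a::euclidean_space \<Rightarrow> complex"
  assumes r: "resolution_of_unity \<Phi> \<phi>" and g: "g \<in> schwartz" and t: "t > 0"
    and s: "supp (fourier g) \<subseteq> {\<xi>. norm \<xi> < 2}"
  shows "dilate g t u = (LINT z|lborel. dilate \<Phi> (t / 4) (u - z) * dilate g t z)"
proof (rule schwartz_reproducing)
  have \<Phi>: "\<Phi> \<in> schwartz" using r unfolding resolution_of_unity_def by blast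
  show "dilate \<Phi> (t / 4) \<in> schwartz" "dilate g t \<in> schwartz"
    using t by (auto intro: schwartz_dilate \<Phi> g)
  show "fourier (dilate \<Phi> (t / 4)) \<xi> = 1" if "fourier (dilate g t) \<xi> \<noteq> 0" for \<xi>
  proof -
    have "norm (t *\<^sub>R \<xi>) < 2"
      using that t s in_suppI[of "fourier g" "t *\<^sub>R \<xi>"] by (auto simp: fourier_dilate schwartz_borel g)
    then have "norm ((t / 4) *\<^sub>R \<xi>) \<le> 1/2" using t by simp
    then show ?thesis using t by (simp add: fourier_dilate schwartz_borel \<Phi> resolution_fourier_eq_one[OF r])
  qed
qed

lemma resolution_conv_le:
  fixes \<Phi> \<phi> g :: "'a::euclidean_space \<Rightarrow> complex"
  assumes r: "resolution_of_unity \<Phi> \<phi>" and g: "g \<in> schwartz" and t: "t > 0"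
    and s: "supp (fourier g) \<subseteq> {\<xi>. norm \<xi> < 2}" and f: "f \<in> tempered_distribution"
  shows "ennreal (cmod (conv (dilate g t) f x)) \<le>
    (\<integral>\<^sup>+z. ennreal (cmod (dilate \<Phi> (t / 4) (x - z)) * cmod (conv (dilate g t) f z)) \<partial>lborel)"
  unfolding conv_def
proof (rule tempered_reproducing_le[OF f])
  have \<Phi>: "\<Phi> \<in> schwartz" using r unfolding resolution_of_unity_def by blast
  show "dilate \<Phi> (t / 4) \<in> schwartz" "dilate g t \<in> schwartz"
    using t by (auto intro: schwartz_dilate \<Phi> g)
qed (rule resolution_reproducing[OF r g t s])

section \<open>Averaging operators in variable exponent spaces\<close>

text \<open>A convex power lies above its tangent at \<open>c\<close>; here this comes from Young's
  inequality with weights \<open>1 / s\<close> and \<open>1 - 1 / s\<close>.\<close>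

lemma powr_tangent_le:
  fixes u c s :: real
  assumes "u \<ge> 0" "c > 0" "s \<ge> 1"
  shows "s * c powr (s - 1) * u \<le> u powr s + (s - 1) * c powr s"
proof (cases "u = 0")
  case False
  with assms have "(u powr s) powr (1/s) * (c powr s) powr (1 - 1/s) \<le> (1/s) * u powr s + (1 - 1/s) * c powr s"
    by (intro Youngs_inequality_0) auto
  moreover have "(u powr s) powr (1/s) = u" using assms by (simp add: powr_powr)
  moreover have "(c powr s) powr (1 - 1/s) = c powr (s - 1)" using assms by (simp add: powr_powr algebra_simps)
  ultimately have "u * c powr (s - 1) \<le> (1/s) * u powr s + (1 - 1/s) * c powr s" by simp
  then have "s * (u * c powr (s - 1)) \<le> s * ((1/s) * u powr s + (1 - 1/s) * c powr s)"
    using assms by (intro mult_left_mono) auto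
  then show ?thesis using assms by (simp add: algebra_simps)
qed (use assms in simp)

text \<open>The tangent inequality at the point \<open>g\<close> itself is integrated. Its constant
  term \<open>?b\<close> is nonnegative, so mass at most 1 is enough, and it is finite, so it
  cancels even if the integral is infinite.\<close>

lemma nn_integral_jensen_powr:
  fixes f :: "'b \<Rightarrow> real"
  assumes [measurable]: "k \<in> borel_measurable M" "f \<in> borel_measurable M"
    and f: "\<And>z. f z \<ge> 0" and k: "(\<integral>\<^sup>+z. k z \<partial>M) \<le> 1" and s: "s \<ge> 1" and "g \<ge> 0"
    and le: "ennreal g \<le> (\<integral>\<^sup>+z. k z * ennreal (f z) \<partial>M)"
  shows "ennreal (g powr s) \<le> (\<integral>\<^sup>+z. k z * ennreal (f z powr s) \<partial>M)" (is "_ \<le> ?X")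
proof (cases "g = 0")
  case False
  with \<open>g \<ge> 0\<close> have g: "g > 0" by simp
  let ?a = "s * g powr (s - 1)" and ?b = "(s - 1) * g powr s"
  have "ennreal (g powr s) + ennreal ?b = ennreal (?a * g)"
    using g s by (simp add: ennreal_plus[symmetric] powr_diff algebra_simps del: ennreal_plus)
  also have "\<dots> = ennreal ?a * ennreal g" using g s by (intro ennreal_mult) auto
  also have "\<dots> \<le> ennreal ?a * (\<integral>\<^sup>+z. k z * ennreal (f z) \<partial>M)" by (intro mult_left_mono le) auto
  also have "\<dots> = (\<integral>\<^sup>+z. k z * (ennreal ?a * ennreal (f z)) \<partial>M)"
    by (subst nn_integral_cmult[symmetric]) (auto simp: mult_ac)
  also have "\<dots> \<le> (\<integral>\<^sup>+z. k z * (ennreal (f z powr s) + ennreal ?b) \<partial>M)"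
  proof (intro nn_integral_mono mult_left_mono)
    fix z
    show "ennreal ?a * ennreal (f z) \<le> ennreal (f z powr s) + ennreal ?b"
      using powr_tangent_le[OF f[of z] g s] f[of z] g s
      by (simp add: ennreal_plus[symmetric] ennreal_mult'[symmetric] ennreal_leI del: ennreal_plus)
  qed auto
  also have "\<dots> = ?X + (\<integral>\<^sup>+z. k z \<partial>M) * ennreal ?b"
    by (simp add: distrib_left nn_integral_add nn_integral_multc)
  also have "\<dots> \<le> ?X + 1 * ennreal ?b" by (intro add_left_mono mult_right_mono k) auto
  finally show ?thesis by (simp add: ennreal_add_left_cancel_le add.commute[of _ "ennreal ?b"])
qed simp

text \<open>The density of the uniform distribution on the ball about \<open>x\<close>. Written
  through \<open>dist\<close>, it is visibly symmetric and jointly measurable, as Fubini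
  requires.\<close>

definition ball_kernel :: "real \<Rightarrow> 'a::euclidean_space \<Rightarrow> 'a \<Rightarrow> ennreal" where
  "ball_kernel R x z = ennreal (1 / (unit_ball_vol (DIM('a)) * R ^ DIM('a))) * indicator {..<R} (dist x z)"

lemma ball_kernel_measurable [measurable]:
  "(\<lambda>(x, z). ball_kernel R x z) \<in> borel_measurable (borel \<Otimes>\<^sub>M borel)"
  "ball_kernel R x \<in> borel_measurable borel"
  unfolding ball_kernel_def by measurable

lemma ball_kernel_commute: "ball_kernel R x z = ball_kernel R z x"
  by (simp add: ball_kernel_def dist_commute)

lemma nn_integral_ball_kernel:
  fixes x :: "'a::euclidean_space"
  assumes "R > 0"
  shows "(\<integral>\<^sup>+z. ball_kernel R x z \<partial>lborel) = 1"
proof -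
  have "indicator {..<R} (dist x z) = (indicator (ball x R) z :: ennreal)" for z
    by (simp add: indicator_def)
  then have "(\<integral>\<^sup>+z. ball_kernel R x z \<partial>lborel) =
      ennreal (1 / (unit_ball_vol (DIM('a)) * R ^ DIM('a))) * ennreal (unit_ball_vol (DIM('a)) * R ^ DIM('a))"
    using assms by (simp add: ball_kernel_def nn_integral_cmult_indicator emeasure_ball)
  also have "\<dots> = 1"
    using assms by (simp add: ennreal_mult'[symmetric] less_imp_neq[OF unit_ball_vol_pos, symmetric])
  finally show ?thesis .
qed

text \<open>By symmetry of the kernel each \<open>z\<close> spreads total mass 1 over the points
  \<open>x\<close>.\<close>

lemma nn_integral_ball_average:
  fixes u :: "'a::euclidean_space \<Rightarrow> ennreal"
  assumes "R > 0" and [measurable]: "u \<in> borel_measurable borel"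
  shows "(\<integral>\<^sup>+x. (\<integral>\<^sup>+z. ball_kernel R x z * u z \<partial>lborel) \<partial>lborel) = (\<integral>\<^sup>+z. u z \<partial>lborel)"
proof -
  have "(\<integral>\<^sup>+x. (\<integral>\<^sup>+z. ball_kernel R x z * u z \<partial>lborel) \<partial>lborel) =
      (\<integral>\<^sup>+z. (\<integral>\<^sup>+x. ball_kernel R x z * u z \<partial>lborel) \<partial>lborel)"
    by (rule lborel_pair.Fubini') measurable
  also have "\<dots> = (\<integral>\<^sup>+z. u z \<partial>lborel)"
    by (subst ball_kernel_commute) (simp add: nn_integral_multc nn_integral_ball_kernel[OF assms(1)])
  finally show ?thesis .
qed

text \<open>
  Values at most 1 are controlled by the decay of \<open>1 / s\<close> at infinity, values above 1 by its local
  continuity: there \<open>1 / \<tau>\<close> is a lower bound of \<open>s\<close> on the ball, to which Jensen's inequality applies.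
\<close>

lemma powr_young_far:
  fixes s :: "'a::real_normed_vector \<Rightarrow> real"
  assumes s: "\<And>x. s x \<ge> 1" and c: "c > 0"
    and inf: "\<And>x. \<bar>1 / s x - l\<bar> \<le> c / ln (exp 1 + norm x)"
    and N: "N > 0" and \<beta>: "\<beta> > 0" "\<beta> \<le> exp (- (2 * c * N))" and f: "0 \<le> f" "f \<le> 1"
  shows "(\<beta> * f) powr s x \<le> f powr s z + ((1 + norm x) powr - N + (1 + norm z) powr - N)"
proof (cases "f = 0 \<or> s z \<le> s x")
  case True
  have "exp (- (2 * c * N)) \<le> 1" using c N by simp
  then have b1: "\<beta> \<le> 1" using \<beta> by linarith
  have "(\<beta> * f) powr s x \<le> f powr s x" using f \<beta> b1 s[of x] by (intro powr_mono2) (auto intro: mult_left_le_one_le)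
  also have "\<dots> \<le> f powr s z"
    using True f powr_mono'[of "s z" "s x" f] by auto
  finally show ?thesis by (smt (verit) powr_ge_zero)
next
  case False
  then have f0: "f > 0" and lt: "s x < s z" using f by auto
  have s0: "s x > 0" "s z > 0" using s[of x] s[of z] by auto
  define \<alpha> where "\<alpha> = s x / s z"
  \<comment> \<open>\<open>1 / \<sigma>\<close> is the difference of the reciprocal exponents, the
    quantity that the decay condition bounds. Young's inequality with weights
    \<open>\<alpha>\<close> and \<open>1 - \<alpha>\<close> splits off
    \<open>\<beta> powr \<sigma>\<close>.\<close>
  define \<sigma> where "\<sigma> = s x / (1 - \<alpha>)"
  have \<alpha>: "0 < \<alpha>" "\<alpha> < 1" using lt s0 by (auto simp: \<alpha>_def)
  have \<sigma>1: "1 / \<sigma> = 1 / s x - 1 / s z"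
    using s0 lt by (simp add: \<sigma>_def \<alpha>_def field_simps)
  have "\<sigma> > 0" using \<alpha> s0 by (simp add: \<sigma>_def)
  have "(\<beta> * f) powr s x = (f powr s z) powr \<alpha> * (\<beta> powr \<sigma>) powr (1 - \<alpha>)"
    using f0 \<beta> \<alpha> s0 by (simp add: powr_mult powr_powr \<sigma>_def \<alpha>_def mult.commute)
  also have "\<dots> \<le> \<alpha> * f powr s z + (1 - \<alpha>) * \<beta> powr \<sigma>"
    using \<alpha> f0 \<beta> by (intro Youngs_inequality_0) auto
  also have "\<dots> \<le> 1 * f powr s z + 1 * \<beta> powr \<sigma>"
    using \<alpha> by (intro add_mono mult_right_mono) auto
  also have "\<beta> powr \<sigma> \<le> (1 + norm x) powr - N + (1 + norm z) powr - N"
  proof -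
    \<comment> \<open>The point nearer to the origin has the weaker decay bound, so it serves for
      both terms.\<close>
    define w where "w = (if norm x \<le> norm z then x else z)"
    let ?L = "\<lambda>y. ln (exp 1 + norm y :: real)"
    have L: "?L y \<ge> 1" for y :: 'a
    proof -
      have "ln (exp 1) \<le> ?L y" by (subst ln_le_cancel_iff) (auto simp: add_pos_nonneg)
      then show ?thesis by simp
    qed
    have mono: "?L w \<le> ?L y" if "norm w \<le> norm y" for y
      using that by (subst ln_le_cancel_iff) (auto simp: add_pos_nonneg)
    have "1 / \<sigma> \<le> \<bar>1 / s x - l\<bar> + \<bar>1 / s z - l\<bar>" unfolding \<sigma>1 by linarith
    also have "\<dots> \<le> c / ?L x + c / ?L z" by (intro add_mono inf)
    also have "\<dots> \<le> c / ?L w + c / ?L w"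
      using c L by (intro add_mono divide_left_mono mono mult_pos_pos less_le_trans[OF zero_less_one L]) (auto simp: w_def)
    finally have "1 / \<sigma> \<le> 2 * c / ?L w" by simp
    then have "?L w \<le> 2 * c * \<sigma>" using \<open>\<sigma> > 0\<close> L[of w] c by (simp add: field_simps)
    then have "N * ?L w \<le> N * (2 * c * \<sigma>)" using N by (intro mult_left_mono) auto
    have "\<beta> powr \<sigma> \<le> exp (- (2 * c * N)) powr \<sigma>"
      using \<beta> \<open>\<sigma> > 0\<close> by (intro powr_mono2) auto
    also have "\<dots> = exp (- (N * (2 * c * \<sigma>)))" by (simp add: powr_def mult_ac)
    also have "\<dots> \<le> exp (- (N * ?L w))" using \<open>N * ?L w \<le> N * (2 * c * \<sigma>)\<close> by simp
    also have "\<dots> = (exp 1 + norm w) powr - N"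
      by (subst powr_def) (smt (verit) exp_gt_zero norm_ge_zero mult_minus_left)
    also have "\<dots> \<le> (1 + norm w) powr - N"
      using N by (intro powr_mono2') (auto simp: add_pos_nonneg)
    also have "\<dots> \<le> (1 + norm x) powr - N + (1 + norm z) powr - N"
      by (auto simp: w_def)
    finally show ?thesis .
  qed
  finally show ?thesis by simp
qed

lemma small_values_average:
  fixes s f :: "'a::euclidean_space \<Rightarrow> real"
  assumes s: "\<And>x. s x \<ge> 1" and c: "c > 0"
    and inf: "\<And>x. \<bar>1 / s x - l\<bar> \<le> c / ln (exp 1 + norm x)"
    and N: "N > 0" and \<beta>: "\<beta> > 0" "\<beta> \<le> exp (- (2 * c * N))"
    and f: "\<And>z. 0 \<le> f z" "\<And>z. f z \<le> 1" and [measurable]: "f \<in> borel_measurable borel"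
    and [measurable]: "k \<in> borel_measurable borel" and k: "(\<integral>\<^sup>+z. k z \<partial>lborel) \<le> 1"
    and g: "g \<ge> 0" "ennreal g \<le> (\<integral>\<^sup>+z. k z * ennreal (f z) \<partial>lborel)"
  shows "ennreal ((\<beta> * g) powr s x) \<le>
    (\<integral>\<^sup>+z. k z * ennreal (f z powr s z + ((1 + norm x) powr - N + (1 + norm z) powr - N)) \<partial>lborel)"
proof -
  have "ennreal (\<beta> * g) = ennreal \<beta> * ennreal g" using \<beta> by (intro ennreal_mult') auto
  also have "\<dots> \<le> ennreal \<beta> * (\<integral>\<^sup>+z. k z * ennreal (f z) \<partial>lborel)" by (intro mult_left_mono g) auto
  also have "\<dots> = (\<integral>\<^sup>+z. k z * ennreal (\<beta> * f z) \<partial>lborel)"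
    using \<beta> by (subst nn_integral_cmult[symmetric]) (auto simp: ennreal_mult' mult_ac)
  finally have "ennreal ((\<beta> * g) powr s x) \<le> (\<integral>\<^sup>+z. k z * ennreal ((\<beta> * f z) powr s x) \<partial>lborel)"
    using \<beta> f g k s by (intro nn_integral_jensen_powr) auto
  also have "\<dots> \<le> (\<integral>\<^sup>+z. k z * ennreal (f z powr s z + ((1 + norm x) powr - N + (1 + norm z) powr - N)) \<partial>lborel)"
    by (intro nn_integral_mono mult_left_mono ennreal_leI powr_young_far[OF s c inf N \<beta> f]) auto
  finally show ?thesis .
qed

lemma ln_exp_plus_ge_one: "0 \<le> x \<Longrightarrow> 1 \<le> ln (exp 1 + x :: real)"
  by (subst ln_ge_iff) (auto simp: add_pos_nonneg)

text \<open>The average \<open>\<mu>\<close> of the modular is at most the reciprocal volume of the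
  ball. On small balls the passage to the exponent \<open>s x\<close> costs the factor
  \<open>\<mu> powr (s x * \<tau> - 1)\<close>, whose exponent is at most
  \<open>s x * c / ln (exp 1 + 1 / R)\<close>. So the cost is at most the exponential of a fixed
  multiple of \<open>s x\<close>, which \<open>\<beta> powr s x\<close> cancels.\<close>

lemma large_values_average:
  fixes s f :: "'a::euclidean_space \<Rightarrow> real"
  defines "v \<equiv> unit_ball_vol (DIM('a))"
  assumes [measurable]: "s \<in> borel_measurable borel" and s: "\<And>x. s x \<ge> 1" and c: "c > 0"
    and loc: "\<And>x y. \<bar>1 / s x - 1 / s y\<bar> \<le> c / ln (exp 1 + 1 / norm (x - y))"
    and \<beta>: "\<beta> > 0" "\<beta> \<le> v" "\<beta> \<le> exp (- (c * (ln (max 1 (1 / v)) + DIM('a))))"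
    and f: "\<And>z. f z = 0 \<or> f z > 1" and [measurable]: "f \<in> borel_measurable borel"
    and int: "(\<integral>\<^sup>+z. ennreal (f z powr s z) \<partial>lborel) \<le> 1"
    and R: "R > 0" and g: "g \<ge> 0" "ennreal g \<le> (\<integral>\<^sup>+z. ball_kernel R x z * ennreal (f z) \<partial>lborel)"
  shows "ennreal ((\<beta> * g) powr s x) \<le> (\<integral>\<^sup>+z. ball_kernel R x z * ennreal (f z powr s z) \<partial>lborel)" (is "_ \<le> ?M")
proof -
  let ?n = "DIM('a)"
  have v: "v > 0" by (simp add: v_def)
  have mono: "f z powr a \<le> f z powr b" if "a \<le> b" for z a b
    using f[of z] that by (auto intro: powr_mono)
  have f0: "f z \<ge> 0" for z using f[of z] by auto
  have f1: "f z powr 1 = f z" for z using f0[of z] by simp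
  have "?M \<le> (\<integral>\<^sup>+z. ennreal (1 / (v * R ^ ?n)) * ennreal (f z powr s z) \<partial>lborel)"
    unfolding ball_kernel_def v_def
    by (intro nn_integral_mono mult_right_mono) (auto simp: indicator_def)
  also have "\<dots> = ennreal (1 / (v * R ^ ?n)) * (\<integral>\<^sup>+z. ennreal (f z powr s z) \<partial>lborel)"
    by (rule nn_integral_cmult) measurable
  also have "\<dots> \<le> ennreal (1 / (v * R ^ ?n)) * 1" by (intro mult_left_mono int) auto
  finally have M: "?M \<le> ennreal (1 / (v * R ^ ?n))" by simp
  then obtain \<mu> where \<mu>: "?M = ennreal \<mu>" "\<mu> \<ge> 0" by (cases ?M) (auto simp: top_unique)
  with M v R have \<mu>M: "\<mu> \<le> 1 / (v * R ^ ?n)" by (simp add: ennreal_le_iff)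
  show ?thesis
  proof (cases "R \<ge> 1")
    \<comment> \<open>For \<open>R \<ge> 1\<close> the bound on \<open>\<mu>\<close> gives
      \<open>\<beta> * g \<le> 1\<close>, and raising the exponent from 1 to \<open>s x\<close>
      lowers the power.\<close>
    case True
    have "ennreal g \<le> (\<integral>\<^sup>+z. ball_kernel R x z * ennreal (f z powr 1) \<partial>lborel)" using g(2) by (simp only: f1)
    also have "\<dots> \<le> ?M" by (intro nn_integral_mono mult_left_mono ennreal_leI mono s) auto
    finally have g\<mu>: "g \<le> \<mu>" using \<mu> by (simp add: ennreal_le_iff)
    have R1: "R ^ ?n \<ge> 1" using True by simp
    have "\<beta> * g \<le> v * (1 / (v * R ^ ?n))" using g\<mu> \<mu>M \<beta> g v by (intro mult_mono) auto
    also have "\<dots> = 1 / R ^ ?n" using v by simp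
    also have "\<dots> \<le> 1" using R1 by simp
    finally have "(\<beta> * g) powr s x \<le> (\<beta> * g) powr 1" using \<beta> g s[of x] by (intro powr_mono') auto
    also have "\<dots> \<le> g"
    proof -
      have "exp (- (c * (ln (max 1 (1 / v)) + ?n))) \<le> 1" using c by simp
      then have "\<beta> \<le> 1" using \<beta> by linarith
      then show ?thesis using \<beta> g by (simp add: mult_left_le_one_le)
    qed
    finally show ?thesis using g\<mu> unfolding \<mu>(1) by (intro ennreal_leI) linarith
  next
    case False
    define L where "L = ln (exp 1 + 1 / R)"
    \<comment> \<open>An upper bound of \<open>1 / s\<close> on the ball; the cap at 1 keeps
      \<open>1 / \<tau> \<ge> 1\<close>, as Jensen's inequality requires.\<close>
    define \<tau> where "\<tau> = min 1 (1 / s x + c / L)"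
    have L: "L \<ge> 1" unfolding L_def using R by (intro ln_exp_plus_ge_one) auto
    have cL: "c / L > 0" using c L by simp
    have sx: "s x \<ge> 1" "s x > 0" using s[of x] by auto
    have \<tau>: "\<tau> > 0" "\<tau> \<le> 1" "s x * \<tau> \<ge> 1" "s x * \<tau> - 1 \<le> s x * (c / L)"
    proof -
      have p: "1 / s x + c / L > 0" using sx cL by (intro add_pos_pos) auto
      then show "\<tau> > 0" "\<tau> \<le> 1" by (auto simp: \<tau>_def)
      have "1 / s x \<le> \<tau>" using sx cL by (auto simp: \<tau>_def)
      then show "s x * \<tau> \<ge> 1" using sx by (simp add: field_simps)
      have "s x * \<tau> \<le> s x * (1 / s x + c / L)" using sx by (intro mult_left_mono) (auto simp: \<tau>_def)
      also have "\<dots> = 1 + s x * (c / L)" using sx by (simp add: distrib_left)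
      finally show "s x * \<tau> - 1 \<le> s x * (c / L)" by simp
    qed
    have le: "1 / \<tau> \<le> s z" if "dist x z < R" for z
    proof -
      have "\<bar>1 / s x - 1 / s z\<bar> \<le> c / L"
      proof (cases "x = z")
        case False
        then have "1 / R \<le> 1 / norm (x - z)" using that R by (intro divide_left_mono mult_pos_pos) (auto simp: dist_norm)
        then have "L \<le> ln (exp 1 + 1 / norm (x - z))"
          unfolding L_def using R by (subst ln_le_cancel_iff) (auto simp: add_pos_nonneg add_pos_pos)
        then have "c / ln (exp 1 + 1 / norm (x - z)) \<le> c / L"
          using c L by (intro divide_left_mono) auto
        with loc[of x z] show ?thesis by linarith
      qed (use cL in simp)
      moreover have "1 / s z \<le> 1" using s[of z] by simp
      ultimately have "1 / s z \<le> \<tau>" by (auto simp: \<tau>_def)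
      moreover have "s z > 0" using s[of z] by linarith
      ultimately show ?thesis using \<tau>(1) by (simp add: field_simps)
    qed
    have "ennreal (g powr (1 / \<tau>)) \<le> (\<integral>\<^sup>+z. ball_kernel R x z * ennreal (f z powr (1 / \<tau>)) \<partial>lborel)"
      using g f0 \<tau> R by (intro nn_integral_jensen_powr) (auto simp: nn_integral_ball_kernel)
    also have "\<dots> \<le> ?M"
    proof (rule nn_integral_mono)
      fix z
      show "ball_kernel R x z * ennreal (f z powr (1 / \<tau>)) \<le> ball_kernel R x z * ennreal (f z powr s z)"
        using mono[OF le, of z] by (cases "dist x z < R") (auto simp: ball_kernel_def intro!: mult_left_mono ennreal_leI)
    qed
    finally have g\<mu>: "g powr (1 / \<tau>) \<le> \<mu>" using \<mu> by (simp add: ennreal_le_iff)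
    have "g powr s x = (g powr (1 / \<tau>)) powr (s x * \<tau>)" using \<tau> by (simp add: powr_powr)
    also have "\<dots> \<le> \<mu> powr (s x * \<tau>)" using g\<mu> \<tau> sx by (intro powr_mono2) auto
    also have "\<dots> \<le> \<mu> * exp (s x * (c * (ln (max 1 (1 / v)) + ?n)))"
    proof (cases "\<mu> = 0")
      case False
      with \<mu> have \<mu>0: "\<mu> > 0" by simp
      \<comment> \<open>A bound for \<open>\<mu>\<close> that is at least 1, so that its powers grow
        with the exponent; the maximum covers a unit ball of volume greater than 1.\<close>
      let ?Q = "max 1 (1 / v) * (1 / R) ^ ?n"
      have Q1: "(1 / R) ^ ?n \<ge> 1" using False \<open>\<not> R \<ge> 1\<close> R by (intro one_le_power) auto
      have Q: "?Q \<ge> 1" using mult_mono[of 1 "max 1 (1 / v)" 1 "(1 / R) ^ ?n"] Q1 by simp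
      have "\<mu> \<le> (1 / v) * (1 / R) ^ ?n" using \<mu>M by (simp add: power_divide)
      also have "\<dots> \<le> ?Q" using R by (intro mult_right_mono) auto
      finally have \<mu>Q: "\<mu> \<le> ?Q" .
      have "\<mu> powr (s x * \<tau>) = \<mu> * \<mu> powr (s x * \<tau> - 1)"
        using \<mu>0 by (simp add: powr_diff)
      also have "\<dots> \<le> \<mu> * ?Q powr (s x * \<tau> - 1)"
        using \<mu>0 \<mu>Q \<tau> by (intro mult_left_mono powr_mono2) auto
      also have "\<dots> \<le> \<mu> * ?Q powr (s x * (c / L))"
        using \<mu>0 \<tau>(4) Q by (intro mult_left_mono powr_mono) auto
      also have "\<dots> = \<mu> * exp (s x * (c / L) * ln ?Q)"
      proof -
        have "?Q \<noteq> 0" using Q by linarith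
        then show ?thesis by (simp only: powr_def if_False)
      qed
      also have "\<dots> \<le> \<mu> * exp (s x * (c * (ln (max 1 (1 / v)) + ?n)))"
      proof -
        have "ln ?Q = ln (max 1 (1 / v)) + ?n * ln (1 / R)"
        proof -
          have p: "0 < max 1 (1 / v)" "0 < (1 / R) ^ ?n" "0 < 1 / R" using R by auto
          show ?thesis by (simp only: ln_mult_pos[OF p(1,2)] ln_realpow)
        qed
        also have "\<dots> \<le> ln (max 1 (1 / v)) * L + ?n * L"
        proof (intro add_mono mult_left_mono)
          show "ln (max 1 (1 / v)) \<le> ln (max 1 (1 / v)) * L" using L mult_left_mono[of 1 L "ln (max 1 (1 / v))"] by simp
          show "ln (1 / R) \<le> L" unfolding L_def using R by (subst ln_le_cancel_iff) (auto simp: add_pos_pos)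
        qed auto
        finally have "ln ?Q \<le> (ln (max 1 (1 / v)) + ?n) * L" by (simp add: distrib_right)
        then have "s x * (c / L) * ln ?Q \<le> s x * (c / L) * ((ln (max 1 (1 / v)) + ?n) * L)"
          by (rule mult_left_mono) (rule mult_nonneg_nonneg; use sx cL in linarith)
        also have "\<dots> = s x * (c * (ln (max 1 (1 / v)) + ?n))" using L by simp
        finally show ?thesis using \<mu>0 by (intro mult_left_mono) auto
      qed
      finally show ?thesis .
    qed simp
    finally have gs: "g powr s x \<le> \<mu> * exp (s x * (c * (ln (max 1 (1 / v)) + ?n)))" .
    let ?E = "c * (ln (max 1 (1 / v)) + ?n)"
    have "(\<beta> * g) powr s x = \<beta> powr s x * g powr s x" using \<beta> g by (simp add: powr_mult)
    also have "\<dots> \<le> exp (- ?E) powr s x * (\<mu> * exp (s x * ?E))"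
      using gs \<beta> sx by (intro mult_mono powr_mono2) auto
    also have "\<dots> = \<mu>"
    proof -
      have "exp (- e) powr y * (\<mu> * exp (y * e)) = \<mu>" for e y :: real
      proof -
        have "exp (- e) powr y = exp (- (y * e))" by (simp add: powr_def)
        then show ?thesis by (simp add: exp_minus)
      qed
      then show ?thesis .
    qed
    finally show ?thesis unfolding \<mu>(1) by (rule ennreal_leI)
  qed
qed

lemma log_holder_average:
  fixes s :: "'a::euclidean_space \<Rightarrow> real"
  assumes [measurable]: "s \<in> borel_measurable borel" and s: "\<And>x. s x \<ge> 1"
    and h: "(\<lambda>x. 1 / s x) \<in> log_holder" and N: "N > 0"
  obtains \<beta> where "\<beta> > 0"
    "\<And>f R g x. (\<And>z. f z \<ge> 0) \<Longrightarrow> f \<in> borel_measurable borel \<Longrightarrow>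
      (\<integral>\<^sup>+z. ennreal (f z powr s z) \<partial>lborel) \<le> 1 \<Longrightarrow> R > 0 \<Longrightarrow> g \<ge> 0 \<Longrightarrow>
      ennreal g \<le> (\<integral>\<^sup>+z. ball_kernel R x z * ennreal (f z) \<partial>lborel) \<Longrightarrow>
      ennreal ((\<beta> * g) powr s x) \<le> (\<integral>\<^sup>+z. ball_kernel R x z *
        ennreal (f z powr s z + ((1 + norm x) powr - N + (1 + norm z) powr - N)) \<partial>lborel)"
proof -
  let ?n = "DIM('a)" and ?v = "unit_ball_vol (DIM('a))"
  obtain c1 where c1: "c1 > 0" "\<And>x y. \<bar>1 / s x - 1 / s y\<bar> \<le> c1 / ln (exp 1 + 1 / norm (x - y))"
    using h unfolding log_holder_def log_holder_loc_def by blast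
  obtain l c2 where c2: "c2 > 0" "\<And>x. \<bar>1 / s x - l\<bar> \<le> c2 / ln (exp 1 + norm x)"
    using h unfolding log_holder_def by blast
  define \<beta> where "\<beta> = min ?v (min (exp (- (c1 * (ln (max 1 (1 / ?v)) + ?n)))) (exp (- (2 * c2 * N))))"
  have \<beta>: "\<beta> > 0" "\<beta> \<le> ?v" "\<beta> \<le> exp (- (c1 * (ln (max 1 (1 / ?v)) + ?n)))" "\<beta> \<le> exp (- (2 * c2 * N))"
    by (auto simp: \<beta>_def)
  have "ennreal ((\<beta> / 2 * g) powr s x) \<le> (\<integral>\<^sup>+z. ball_kernel R x z *
        ennreal (f z powr s z + ((1 + norm x) powr - N + (1 + norm z) powr - N)) \<partial>lborel)" (is "_ \<le> ?I")
    if f: "\<And>z. f z \<ge> 0" and [measurable]: "f \<in> borel_measurable borel"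
      and int: "(\<integral>\<^sup>+z. ennreal (f z powr s z) \<partial>lborel) \<le> 1" and R: "R > 0" and g: "g \<ge> 0"
      and gf: "ennreal g \<le> (\<integral>\<^sup>+z. ball_kernel R x z * ennreal (f z) \<partial>lborel)" for f :: "'a \<Rightarrow> real" and R g x
  proof -
    \<comment> \<open>Splitting at height 1: one of the two parts carries at least half of
      \<open>g\<close>. The halving goes into \<open>\<beta> / 2\<close>, so no power of a sum with
      exponent \<open>s x\<close> arises.\<close>
    define f1 where "f1 z = (if f z \<le> 1 then f z else 0)" for z
    define f2 where "f2 z = (if f z \<le> 1 then 0 else f z)" for z
    have [measurable]: "f1 \<in> borel_measurable borel" "f2 \<in> borel_measurable borel"
      unfolding f1_def f2_def by measurable
    have "ennreal (g / 2) + ennreal (g / 2) = ennreal g"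
      using g by (simp add: ennreal_plus[symmetric] del: ennreal_plus)
    also note gf
    also have "(\<integral>\<^sup>+z. ball_kernel R x z * ennreal (f z) \<partial>lborel) =
        (\<integral>\<^sup>+z. ball_kernel R x z * ennreal (f1 z) + ball_kernel R x z * ennreal (f2 z) \<partial>lborel)"
      by (intro nn_integral_cong) (auto simp: f1_def f2_def)
    also have "\<dots> = (\<integral>\<^sup>+z. ball_kernel R x z * ennreal (f1 z) \<partial>lborel) +
        (\<integral>\<^sup>+z. ball_kernel R x z * ennreal (f2 z) \<partial>lborel)"
      by (rule nn_integral_add) measurable
    finally consider "ennreal (g / 2) \<le> (\<integral>\<^sup>+z. ball_kernel R x z * ennreal (f1 z) \<partial>lborel)"
      | "ennreal (g / 2) \<le> (\<integral>\<^sup>+z. ball_kernel R x z * ennreal (f2 z) \<partial>lborel)"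
      by (metis add_strict_mono linorder_not_le)
    then have "ennreal ((\<beta> * (g / 2)) powr s x) \<le> ?I"
    proof cases
      case 1
      have "ennreal ((\<beta> * (g / 2)) powr s x) \<le> (\<integral>\<^sup>+z. ball_kernel R x z *
          ennreal (f1 z powr s z + ((1 + norm x) powr - N + (1 + norm z) powr - N)) \<partial>lborel)"
        using f g 1 by (intro small_values_average[OF s c2(1) c2(2) N \<beta>(1,4)])
          (auto simp: f1_def nn_integral_ball_kernel[OF R])
      also have "\<dots> \<le> ?I"
        by (intro nn_integral_mono mult_left_mono ennreal_leI add_right_mono) (auto simp: f1_def)
      finally show ?thesis .
    next
      case 2
      have "ennreal ((\<beta> * (g / 2)) powr s x) \<le> (\<integral>\<^sup>+z. ball_kernel R x z * ennreal (f2 z powr s z) \<partial>lborel)"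
      proof (rule large_values_average[OF _ s c1(1) c1(2) \<beta>(1,2,3) _ _ _ R _ 2])
        have "(\<integral>\<^sup>+z. ennreal (f2 z powr s z) \<partial>lborel) \<le> (\<integral>\<^sup>+z. ennreal (f z powr s z) \<partial>lborel)"
          by (intro nn_integral_mono ennreal_leI) (auto simp: f2_def)
        then show "(\<integral>\<^sup>+z. ennreal (f2 z powr s z) \<partial>lborel) \<le> 1" using int by (rule order_trans)
      qed (use g in \<open>auto simp: f2_def\<close>)
      also have "\<dots> \<le> ?I"
        by (intro nn_integral_mono mult_left_mono ennreal_leI) (auto simp: f2_def)
      finally show ?thesis .
    qed
    then show ?thesis by (simp add: mult.commute mult.left_commute)
  qed
  then show ?thesis using \<beta>(1) by (intro that[of "\<beta> / 2"]) auto
qed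

text \<open>Each indicator in the dyadic bound is the volume of its ball times a normalised kernel;
  the volume cancels \<open>1 / t ^ n\<close> and turns the ratio \<open>2 powr - m\<close> into
  \<open>q\<close>.\<close>

lemma kernel_le_ball_kernels:
  fixes x z :: "'a::euclidean_space" and m :: real
  defines "n \<equiv> DIM('a)"
  defines "q \<equiv> 2 powr (n - m)"
  assumes "m \<ge> 0" "t > 0"
  shows "ennreal ((1 + norm (x - z) / t) powr - m / t ^ n) \<le>
    (\<Sum>j. ennreal (2 powr m * unit_ball_vol n * q ^ j) * ball_kernel (2 ^ j * t) x z)"
proof -
  define v where "v = unit_ball_vol n"
  have v: "v > 0" by (simp add: v_def)
  have q: "q = 2 ^ n * 2 powr - m"
    unfolding q_def using powr_add[of 2 "real n" "- m"] powr_realpow[of 2 n] by simp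
  have "ennreal ((1 + norm (x - z) / t) powr - m / t ^ n) =
      ennreal (1 / t ^ n) * ennreal ((1 + norm (x - z) / t) powr - m)"
    using assms by (simp add: ennreal_mult'[symmetric])
  also have "\<dots> \<le> ennreal (1 / t ^ n) *
      (\<Sum>j. ennreal (2 powr m * (2 powr - m) ^ j) * indicator (ball 0 (2 ^ j * t)) (x - z))"
    using assms by (intro mult_left_mono kernel_le_dyadic) auto
  also have "\<dots> = (\<Sum>j. ennreal (1 / t ^ n) *
      (ennreal (2 powr m * (2 powr - m) ^ j) * indicator (ball 0 (2 ^ j * t)) (x - z)))"
    by (rule ennreal_suminf_cmult[symmetric])
  also have "\<dots> = (\<Sum>j. ennreal (2 powr m * v * q ^ j) * ball_kernel (2 ^ j * t) x z)"
  proof (rule suminf_cong)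
    fix j
    let ?K = "1 / (v * (2 ^ j * t) ^ n)"
    have "q ^ j = (2 ^ j) ^ n * (2 powr - m) ^ j"
      unfolding q power_mult_distrib by (simp only: power_mult[symmetric] mult.commute[of n j])
    then have "2 powr m * v * q ^ j * ?K = 1 / t ^ n * (2 powr m * (2 powr - m) ^ j)"
      using v assms(4) by (simp add: power_mult_distrib)
    then have "ennreal (2 powr m * v * q ^ j) * ennreal ?K =
        ennreal (1 / t ^ n) * ennreal (2 powr m * (2 powr - m) ^ j)"
      using v assms(4) by (simp add: ennreal_mult'[symmetric] q_def)
    moreover have "indicator (ball 0 (2 ^ j * t)) (x - z) = (indicator {..<2 ^ j * t} (dist x z) :: ennreal)"
      by (simp add: indicator_def dist_norm norm_minus_commute)
    ultimately show "ennreal (1 / t ^ n) *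
        (ennreal (2 powr m * (2 powr - m) ^ j) * indicator (ball 0 (2 ^ j * t)) (x - z)) =
        ennreal (2 powr m * v * q ^ j) * ball_kernel (2 ^ j * t) x z"
      by (simp only: ball_kernel_def n_def v_def mult.assoc[symmetric])
  qed
  finally show ?thesis unfolding v_def .
qed

text \<open>Boundedness in modular form: one majorant \<open>G\<close> serves all lower bounds
  \<open>g\<close> of the kernel integral at \<open>x\<close>, so that a supremum of such
  \<open>g\<close> can be absorbed later. Jensen's inequality enters once more, for the probability
  weights \<open>w j\<close> on the radii.\<close>

lemma kernel_modular_bound:
  fixes s :: "'a::euclidean_space \<Rightarrow> real" and m :: real
  assumes [measurable]: "s \<in> borel_measurable borel" and s: "\<And>x. s x \<ge> 1"
    and h: "(\<lambda>x. 1 / s x) \<in> log_holder" and m: "m > DIM('a)"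
  obtains C where "C > 0"
    "\<And>t f. t > 0 \<Longrightarrow> (\<And>z. f z \<ge> 0) \<Longrightarrow> f \<in> borel_measurable borel \<Longrightarrow>
      (\<integral>\<^sup>+z. ennreal (f z powr s z) \<partial>lborel) \<le> 1 \<Longrightarrow>
      \<exists>G. (\<integral>\<^sup>+x. G x \<partial>lborel) \<le> 1 \<and>
        (\<forall>x g. 0 \<le> g \<longrightarrow>
          ennreal g \<le> (\<integral>\<^sup>+z. ennreal ((1 + norm (x - z) / t) powr - m / t ^ DIM('a)) * ennreal (f z) \<partial>lborel) \<longrightarrow>
          ennreal ((g / C) powr s x) \<le> G x)"
proof -
  let ?n = "DIM('a)" and ?v = "unit_ball_vol (DIM('a))"
  define N where "N = real ?n + 1"
  have N: "N > 0" by (simp add: N_def)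
  define hh where "hh = (\<lambda>y::'a. (1 + norm y) powr - N)"
  have [measurable]: "hh \<in> borel_measurable borel" unfolding hh_def by measurable
  obtain \<beta> where \<beta>: "\<beta> > 0"
    "\<And>f R g x. (\<And>z. f z \<ge> 0) \<Longrightarrow> f \<in> borel_measurable borel \<Longrightarrow>
      (\<integral>\<^sup>+z. ennreal (f z powr s z) \<partial>lborel) \<le> 1 \<Longrightarrow> R > 0 \<Longrightarrow> g \<ge> 0 \<Longrightarrow>
      ennreal g \<le> (\<integral>\<^sup>+z. ball_kernel R x z * ennreal (f z) \<partial>lborel) \<Longrightarrow>
      ennreal ((\<beta> * g) powr s x) \<le> (\<integral>\<^sup>+z. ball_kernel R x z *
        ennreal (f z powr s z + (hh x + hh z)) \<partial>lborel)"
    unfolding hh_def by (rule log_holder_average[OF assms(1) s h N]) blast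
  obtain K where K: "K > 0" "\<And>t (x::'a). t > 0 \<Longrightarrow>
      (\<integral>\<^sup>+z. ennreal ((1 + norm (x - z) / t) powr - N) \<partial>lborel) \<le> ennreal (K * t ^ ?n)"
    by (rule nn_integral_kernel[of N, where 'a='a]) (auto simp: N_def)
  have hK: "(\<integral>\<^sup>+z. ennreal (hh z) \<partial>lborel) \<le> ennreal K"
    using K(2)[of 1 0] by (simp add: hh_def)
  define q where "q = 2 powr (?n - m)"
  have q: "0 < q" "q < 1" unfolding q_def using m by (auto intro: powr_less_one)
  define w where "w j = ennreal ((1 - q) * q ^ j)" for j :: nat
  have w1: "(\<Sum>j. w j) = 1"
  proof -
    have "(\<lambda>j. (1 - q) * q ^ j) sums ((1 - q) * (1 / (1 - q)))"
      by (intro sums_mult geometric_sums) (use q in auto)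
    then have "(\<lambda>j. (1 - q) * q ^ j) sums 1" using q by simp
    then have "(\<Sum>j. w j) = ennreal 1"
      unfolding w_def using q by (intro suminf_ennreal_eq) auto
    then show ?thesis by simp
  qed
  define A where "A = 2 powr m * ?v / (1 - q)"
  have A: "A > 0" using q by (simp add: A_def)
  \<comment> \<open>1 bounds the modular of \<open>f\<close>; the error term \<open>hh\<close>
    contributes \<open>K\<close> twice, once at \<open>x\<close> and once averaged over
    \<open>z\<close>.\<close>
  define C0 where "C0 = 1 + 2 * K"
  have C0: "C0 \<ge> 1" using K by (simp add: C0_def)
  define C where "C = C0 * A / \<beta>"
  have "C > 0" using C0 A \<beta> by (simp add: C_def)
  moreover have "\<exists>G. (\<integral>\<^sup>+x. G x \<partial>lborel) \<le> 1 \<and>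
        (\<forall>x g. 0 \<le> g \<longrightarrow>
          ennreal g \<le> (\<integral>\<^sup>+z. ennreal ((1 + norm (x - z) / t) powr - m / t ^ ?n) * ennreal (f z) \<partial>lborel) \<longrightarrow>
          ennreal ((g / C) powr s x) \<le> G x)"
    if t: "t > 0" and f: "\<And>z. f z \<ge> 0" and [measurable]: "f \<in> borel_measurable borel"
      and int: "(\<integral>\<^sup>+z. ennreal (f z powr s z) \<partial>lborel) \<le> 1" for t and f :: "'a \<Rightarrow> real"
  proof -
    define b where "b j = (ball_kernel (2 ^ j * t) :: 'a \<Rightarrow> 'a \<Rightarrow> ennreal)" for j
    have bm [measurable]: "(\<lambda>(x, z). b j x z) \<in> borel_measurable (borel \<Otimes>\<^sub>M borel)"
        "b j x \<in> borel_measurable borel" for j x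
      unfolding b_def by measurable
    have b1: "(\<integral>\<^sup>+z. b j x z \<partial>lborel) = 1" for j x
      unfolding b_def using t by (intro nn_integral_ball_kernel) simp
    define E where "E j x = (\<integral>\<^sup>+z. b j x z * ennreal (f z powr s z + (hh x + hh z)) \<partial>lborel)" for j x
    have E_eq: "E j x = (\<integral>\<^sup>+z. b j x z * ennreal (f z powr s z + hh z) \<partial>lborel) + ennreal (hh x)" for j x
    proof -
      have "E j x = (\<integral>\<^sup>+z. b j x z * ennreal (f z powr s z + hh z) + b j x z * ennreal (hh x) \<partial>lborel)"
        unfolding E_def
      proof (intro nn_integral_cong)
        fix z
        have "ennreal (f z powr s z + (hh x + hh z)) = ennreal (f z powr s z + hh z) + ennreal (hh x)"
          by (subst ennreal_plus[symmetric]) (auto simp: hh_def add_ac)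
        then show "b j x z * ennreal (f z powr s z + (hh x + hh z)) =
            b j x z * ennreal (f z powr s z + hh z) + b j x z * ennreal (hh x)"
          by (simp only: distrib_left)
      qed
      also have "\<dots> = (\<integral>\<^sup>+z. b j x z * ennreal (f z powr s z + hh z) \<partial>lborel) + (\<integral>\<^sup>+z. b j x z * ennreal (hh x) \<partial>lborel)"
        by (rule nn_integral_add) measurable
      finally show ?thesis by (simp add: nn_integral_multc b1)
    qed
    have [measurable]: "E j \<in> borel_measurable borel" for j
      unfolding E_eq[abs_def] by measurable
    have iE: "(\<integral>\<^sup>+x. E j x \<partial>lborel) \<le> ennreal C0" for j
    proof -
      have "(\<integral>\<^sup>+x. E j x \<partial>lborel) = (\<integral>\<^sup>+x. (\<integral>\<^sup>+z. b j x z * ennreal (f z powr s z + hh z) \<partial>lborel) \<partial>lborel) +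
          (\<integral>\<^sup>+x. ennreal (hh x) \<partial>lborel)"
        unfolding E_eq by (rule nn_integral_add) measurable
      also have "(\<integral>\<^sup>+x. (\<integral>\<^sup>+z. b j x z * ennreal (f z powr s z + hh z) \<partial>lborel) \<partial>lborel) =
          (\<integral>\<^sup>+z. ennreal (f z powr s z + hh z) \<partial>lborel)"
        unfolding b_def using t by (intro nn_integral_ball_average) auto
      also have "\<dots> = (\<integral>\<^sup>+z. ennreal (f z powr s z) + ennreal (hh z) \<partial>lborel)"
        by (intro nn_integral_cong ennreal_plus) (auto simp: hh_def)
      also have "\<dots> = (\<integral>\<^sup>+z. ennreal (f z powr s z) \<partial>lborel) + (\<integral>\<^sup>+z. ennreal (hh z) \<partial>lborel)"
        by (rule nn_integral_add) measurable
      also have "\<dots> + (\<integral>\<^sup>+x. ennreal (hh x) \<partial>lborel) \<le> (1 + ennreal K) + ennreal K"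
        by (intro add_mono int hK)
      also have "\<dots> = ennreal C0"
        using K(1) by (simp add: C0_def ennreal_plus[symmetric] ennreal_1[symmetric] del: ennreal_plus ennreal_1)
      finally show ?thesis .
    qed
    define G where "G x = ennreal (1 / C0) * (\<Sum>j. w j * E j x)" for x
    have "(\<integral>\<^sup>+x. G x \<partial>lborel) = ennreal (1 / C0) * (\<integral>\<^sup>+x. (\<Sum>j. w j * E j x) \<partial>lborel)"
      unfolding G_def by (rule nn_integral_cmult) measurable
    also have "(\<integral>\<^sup>+x. (\<Sum>j. w j * E j x) \<partial>lborel) = (\<Sum>j. \<integral>\<^sup>+x. w j * E j x \<partial>lborel)"
      by (rule nn_integral_suminf) measurable
    also have "\<dots> = (\<Sum>j. w j * (\<integral>\<^sup>+x. E j x \<partial>lborel))"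
      by (intro suminf_cong nn_integral_cmult) measurable
    also have "\<dots> \<le> (\<Sum>j. w j * ennreal C0)"
      by (intro suminf_le mult_left_mono iE) auto
    also have "(\<Sum>j. w j * ennreal C0) = ennreal C0"
      by (simp add: ennreal_suminf_multc w1)
    also have "ennreal (1 / C0) * ennreal C0 = 1"
      using C0 by (simp add: ennreal_mult'[symmetric])
    finally have "(\<integral>\<^sup>+x. G x \<partial>lborel) \<le> 1" by (simp add: mult_left_mono)
    moreover have "ennreal ((g / C) powr s x) \<le> G x"
      if g: "0 \<le> g" and gf: "ennreal g \<le>
        (\<integral>\<^sup>+z. ennreal ((1 + norm (x - z) / t) powr - m / t ^ ?n) * ennreal (f z) \<partial>lborel)" for x g
    proof -
      define a where "a j = (\<integral>\<^sup>+z. b j x z * ennreal (f z) \<partial>lborel)" for j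
      \<comment> \<open>The estimate for a single radius takes real lower bounds, so the averages
        have to be finite; this comes from \<open>f z \<le> 1 + f z powr s z\<close>.\<close>
      have fin: "a j < \<infinity>" for j
      proof -
        have "a j \<le> (\<integral>\<^sup>+z. b j x z * 1 + b j x z * ennreal (f z powr s z) \<partial>lborel)"
          unfolding a_def
        proof (rule nn_integral_mono)
          fix z
          have "f z \<le> 1 + f z powr s z"
            using powr_mono[of 1 "s z" "f z"] s[of z] f[of z] by (cases "f z \<le> 1") (auto intro: add_increasing2)
          then have "ennreal (f z) \<le> ennreal (1 + f z powr s z)" by (rule ennreal_leI)
          also have "\<dots> = 1 + ennreal (f z powr s z)" by (subst ennreal_plus) auto
          finally have "b j x z * ennreal (f z) \<le> b j x z * (1 + ennreal (f z powr s z))" by (intro mult_left_mono) auto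
          then show "b j x z * ennreal (f z) \<le> b j x z * 1 + b j x z * ennreal (f z powr s z)"
            by (simp only: distrib_left)
        qed
        also have "\<dots> = 1 + (\<integral>\<^sup>+z. b j x z * ennreal (f z powr s z) \<partial>lborel)"
          by (subst nn_integral_add) (auto simp: b1)
        also have "(\<integral>\<^sup>+z. b j x z * ennreal (f z powr s z) \<partial>lborel) \<le>
            (\<integral>\<^sup>+z. ennreal (1 / (?v * (2 ^ j * t) ^ ?n)) * ennreal (f z powr s z) \<partial>lborel)"
          unfolding b_def ball_kernel_def by (intro nn_integral_mono mult_right_mono) (auto simp: indicator_def)
        also have "\<dots> = ennreal (1 / (?v * (2 ^ j * t) ^ ?n)) * (\<integral>\<^sup>+z. ennreal (f z powr s z) \<partial>lborel)"
          by (rule nn_integral_cmult) measurable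
        also have "\<dots> \<le> ennreal (1 / (?v * (2 ^ j * t) ^ ?n)) * 1"
          by (intro mult_left_mono int) auto
        finally have "a j \<le> 1 + ennreal (1 / (?v * (2 ^ j * t) ^ ?n)) * 1" by (simp add: add_left_mono)
        also have "\<dots> < \<infinity>" by simp
        finally show ?thesis .
      qed
      define \<gamma> where "\<gamma> j = enn2real (a j)" for j
      have \<gamma>: "a j = ennreal (\<gamma> j)" "\<gamma> j \<ge> 0" for j
        using fin[of j] by (auto simp: \<gamma>_def)
      have Aq: "2 powr m * ?v * q ^ j = A * ((1 - q) * q ^ j)" for j
        using q by (simp add: A_def)
      have "ennreal g \<le> (\<integral>\<^sup>+z. (\<Sum>j. ennreal A * (w j * (b j x z * ennreal (f z)))) \<partial>lborel)"
      proof (rule order_trans[OF gf], rule nn_integral_mono)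
        fix z
        have "ennreal ((1 + norm (x - z) / t) powr - m / t ^ ?n) \<le> (\<Sum>j. ennreal A * w j * b j x z)"
          using kernel_le_ball_kernels[of m t x z] m t A q
          by (simp add: q_def[symmetric] Aq ennreal_mult' w_def b_def)
        then have "ennreal ((1 + norm (x - z) / t) powr - m / t ^ ?n) * ennreal (f z) \<le>
            (\<Sum>j. ennreal A * w j * b j x z) * ennreal (f z)" by (rule mult_right_mono) simp
        then show "ennreal ((1 + norm (x - z) / t) powr - m / t ^ ?n) * ennreal (f z) \<le>
            (\<Sum>j. ennreal A * (w j * (b j x z * ennreal (f z))))"
          by (simp only: ennreal_suminf_multc[symmetric] mult.assoc)
      qed
      also have "\<dots> = (\<Sum>j. \<integral>\<^sup>+z. ennreal A * (w j * (b j x z * ennreal (f z))) \<partial>lborel)"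
        by (rule nn_integral_suminf) measurable
      also have "\<dots> = (\<Sum>j. ennreal A * (w j * a j))"
        by (simp add: nn_integral_cmult a_def)
      also have "\<dots> = ennreal A * (\<Sum>j. w j * a j)" by (rule ennreal_suminf_cmult)
      finally have gA: "ennreal g \<le> ennreal A * (\<Sum>j. w j * a j)" .
      have "ennreal (\<beta> * g / A) = ennreal (\<beta> / A) * ennreal g"
        using \<beta>(1) A by (simp add: ennreal_mult'[symmetric])
      also have "\<dots> \<le> ennreal (\<beta> / A) * (ennreal A * (\<Sum>j. w j * a j))" by (intro mult_left_mono gA) auto
      also have "\<dots> = ennreal \<beta> * (\<Sum>j. w j * a j)"
        using \<beta>(1) A by (simp add: mult.assoc[symmetric] ennreal_mult'[symmetric])
      also have "\<dots> = (\<Sum>j. w j * ennreal (\<beta> * \<gamma> j))"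
        unfolding ennreal_suminf_cmult[symmetric]
        by (intro suminf_cong) (simp only: \<gamma>(1) ennreal_mult'[OF less_imp_le[OF \<beta>(1)]] mult.left_commute)
      \<comment> \<open>The series is read as an integral over the counting measure, so that the
        integral form of Jensen's inequality applies to the weights \<open>w j\<close>.\<close>
      also have "\<dots> = (\<integral>\<^sup>+j. w j * ennreal (\<beta> * \<gamma> j) \<partial>count_space UNIV)"
        by (simp add: nn_integral_count_space_nat)
      finally have "ennreal ((\<beta> * g / A) powr s x) \<le>
          (\<integral>\<^sup>+j. w j * ennreal ((\<beta> * \<gamma> j) powr s x) \<partial>count_space UNIV)"
        using \<beta>(1) \<gamma>(2) s A g
        by (intro nn_integral_jensen_powr) (auto simp: nn_integral_count_space_nat w1)
      also have "\<dots> = (\<Sum>j. w j * ennreal ((\<beta> * \<gamma> j) powr s x))"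
        by (simp add: nn_integral_count_space_nat)
      also have "\<dots> \<le> (\<Sum>j. w j * E j x)"
      proof (intro suminf_le mult_left_mono)
        fix j
        show "ennreal ((\<beta> * \<gamma> j) powr s x) \<le> E j x"
          unfolding E_def b_def using t f int \<gamma>
          by (intro \<beta>(2)) (auto simp: a_def[symmetric] b_def[symmetric] \<gamma>_def[symmetric])
      qed auto
      finally have main: "ennreal ((\<beta> * g / A) powr s x) \<le> (\<Sum>j. w j * E j x)" .
      \<comment> \<open>Since \<open>C0 \<ge> 1\<close> and \<open>s x \<ge> 1\<close>, the power of
        \<open>1 / C0\<close> is at most \<open>1 / C0\<close>, a constant free of
        \<open>x\<close>.\<close>
      have "(g / C) powr s x = (1 / C0 * (\<beta> * g / A)) powr s x" by (simp add: C_def mult.commute)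
      also have "\<dots> = (1 / C0) powr s x * (\<beta> * g / A) powr s x"
        using C0 \<beta>(1) g A by (intro powr_mult)
      also have "\<dots> \<le> (1 / C0) powr 1 * (\<beta> * g / A) powr s x"
        using C0 s[of x] by (intro mult_right_mono powr_mono') auto
      finally have "(g / C) powr s x \<le> (1 / C0) * (\<beta> * g / A) powr s x" using C0 by simp
      then have "ennreal ((g / C) powr s x) \<le> ennreal ((1 / C0) * (\<beta> * g / A) powr s x)" by (rule ennreal_leI)
      also have "\<dots> = ennreal (1 / C0) * ennreal ((\<beta> * g / A) powr s x)"
        using C0 by (intro ennreal_mult') auto
      also have "\<dots> \<le> G x" unfolding G_def by (intro mult_left_mono main) auto
      finally show ?thesis .
    qed
    ultimately show ?thesis by blast
  qed
  ultimately show ?thesis by (rule that)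
qed

section \<open>Peetre maximal functions\<close>

text \<open>Peetre's inequality at scale \<open>t\<close>, raised to a negative power.\<close>

lemma peetre_weight_mult_le:
  fixes x y z :: "'a::real_normed_vector"
  assumes "t > 0" "a \<ge> 0"
  shows "(1 + norm (y - z) / t) powr - a * (1 + norm (x - y) / t) powr - a \<le> (1 + norm (x - z) / t) powr - a"
proof -
  let ?A = "1 + norm (y - z) / t" and ?B = "1 + norm (x - y) / t"
  have A: "?A \<ge> 1" and B: "?B \<ge> 1" using assms by auto
  have "norm (x - z) \<le> norm (x - y) + norm (y - z)" using norm_triangle_ineq[of "x - y" "y - z"] by simp
  then have "norm (x - z) / t \<le> (norm (x - y) + norm (y - z)) / t" using assms by (intro divide_right_mono) auto
  then have "1 + norm (x - z) / t \<le> ?A + ?B - 1" by (simp add: add_divide_distrib)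
  also have "\<dots> \<le> ?A * ?B" using mult_nonneg_nonneg[of "?A - 1" "?B - 1"] A B by (simp add: algebra_simps)
  finally have le: "1 + norm (x - z) / t \<le> ?A * ?B" .
  have "?A powr - a * ?B powr - a = (?A * ?B) powr - a" using A B by (intro powr_mult[symmetric])
  also have "\<dots> \<le> (1 + norm (x - z) / t) powr - a"
    using le assms by (intro powr_mono2') (auto simp: add_pos_nonneg)
  finally show ?thesis .
qed

text \<open>The decay \<open>DIM('a) + 1 + a\<close> is used in two parts:
  \<open>DIM('a) + 1\<close> powers form an integrable kernel \<open>k\<close> for Jensen's
  inequality, and the other \<open>a\<close> powers combine with the weight between \<open>x\<close>
  and \<open>y\<close> into the weight between \<open>x\<close> and \<open>z\<close>. After the
  \<open>r\<close>-th power \<open>k\<close> is bounded by \<open>D / t ^ DIM('a)\<close>, and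
  \<open>y\<close> disappears from the right-hand side.\<close>

lemma peetre_pointwise:
  fixes u :: "'a::euclidean_space \<Rightarrow> real" and a r D :: real
  assumes a: "a \<ge> 0" and r: "r \<ge> 1" and D: "D > 0"
  obtains B where "B > 0"
    "\<And>t u x y. t > 0 \<Longrightarrow> (\<And>z. u z \<ge> 0) \<Longrightarrow> u \<in> borel_measurable borel \<Longrightarrow>
      (\<And>y. ennreal (u y) \<le> (\<integral>\<^sup>+z. ennreal (D * (1 + norm (y - z) / t) powr - (DIM('a) + 1 + a) / t ^ DIM('a)) * ennreal (u z) \<partial>lborel)) \<Longrightarrow>
      ennreal ((u y / (1 + norm (x - y) / t) powr a) powr r / B) \<le>
        (\<integral>\<^sup>+z. ennreal ((1 + norm (x - z :: 'a) / t) powr - (a * r) / t ^ DIM('a)) * ennreal (u z powr r) \<partial>lborel)"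
proof -
  let ?n = "DIM('a)"
  define N where "N = real ?n + 1"
  obtain K where K: "K > 0" "\<And>t (x::'a). t > 0 \<Longrightarrow>
      (\<integral>\<^sup>+z. ennreal ((1 + norm (x - z) / t) powr - N) \<partial>lborel) \<le> ennreal (K * t ^ ?n)"
    by (rule nn_integral_kernel[of N, where 'a='a]) (auto simp: N_def)
  \<comment> \<open>Normalises \<open>k\<close> to mass at most 1; being at least 1 it also gives
    \<open>D / E \<le> D\<close>.\<close>
  define E where "E = max 1 (D * K)"
  have E: "E \<ge> 1" "D * K \<le> E" by (auto simp: E_def)
  define B where "B = E powr r * D"
  have "B > 0" using E D by (simp add: B_def)
  moreover have "ennreal ((u y / (1 + norm (x - y) / t) powr a) powr r / B) \<le>
        (\<integral>\<^sup>+z. ennreal ((1 + norm (x - z) / t) powr - (a * r) / t ^ ?n) * ennreal (u z powr r) \<partial>lborel)"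
    if t: "t > 0" and u: "\<And>z. u z \<ge> 0" and [measurable]: "u \<in> borel_measurable borel"
      and le: "\<And>y. ennreal (u y) \<le>
        (\<integral>\<^sup>+z. ennreal (D * (1 + norm (y - z) / t) powr - (?n + 1 + a) / t ^ ?n) * ennreal (u z) \<partial>lborel)"
    for t and u :: "'a \<Rightarrow> real" and x y
  proof -
    define k where "k z = ennreal (D / E * ((1 + norm (y - z) / t) powr - N / t ^ ?n))" for z
    have [measurable]: "k \<in> borel_measurable borel" unfolding k_def by measurable
    define U where "U = u y / (1 + norm (x - y) / t) powr a"
    have U: "U \<ge> 0" using u by (simp add: U_def)
    have "(\<integral>\<^sup>+z. k z \<partial>lborel) = ennreal (D / E / t ^ ?n) * (\<integral>\<^sup>+z. ennreal ((1 + norm (y - z) / t) powr - N) \<partial>lborel)"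
      unfolding k_def using D E t
      by (subst nn_integral_cmult[symmetric]) (auto simp: ennreal_mult'[symmetric] mult_ac intro!: nn_integral_cong)
    also have "\<dots> \<le> ennreal (D / E / t ^ ?n) * ennreal (K * t ^ ?n)" by (intro mult_left_mono K t) auto
    also have "\<dots> = ennreal (D * K / E)" using D E t K by (simp add: ennreal_mult'[symmetric])
    also have "\<dots> \<le> 1" using E D K by (simp add: ennreal_le_1)
    finally have k1: "(\<integral>\<^sup>+z. k z \<partial>lborel) \<le> 1" .
    have pt: "1 / (E * (1 + norm (x - y) / t) powr a) * (D * (1 + norm (y - z) / t) powr - (?n + 1 + a) / t ^ ?n) \<le>
        D / E * ((1 + norm (y - z) / t) powr - N / t ^ ?n) * (1 + norm (x - z) / t) powr - a" for z
    proof -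
      have sp: "(1 + norm (y - z) / t) powr - (?n + 1 + a) = (1 + norm (y - z) / t) powr - N * (1 + norm (y - z) / t) powr - a"
      proof -
        have e: "- (?n + 1 + a) = - N + - a" by (simp add: N_def)
        show ?thesis unfolding e by (rule powr_add)
      qed
      have "1 / (E * (1 + norm (x - y) / t) powr a) * (D * (1 + norm (y - z) / t) powr - (?n + 1 + a) / t ^ ?n) =
          D / E * ((1 + norm (y - z) / t) powr - N / t ^ ?n) *
          ((1 + norm (y - z) / t) powr - a * (1 + norm (x - y) / t) powr - a)"
        unfolding sp by (simp add: powr_minus_divide)
      also have "\<dots> \<le> D / E * ((1 + norm (y - z) / t) powr - N / t ^ ?n) * (1 + norm (x - z) / t) powr - a"
        using D E t a by (intro mult_left_mono peetre_weight_mult_le) auto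
      finally show ?thesis .
    qed
    have "ennreal (U / E) = ennreal (1 / (E * (1 + norm (x - y) / t) powr a)) * ennreal (u y)"
    proof -
      have "U / E = 1 / (E * (1 + norm (x - y) / t) powr a) * u y" by (simp add: U_def mult.commute)
      then show ?thesis using E by (simp only:) (rule ennreal_mult', simp)
    qed
    also have "\<dots> \<le> ennreal (1 / (E * (1 + norm (x - y) / t) powr a)) *
        (\<integral>\<^sup>+z. ennreal (D * (1 + norm (y - z) / t) powr - (?n + 1 + a) / t ^ ?n) * ennreal (u z) \<partial>lborel)"
      by (intro mult_left_mono le) auto
    also have "\<dots> = (\<integral>\<^sup>+z. ennreal (1 / (E * (1 + norm (x - y) / t) powr a)) *
        (ennreal (D * (1 + norm (y - z) / t) powr - (?n + 1 + a) / t ^ ?n) * ennreal (u z)) \<partial>lborel)"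
      by (rule nn_integral_cmult[symmetric]) measurable
    also have "\<dots> \<le> (\<integral>\<^sup>+z. k z * ennreal ((1 + norm (x - z) / t) powr - a * u z) \<partial>lborel)"
    proof (rule nn_integral_mono)
      fix z
      have "1 / (E * (1 + norm (x - y) / t) powr a) * (D * (1 + norm (y - z) / t) powr - (?n + 1 + a) / t ^ ?n) * u z \<le>
        D / E * ((1 + norm (y - z) / t) powr - N / t ^ ?n) * (1 + norm (x - z) / t) powr - a * u z"
        by (rule mult_right_mono[OF pt u])
      from ennreal_leI[OF this]
      show "ennreal (1 / (E * (1 + norm (x - y) / t) powr a)) *
          (ennreal (D * (1 + norm (y - z) / t) powr - (?n + 1 + a) / t ^ ?n) * ennreal (u z)) \<le>
          k z * ennreal ((1 + norm (x - z) / t) powr - a * u z)"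
        unfolding k_def using E D t u[of z] by (simp add: ennreal_mult'[symmetric] mult.assoc)
    qed
    finally have "ennreal ((U / E) powr r) \<le> (\<integral>\<^sup>+z. k z * ennreal (((1 + norm (x - z) / t) powr - a * u z) powr r) \<partial>lborel)"
      using U E r u k1 by (intro nn_integral_jensen_powr) auto
    also have "\<dots> \<le> (\<integral>\<^sup>+z. ennreal D * (ennreal ((1 + norm (x - z) / t) powr - (a * r) / t ^ ?n) * ennreal (u z powr r)) \<partial>lborel)"
    proof (rule nn_integral_mono)
      fix z
      have eq: "((1 + norm (x - z) / t) powr - a * u z) powr r = (1 + norm (x - z) / t) powr - (a * r) * u z powr r"
        using u[of z] by (simp add: powr_mult powr_powr)
      have "(1 + norm (y - z) / t) powr - N \<le> 1 powr - N"
        using t by (intro powr_mono2') (auto simp: N_def)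
      then have "(1 + norm (y - z) / t) powr - N \<le> 1" by simp
      then have "D / E * ((1 + norm (y - z) / t) powr - N / t ^ ?n) \<le> D / 1 * (1 / t ^ ?n)"
        using D E t by (intro mult_mono divide_left_mono divide_right_mono) auto
      then have "D / E * ((1 + norm (y - z) / t) powr - N / t ^ ?n) * ((1 + norm (x - z) / t) powr - (a * r) * u z powr r) \<le>
          D / 1 * (1 / t ^ ?n) * ((1 + norm (x - z) / t) powr - (a * r) * u z powr r)"
        by (rule mult_right_mono) simp
      from ennreal_leI[OF this]
      show "k z * ennreal (((1 + norm (x - z) / t) powr - a * u z) powr r) \<le>
          ennreal D * (ennreal ((1 + norm (x - z) / t) powr - (a * r) / t ^ ?n) * ennreal (u z powr r))"
        unfolding k_def eq using D E t by (simp add: ennreal_mult'[symmetric])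
    qed
    also have "\<dots> = ennreal D * (\<integral>\<^sup>+z. ennreal ((1 + norm (x - z) / t) powr - (a * r) / t ^ ?n) * ennreal (u z powr r) \<partial>lborel)"
      by (rule nn_integral_cmult) measurable
    finally have main: "ennreal ((U / E) powr r) \<le> ennreal D *
      (\<integral>\<^sup>+z. ennreal ((1 + norm (x - z) / t) powr - (a * r) / t ^ ?n) * ennreal (u z powr r) \<partial>lborel)" (is "_ \<le> _ * ?X") .
    have "(U powr r) / B = (1 / D) * (U / E) powr r"
      using U E by (simp add: B_def powr_divide)
    then have "ennreal (U powr r / B) = ennreal (1 / D) * ennreal ((U / E) powr r)"
      using D by (simp add: ennreal_mult'[symmetric])
    also have "\<dots> \<le> ennreal (1 / D) * (ennreal D * ?X)" by (intro mult_left_mono main) auto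
    also have "\<dots> = ?X" using D by (simp add: mult.assoc[symmetric] ennreal_mult'[symmetric])
    finally show ?thesis by (simp add: U_def)
  qed
  ultimately show ?thesis by (rule that)
qed

section \<open>Comparison of variable exponent norms through their modulars\<close>

lemma ennpowr_ennreal: "0 \<le> x \<Longrightarrow> ennpowr (ennreal x) r = ennreal (x powr r)"
  by (simp add: ennpowr_def)

lemma ennpowr_mono:
  assumes "x \<le> y" "r \<ge> 0"
  shows "ennpowr x r \<le> ennpowr y r"
proof (cases "y = \<infinity>")
  case False
  then have "x \<noteq> \<infinity>" using assms(1) by (auto simp: top_unique)
  with False assms show ?thesis
    by (auto simp: ennpowr_def intro!: ennreal_leI powr_mono2 enn2real_mono) (simp add: less_top)
qed (simp add: ennpowr_def)

lemma ennpowr_le_of_le: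
  assumes "x \<le> ennreal (g powr (1 / r))" "r > 0" "g \<ge> 0"
  shows "ennpowr x r \<le> ennreal g"
proof -
  have "ennpowr x r \<le> ennpowr (ennreal (g powr (1 / r))) r" using assms by (intro ennpowr_mono) auto
  also have "\<dots> = ennreal g" using assms by (simp add: ennpowr_ennreal powr_powr)
  finally show ?thesis .
qed

text \<open>Every \<open>l\<close> admissible for \<open>f\<close> yields \<open>B * l\<close>
  admissible for \<open>h\<close>; if \<open>f\<close> has none, the infimum of the empty set is
  infinite and the bound is trivial.\<close>

lemma var_norm_le_cmult:
  assumes B: "B > 0"
    and le: "\<And>l. l > 0 \<Longrightarrow> (\<integral>\<^sup>+ x. ennpowr (f x / ennreal l) (p x) \<partial>lebesgue) \<le> 1 \<Longrightarrow>
      (\<integral>\<^sup>+ x. ennpowr (h x / ennreal (B * l)) (p x) \<partial>lebesgue) \<le> 1"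
  shows "var_norm p h \<le> ennreal B * var_norm p f"
proof -
  have "var_norm p h / ennreal B \<le> var_norm p f"
    unfolding var_norm_def[of p f]
  proof (rule Inf_greatest)
    fix y assume "y \<in> {ennreal l | l. l > 0 \<and> (\<integral>\<^sup>+ x. ennpowr (f x / ennreal l) (p x) \<partial>lebesgue) \<le> 1}"
    then obtain l where l: "y = ennreal l" "l > 0" "(\<integral>\<^sup>+ x. ennpowr (f x / ennreal l) (p x) \<partial>lebesgue) \<le> 1" by blast
    then have "var_norm p h \<le> ennreal (B * l)"
      unfolding var_norm_def using B le[OF l(2,3)] by (intro Inf_lower) auto
    also have "\<dots> = ennreal B * y" using B l by (simp add: ennreal_mult')
    finally have "var_norm p h / ennreal B \<le> (ennreal B * y) / ennreal B" by (rule divide_right_mono_ennreal)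
    also have "\<dots> = y" using B by (simp add: ennreal_mult_divide_eq mult.commute[of "ennreal B"])
    finally show "var_norm p h / ennreal B \<le> y" .
  qed
  then have "ennreal B * (var_norm p h / ennreal B) \<le> ennreal B * var_norm p f" by (intro mult_left_mono) auto
  then show ?thesis using B by (simp add: ennreal_times_divide ennreal_mult_divide_eq mult.commute[of "ennreal B"])
qed

lemma var_norm_dt_le_cmult:
  assumes B: "B > 0" and q: "\<And>t. t \<in> I \<Longrightarrow> q t \<ge> 0" and le: "\<And>t. t \<in> I \<Longrightarrow> h t \<le> ennreal B * f t"
  shows "var_norm_dt q I h \<le> ennreal B * var_norm_dt q I f"
proof -
  have "var_norm_dt q I h / ennreal B \<le> var_norm_dt q I f"
    unfolding var_norm_dt_def[of q I f]
  proof (rule Inf_greatest)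
    fix y assume "y \<in> {ennreal l | l. l > 0 \<and>
       (\<integral>\<^sup>+ t\<in>I. ennpowr (f t / ennreal l) (q t) * ennreal (1 / t) \<partial>lebesgue) \<le> 1}"
    then obtain l where l: "y = ennreal l" "l > 0"
        "(\<integral>\<^sup>+ t\<in>I. ennpowr (f t / ennreal l) (q t) * ennreal (1 / t) \<partial>lebesgue) \<le> 1" by blast
    have "(\<integral>\<^sup>+ t\<in>I. ennpowr (h t / ennreal (B * l)) (q t) * ennreal (1 / t) \<partial>lebesgue) \<le>
        (\<integral>\<^sup>+ t\<in>I. ennpowr (f t / ennreal l) (q t) * ennreal (1 / t) \<partial>lebesgue)"
    proof (rule nn_integral_mono)
      fix t
      have "ennpowr (h t / ennreal (B * l)) (q t) \<le> ennpowr (f t / ennreal l) (q t)" if "t \<in> I"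
      proof (rule ennpowr_mono[OF _ q[OF that]])
        have Bl: "B * l > 0" using B l by simp
        have "h t / ennreal (B * l) \<le> (ennreal B * f t) / ennreal (B * l)"
          by (rule divide_right_mono_ennreal[OF le[OF that]])
        also have "\<dots> = f t * (ennreal B * ennreal (inverse (B * l)))"
          by (simp only: divide_ennreal_def inverse_ennreal[OF Bl] mult.assoc mult.left_commute)
        also have "ennreal B * ennreal (inverse (B * l)) = ennreal (inverse l)"
          using B l(2) by (simp add: ennreal_mult'[symmetric])
        also have "f t * ennreal (inverse l) = f t / ennreal l"
          using l(2) by (simp add: divide_ennreal_def inverse_ennreal)
        finally show "h t / ennreal (B * l) \<le> f t / ennreal l" .
      qed
      then show "ennpowr (h t / ennreal (B * l)) (q t) * ennreal (1 / t) * indicator I t \<le>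
          ennpowr (f t / ennreal l) (q t) * ennreal (1 / t) * indicator I t"
        by (cases "t \<in> I") (auto intro!: mult_right_mono)
    qed
    also note l(3)
    finally have "var_norm_dt q I h \<le> ennreal (B * l)"
      unfolding var_norm_dt_def using B l by (intro Inf_lower) auto
    also have "\<dots> = ennreal B * y" using B l by (simp add: ennreal_mult')
    finally have "var_norm_dt q I h / ennreal B \<le> (ennreal B * y) / ennreal B" by (rule divide_right_mono_ennreal)
    also have "\<dots> = y" using B by (simp add: ennreal_mult_divide_eq mult.commute[of "ennreal B"])
    finally show "var_norm_dt q I h / ennreal B \<le> y" .
  qed
  then have "ennreal B * (var_norm_dt q I h / ennreal B) \<le> ennreal B * var_norm_dt q I f" by (intro mult_left_mono) auto
  then show ?thesis using B by (simp add: ennreal_times_divide ennreal_mult_divide_eq mult.commute[of "ennreal B"])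
qed

section \<open>Consequences of log-Hoelder continuity\<close>

lemma log_holder_loc_continuous:
  assumes "g \<in> log_holder_loc"
  shows "continuous_on UNIV g"
proof -
  obtain c where c: "c > 0" "\<And>x y. \<bar>g x - g y\<bar> \<le> c / ln (exp 1 + 1 / norm (x - y))"
    using assms unfolding log_holder_loc_def by blast
  have "\<exists>d>0. \<forall>y. dist y x < d \<longrightarrow> dist (g y) (g x) < e" if e: "e > 0" for x e
  \<comment> \<open>The distance \<open>d\<close> solves \<open>c / ln (1 / d) = e\<close>.\<close>
  proof (intro exI[of _ "exp (- (c / e))"] conjI allI impI)
    fix y assume y: "dist y x < exp (- (c / e))"
    show "dist (g y) (g x) < e"
    proof (cases "y = x")
      case False
      then have d: "norm (y - x) > 0" by simp
      have "1 / exp (- (c / e)) < 1 / norm (y - x)" using y d by (intro divide_strict_left_mono) (auto simp: dist_norm)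
      then have lt: "exp (c / e) < exp 1 + 1 / norm (y - x)" by (simp add: exp_minus field_simps add_strict_increasing2)
      then have "ln (exp (c / e)) < ln (exp 1 + 1 / norm (y - x))"
        by (subst ln_less_cancel_iff) (auto simp: add_pos_nonneg)
      then have L: "c / e < ln (exp 1 + 1 / norm (y - x))" by simp
      moreover have "c / e > 0" using c e by simp
      ultimately have "ln (exp 1 + 1 / norm (y - x)) > 0" by linarith
      with L have "c / ln (exp 1 + 1 / norm (y - x)) < e" using e by (simp add: field_simps)
      then show ?thesis using c(2)[of y x] by (simp add: dist_real_def)
    qed (use e in simp)
  qed simp
  then show ?thesis unfolding continuous_on_iff by (auto simp: dist_commute)
qed

lemma log_holder_cmult:
  assumes g: "g \<in> log_holder" and k: "k > 0"
  shows "(\<lambda>x. k * g x) \<in> log_holder"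
proof -
  obtain c where c: "c > 0" "\<And>x y. \<bar>g x - g y\<bar> \<le> c / ln (exp 1 + 1 / norm (x - y))"
    using g unfolding log_holder_def log_holder_loc_def by blast
  obtain l d where d: "d > 0" "\<And>x. \<bar>g x - l\<bar> \<le> d / ln (exp 1 + norm x)"
    using g unfolding log_holder_def by blast
  have sc: "\<bar>k * u - k * v\<bar> = k * \<bar>u - v\<bar>" for u v
    using k by (simp add: right_diff_distrib[symmetric] abs_mult)
  have "\<bar>k * g x - k * g y\<bar> \<le> (k * c) / ln (exp 1 + 1 / norm (x - y))" for x y
    unfolding sc using mult_left_mono[OF c(2)[of x y], of k] k by simp
  moreover have "\<bar>k * g x - k * l\<bar> \<le> (k * d) / ln (exp 1 + norm x)" for x
    unfolding sc using mult_left_mono[OF d(2)[of x], of k] k by simp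
  moreover have "k * c > 0" "k * d > 0" using k c d by auto
  ultimately show ?thesis unfolding log_holder_def log_holder_loc_def by blast
qed

lemma var_exponent_log_continuous:
  assumes "p \<in> var_exponent_log"
  shows "continuous_on UNIV p"
proof -
  have p1: "p x \<ge> 1" for x using assms by (auto simp: var_exponent_log_def var_exponent_def)
  have p0: "p x \<noteq> 0" for x using p1[of x] by auto
  have "continuous_on UNIV (\<lambda>x. 1 / p x)"
    using assms by (intro log_holder_loc_continuous) (auto simp: var_exponent_log_def log_holder_def)
  then have "continuous_on UNIV (\<lambda>x. 1 / (1 / p x))"
    by (rule continuous_on_divide[OF continuous_on_const]) (use p0 in simp)
  then show ?thesis by simp
qed

text \<open>Nonempty open sets have positive measure, so for continuous \<open>p\<close> a lower
  bound almost everywhere is a lower bound everywhere.\<close>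

lemma ess_inf_le:
  assumes p: "p \<in> var_exponent" and c: "continuous_on UNIV p"
  shows "1 \<le> ess_inf p" "ess_inf p \<le> p x"
proof -
  have all: "b \<le> p y" if "AE x in lebesgue. b \<le> p x" for b y
  proof (rule ccontr)
    assume n: "\<not> b \<le> p y"
    have op: "open {x. p x < b}" using c by (intro open_Collect_less continuous_on_const)
    then have "{x. p x < b} \<in> sets lebesgue" by simp
    then have "{x. p x < b} \<in> null_sets lebesgue"
      using that by (simp add: AE_iff_null_sets not_less)
    then have "negligible {x. p x < b}" by (simp add: negligible_iff_null_sets)
    moreover have "{x. p x < b} \<noteq> {}" using n by (auto intro: exI[of _ y])
    ultimately show False using open_not_negligible[OF op] by blast
  qed
  have one: "1 \<in> {c. AE x in lebesgue. c \<le> p x}" using p by (simp add: var_exponent_def)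
  have bdd: "bdd_above {c. AE x in lebesgue. c \<le> p x}"
    by (rule bdd_aboveI[of _ "p 0"], rule all) (simp only: mem_Collect_eq)
  show "1 \<le> ess_inf p" unfolding ess_inf_def by (rule cSup_upper[OF one bdd])
  show "ess_inf p \<le> p x" unfolding ess_inf_def
    by (rule cSup_least, use one in blast, rule all) (simp only: mem_Collect_eq)
qed

text \<open>\<open>1 / t\<close> is at most the product of \<open>1 + norm (y - z) / t\<close> and
  \<open>exp 1 + 1 / norm (y - z)\<close>. The logarithm of the second factor is cancelled by the
  modulus of continuity of \<open>\<alpha>\<close>, and the first factor contributes the power
  \<open>c\<close>.\<close>

lemma log_holder_loc_weight:
  assumes "\<alpha> \<in> log_holder_loc"
  obtains c E where "c > 0" "E > 0"
    "\<And>t y z. 0 < t \<Longrightarrow> t \<le> 1 \<Longrightarrow> t powr - \<alpha> y \<le> E * t powr - \<alpha> z * (1 + norm (y - z) / t) powr c"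
proof -
  obtain c where c: "c > 0" "\<And>x y. \<bar>\<alpha> x - \<alpha> y\<bar> \<le> c / ln (exp 1 + 1 / norm (x - y))"
    using assms unfolding log_holder_loc_def by blast
  have "t powr - \<alpha> y \<le> exp c * t powr - \<alpha> z * (1 + norm (y - z) / t) powr c" if t: "0 < t" "t \<le> 1" for t y z
  proof -
    define W where "W = 1 + norm (y - z) / t"
    have W: "W \<ge> 1" using t by (simp add: W_def)
    have "(\<alpha> y - \<alpha> z) * ln (1 / t) \<le> c + c * ln W"
    proof (cases "y = z")
      case True
      then show ?thesis using c W by simp
    next
      case False
      then have d: "norm (y - z) > 0" by simp
      define L where "L = ln (exp 1 + 1 / norm (y - z))"
      have L: "L \<ge> 1" unfolding L_def by (intro ln_exp_plus_ge_one) simp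
      have "1 / t \<le> W * (exp 1 + 1 / norm (y - z))"
      proof -
        have "1 / t = (norm (y - z) / t) * (1 / norm (y - z))" using d by simp
        also have "\<dots> \<le> W * (exp 1 + 1 / norm (y - z))" unfolding W_def using t d by (intro mult_mono) auto
        finally show ?thesis .
      qed
      moreover have pos: "exp 1 + 1 / norm (y - z) > 0" by (simp add: add_pos_nonneg)
      ultimately have "ln (1 / t) \<le> ln (W * (exp 1 + 1 / norm (y - z)))"
        using t W by (subst ln_le_cancel_iff) auto
      also have "\<dots> = ln W + L" unfolding L_def using W pos by (intro ln_mult_pos) auto
      finally have lt: "ln (1 / t) \<le> ln W + L" .
      have "(\<alpha> y - \<alpha> z) * ln (1 / t) \<le> \<bar>\<alpha> y - \<alpha> z\<bar> * ln (1 / t)"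
        using t by (intro mult_right_mono) auto
      also have "\<dots> \<le> (c / L) * (ln W + L)"
        using c L t lt by (intro mult_mono) (auto simp: L_def)
      also have "\<dots> = c / L * ln W + c" using L by (simp add: distrib_left)
      also have "\<dots> \<le> c * ln W + c"
      proof -
        have "c / L \<le> c / 1" using c L by (intro divide_left_mono) auto
        then show ?thesis using W by (intro add_right_mono mult_right_mono) auto
      qed
      finally show ?thesis by simp
    qed
    then have "exp ((\<alpha> y - \<alpha> z) * ln (1 / t)) \<le> exp (c + c * ln W)" by simp
    also have "\<dots> = exp c * W powr c" using W by (simp add: exp_add powr_def)
    finally have e: "exp ((\<alpha> y - \<alpha> z) * ln (1 / t)) \<le> exp c * W powr c" .
    have "t powr - \<alpha> y = t powr - \<alpha> z * exp ((\<alpha> y - \<alpha> z) * ln (1 / t))"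
      using t by (simp add: powr_def ln_div algebra_simps flip: exp_add)
    also have "\<dots> \<le> t powr - \<alpha> z * (exp c * W powr c)" by (intro mult_left_mono e) auto
    finally show ?thesis by (simp add: W_def mult_ac)
  qed
  then show ?thesis using c(1) by (intro that[of c "exp c"]) auto
qed

text \<open>A real decay rate \<open>L\<close> is reached through a natural number
  \<open>N \<ge> L\<close>; measuring a dilation by \<open>t / 4\<close> at scale \<open>t\<close>
  costs the factor \<open>4 ^ DIM('a)\<close>.\<close>

lemma dilate_decay:
  fixes \<Phi> :: "'a::euclidean_space \<Rightarrow> complex"
  assumes \<Phi>: "\<Phi> \<in> schwartz"
  obtains A where "A > 0"
    "\<And>t w. t > 0 \<Longrightarrow> cmod (dilate \<Phi> (t / 4) w) \<le> A * (1 + norm w / t) powr - L / t ^ DIM('a)"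
proof -
  let ?n = "DIM('a)"
  obtain N :: nat where N: "L \<le> real N" using real_arch_simple by blast
  obtain C where C: "C > 0" "\<And>x. (1 + norm x) ^ N * cmod (\<Phi> x) \<le> C"
    using schwartz_bounded[OF \<Phi>] by metis
  have "cmod (dilate \<Phi> (t / 4) w) \<le> (C * 4 ^ ?n) * (1 + norm w / t) powr - L / t ^ ?n" if t: "t > 0" for t w
  proof -
    let ?x = "w /\<^sub>R (t / 4)" and ?W = "1 + norm w / t"
    have W: "?W \<ge> 1" using t by simp
    have nx: "norm ?x = 4 * (norm w / t)" using t by (simp add: field_simps)
    have "0 \<le> norm w / t" using t by simp
    then have "?W \<le> 1 + norm ?x" unfolding nx by linarith
    then have "?W ^ N * cmod (\<Phi> ?x) \<le> (1 + norm ?x) ^ N * cmod (\<Phi> ?x)"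
      using W by (intro mult_right_mono power_mono; (linarith | simp))
    also have "\<dots> \<le> C" by (rule C)
    finally have "cmod (\<Phi> ?x) \<le> C / ?W ^ N" using W by (simp add: pos_le_divide_eq mult.commute)
    also have "\<dots> = C * ?W powr - real N"
    proof -
      have "?W > 0" using W by linarith
      then show ?thesis by (simp add: powr_minus_divide powr_realpow)
    qed
    also have "\<dots> \<le> C * ?W powr - L" using C N W by (intro mult_left_mono powr_mono) auto
    finally have "cmod (\<Phi> ?x) \<le> C * ?W powr - L" .
    then have "cmod (\<Phi> ?x) / (t / 4) ^ ?n \<le> C * ?W powr - L / (t / 4) ^ ?n"
      using t by (intro divide_right_mono) auto
    moreover have "cmod (dilate \<Phi> (t / 4) w) = cmod (\<Phi> ?x) / (t / 4) ^ ?n"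
    proof -
      have "\<bar>(t / 4) ^ ?n\<bar> = (t / 4) ^ ?n" using t by simp
      then show ?thesis
        unfolding dilate_def norm_scaleR abs_inverse by (simp only: divide_inverse mult.commute)
    qed
    moreover have "C * ?W powr - L / (t / 4) ^ ?n = (C * 4 ^ ?n) * ?W powr - L / t ^ ?n"
      by (simp add: power_divide)
    ultimately show ?thesis by (simp only:)
  qed
  then show ?thesis using C(1) by (intro that[of "C * 4 ^ ?n"]) auto
qed

lemma conv_dilate_continuous:
  assumes "f \<in> tempered_distribution" "g \<in> schwartz" "t \<noteq> 0"
  shows "continuous_on UNIV (conv (dilate g t) f)"
  using tempered_translate_continuous[OF assms(1) schwartz_dilate[OF assms(2,3)]]
  by (simp add: conv_def[abs_def])

lemma var_norm_mono:
  assumes p: "\<And>x. p x \<ge> 0" and le: "\<And>x. h x \<le> f x"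
  shows "var_norm p h \<le> var_norm p f"
proof -
  have "var_norm p h \<le> ennreal 1 * var_norm p f"
  proof (rule var_norm_le_cmult)
    fix l :: real assume "(\<integral>\<^sup>+ x. ennpowr (f x / ennreal l) (p x) \<partial>lebesgue) \<le> 1"
    moreover have "(\<integral>\<^sup>+ x. ennpowr (h x / ennreal l) (p x) \<partial>lebesgue) \<le> (\<integral>\<^sup>+ x. ennpowr (f x / ennreal l) (p x) \<partial>lebesgue)"
      by (intro nn_integral_mono ennpowr_mono divide_right_mono_ennreal le p)
    ultimately show "(\<integral>\<^sup>+ x. ennpowr (h x / ennreal (1 * l)) (p x) \<partial>lebesgue) \<le> 1" by simp
  qed simp
  then show ?thesis by simp
qed

text \<open>Stated for any \<open>g\<close> with spectrum in the ball of radius 2, so that it serves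
  both summands of the norm. The \<open>r\<close>-th power of the pointwise bound becomes a modular
  with exponent \<open>p / r \<ge> 1\<close>, and the resulting majorant is independent of the point
  \<open>y\<close> in the supremum.\<close>

lemma peetre_local_norm_le:
  fixes \<alpha> p :: "'a::euclidean_space \<Rightarrow> real" and \<Phi> \<phi> g :: "'a \<Rightarrow> complex"
  assumes \<alpha>: "\<alpha> \<in> log_holder_loc" and p: "p \<in> var_exponent_log"
    and a: "a > real DIM('a) / ess_inf p" and ru: "resolution_of_unity \<Phi> \<phi>"
    and g: "g \<in> schwartz" and supp: "supp (fourier g) \<subseteq> {\<xi>. norm \<xi> < 2}"
  obtains B where "B > 0"
    "\<And>f t. f \<in> tempered_distribution \<Longrightarrow> 0 < t \<Longrightarrow> t \<le> 1 \<Longrightarrow>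
      var_norm p (peetre_local g a \<alpha> t f) \<le>
        ennreal B * var_norm p (\<lambda>x. ennreal (t powr (- \<alpha> x) * cmod (conv (dilate g t) f x)))"
proof -
  let ?n = "DIM('a)"
  have pe: "p \<in> var_exponent" using p by (simp add: var_exponent_log_def)
  have pc: "continuous_on UNIV p" by (rule var_exponent_log_continuous[OF p])
  define r where "r = ess_inf p"
  have r: "r \<ge> 1" "\<And>x. r \<le> p x" unfolding r_def by (auto intro: ess_inf_le[OF pe pc])
  have p1: "p x \<ge> 1" for x using r order_trans by blast
  have ar: "a * r > ?n" using a r(1) unfolding r_def[symmetric] by (simp add: field_simps)
  have a0: "a \<ge> 0"
  proof -
    have "0 \<le> real ?n / r" using r(1) by simp
    then show ?thesis using a unfolding r_def[symmetric] by linarith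
  qed
  have [measurable]: "p \<in> borel_measurable borel" by (rule borel_measurable_continuous_onI[OF pc])
  have [measurable]: "\<alpha> \<in> borel_measurable borel"
    by (rule borel_measurable_continuous_onI[OF log_holder_loc_continuous[OF \<alpha>]])
  have \<Phi>: "\<Phi> \<in> schwartz" using ru by (simp add: resolution_of_unity_def)
  define s where "s x = p x / r" for x
  have [measurable]: "s \<in> borel_measurable borel" unfolding s_def by measurable
  have s1: "s x \<ge> 1" for x using r by (simp add: s_def)
  have sl: "(\<lambda>x. 1 / s x) \<in> log_holder"
    using log_holder_cmult[of "\<lambda>x. 1 / p x" r] p r(1) by (simp add: s_def var_exponent_log_def)
  obtain c E where E: "c > 0" "E > 0"
    "\<And>t y z. 0 < t \<Longrightarrow> t \<le> 1 \<Longrightarrow> t powr - \<alpha> y \<le> E * t powr - \<alpha> z * (1 + norm (y - z) / t) powr c"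
    by (rule log_holder_loc_weight[OF \<alpha>]) blast
  \<comment> \<open>\<open>c\<close> powers are spent on moving the weight from \<open>y\<close> to
    \<open>z\<close>; the rest is the decay that \<open>peetre_pointwise\<close> asks for.\<close>
  define L where "L = (?n + 1 + a) + c"
  obtain A where A: "A > 0"
    "\<And>t w. t > 0 \<Longrightarrow> cmod (dilate \<Phi> (t / 4) w) \<le> A * (1 + norm w / t) powr - L / t ^ ?n"
    by (rule dilate_decay[OF \<Phi>, of L]) blast
  define D where "D = E * A"
  have D: "D > 0" using E A by (simp add: D_def)
  obtain B1 where B1: "B1 > 0"
    "\<And>t u x y. t > 0 \<Longrightarrow> (\<And>z. u z \<ge> 0) \<Longrightarrow> u \<in> borel_measurable borel \<Longrightarrow>
      (\<And>y. ennreal (u y) \<le> (\<integral>\<^sup>+z. ennreal (D * (1 + norm (y - z) / t) powr - (?n + 1 + a) / t ^ ?n) * ennreal (u z) \<partial>lborel)) \<Longrightarrow>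
      ennreal ((u y / (1 + norm (x - y) / t) powr a) powr r / B1) \<le>
        (\<integral>\<^sup>+z. ennreal ((1 + norm (x - z :: 'a) / t) powr - (a * r) / t ^ ?n) * ennreal (u z powr r) \<partial>lborel)"
    by (rule peetre_pointwise[OF a0 r(1) D]) blast
  obtain C where C: "C > 0"
    "\<And>t f. t > 0 \<Longrightarrow> (\<And>z. f z \<ge> 0) \<Longrightarrow> f \<in> borel_measurable borel \<Longrightarrow>
      (\<integral>\<^sup>+z. ennreal (f z powr s z) \<partial>lborel) \<le> 1 \<Longrightarrow>
      \<exists>G. (\<integral>\<^sup>+x. G x \<partial>lborel) \<le> 1 \<and>
        (\<forall>x g. 0 \<le> g \<longrightarrow>
          ennreal g \<le> (\<integral>\<^sup>+z. ennreal ((1 + norm (x - z) / t) powr - (a * r) / t ^ ?n) * ennreal (f z) \<partial>lborel) \<longrightarrow>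
          ennreal ((g / C) powr s x) \<le> G x)"
    by (rule kernel_modular_bound[OF _ s1 sl ar]) (simp, blast)
  \<comment> \<open>\<open>B1\<close> and \<open>C\<close> bound \<open>r\<close>-th powers, hence
    the \<open>r\<close>-th root.\<close>
  define B where "B = (B1 * C) powr (1 / r)"
  have B: "B > 0" using B1 C by (simp add: B_def)
  have Br: "B powr r = B1 * C" using B1(1) C(1) r(1) by (simp add: B_def powr_powr)
  have "var_norm p (peetre_local g a \<alpha> t f) \<le>
        ennreal B * var_norm p (\<lambda>x. ennreal (t powr (- \<alpha> x) * cmod (conv (dilate g t) f x)))"
    if f: "f \<in> tempered_distribution" and t: "0 < t" "t \<le> 1" for f t
  proof -
    define F where "F = conv (dilate g t) f"
    have [measurable]: "F \<in> borel_measurable borel"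
      unfolding F_def using t by (intro borel_measurable_continuous_onI conv_dilate_continuous f g) auto
    define u where "u z = t powr - \<alpha> z * cmod (F z)" for z
    have u0: "u z \<ge> 0" for z by (simp add: u_def)
    have [measurable]: "u \<in> borel_measurable borel" unfolding u_def by measurable
    have rep: "ennreal (cmod (F y)) \<le> (\<integral>\<^sup>+z. ennreal (cmod (dilate \<Phi> (t / 4) (y - z)) * cmod (F z)) \<partial>lborel)" for y
      unfolding F_def by (rule resolution_conv_le[OF ru g t(1) supp f])
    have "var_norm p (peetre_local g a \<alpha> t f) \<le> ennreal B * var_norm p (\<lambda>x. ennreal (u x))"
    proof (rule var_norm_le_cmult[OF B])
      fix l :: real
      assume l: "l > 0" and int: "(\<integral>\<^sup>+ x. ennpowr (ennreal (u x) / ennreal l) (p x) \<partial>lebesgue) \<le> 1"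
      have le: "ennreal (u y / l) \<le>
          (\<integral>\<^sup>+z. ennreal (D * (1 + norm (y - z) / t) powr - (?n + 1 + a) / t ^ ?n) * ennreal (u z / l) \<partial>lborel)" for y
      proof -
        note [measurable] = schwartz_borel[OF schwartz_dilate[OF \<Phi>, of "t / 4"]]
        have "ennreal (u y / l) = ennreal (t powr - \<alpha> y / l) * ennreal (cmod (F y))"
          using l by (simp add: u_def ennreal_mult'[symmetric])
        also have "\<dots> \<le> ennreal (t powr - \<alpha> y / l) *
            (\<integral>\<^sup>+z. ennreal (cmod (dilate \<Phi> (t / 4) (y - z)) * cmod (F z)) \<partial>lborel)"
          by (intro mult_left_mono rep) auto
        also have "\<dots> = (\<integral>\<^sup>+z. ennreal (t powr - \<alpha> y / l) *
            ennreal (cmod (dilate \<Phi> (t / 4) (y - z)) * cmod (F z)) \<partial>lborel)"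
          using t by (intro nn_integral_cmult[symmetric]) measurable
        also have "\<dots> \<le> (\<integral>\<^sup>+z. ennreal (D * (1 + norm (y - z) / t) powr - (?n + 1 + a) / t ^ ?n) * ennreal (u z / l) \<partial>lborel)"
        proof (rule nn_integral_mono)
          fix z
          define W where "W = 1 + norm (y - z) / t"
          have W: "W \<ge> 1" using t by (simp add: W_def)
          have sp: "W powr c * W powr - L = W powr - (?n + 1 + a)"
          proof -
            have e: "- (?n + 1 + a) = c + - L" by (simp add: L_def)
            show ?thesis unfolding e by (rule powr_add[symmetric])
          qed
          have "t powr - \<alpha> y * cmod (dilate \<Phi> (t / 4) (y - z)) \<le>
              (E * t powr - \<alpha> z * W powr c) * (A * W powr - L / t ^ ?n)"
            unfolding W_def using E(2) t A by (intro mult_mono E(3)) auto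
          also have "\<dots> = D * W powr - (?n + 1 + a) / t ^ ?n * t powr - \<alpha> z"
            unfolding sp[symmetric] by (simp add: D_def)
          finally have "t powr - \<alpha> y * cmod (dilate \<Phi> (t / 4) (y - z)) * (cmod (F z) / l) \<le>
              D * W powr - (?n + 1 + a) / t ^ ?n * t powr - \<alpha> z * (cmod (F z) / l)"
            using l by (intro mult_right_mono) auto
          then have "t powr - \<alpha> y / l * (cmod (dilate \<Phi> (t / 4) (y - z)) * cmod (F z)) \<le>
              D * W powr - (?n + 1 + a) / t ^ ?n * (u z / l)"
            by (simp add: u_def mult.assoc)
          from ennreal_leI[OF this]
          show "ennreal (t powr - \<alpha> y / l) * ennreal (cmod (dilate \<Phi> (t / 4) (y - z)) * cmod (F z)) \<le>
              ennreal (D * (1 + norm (y - z) / t) powr - (?n + 1 + a) / t ^ ?n) * ennreal (u z / l)"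
            unfolding W_def[symmetric] using l t D u0 by (simp add: ennreal_mult'[symmetric])
        qed
        finally show ?thesis .
      qed
      \<comment> \<open>The \<open>r\<close>-th power trades the exponent \<open>p\<close> for
        \<open>s\<close> and leaves the modular unchanged.\<close>
      define v where "v z = (u z / l) powr r" for z
      have vp: "v z powr s z = (u z / l) powr p z" for z using r(1) by (simp add: v_def s_def powr_powr)
      have [measurable]: "v \<in> borel_measurable borel" unfolding v_def by measurable
      have "ennpowr (ennreal (u x) / ennreal l) (p x) = ennreal (v x powr s x)" for x
        using l u0 by (simp add: divide_ennreal ennpowr_ennreal vp)
      then have "(\<integral>\<^sup>+z. ennreal (v z powr s z) \<partial>lborel) \<le> 1"
        using int by (simp add: nn_integral_completion)
      then obtain G where G: "(\<integral>\<^sup>+x. G x \<partial>lborel) \<le> 1"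
        "\<And>x g. 0 \<le> g \<Longrightarrow>
          ennreal g \<le> (\<integral>\<^sup>+z. ennreal ((1 + norm (x - z) / t) powr - (a * r) / t ^ ?n) * ennreal (v z) \<partial>lborel) \<Longrightarrow>
          ennreal ((g / C) powr s x) \<le> G x"
        using C(2)[of t v] t by (auto simp: v_def)
      \<comment> \<open>Every \<open>y\<close> in the supremum is compared with the same value
        \<open>G x\<close>; where that value is infinite the bound is trivial.\<close>
      have "ennpowr (peetre_local g a \<alpha> t f x / ennreal (B * l)) (p x) \<le> G x" for x
      proof (cases "G x")
        case (real \<gamma>)
        have "peetre_local g a \<alpha> t f x \<le> ennreal (\<gamma> powr (1 / p x) * (B * l))"
          unfolding peetre_local_def
        proof (rule SUP_least)
          fix y
          define W where "W = (1 + norm (x - y) / t) powr a"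
          have W: "W > 0" using t by (simp add: W_def add_pos_nonneg less_imp_neq[symmetric])
          define X where "X = u y / W / (B * l)"
          have X: "X \<ge> 0" using u0 W B l by (simp add: X_def)
          have "ennreal ((u y / l / W) powr r / B1) \<le>
              (\<integral>\<^sup>+z. ennreal ((1 + norm (x - z) / t) powr - (a * r) / t ^ ?n) * ennreal ((u z / l) powr r) \<partial>lborel)"
            unfolding W_def using t u0 l le by (intro B1(2)) auto
          then have "ennreal (((u y / l / W) powr r / B1 / C) powr s x) \<le> G x"
            using B1(1) unfolding v_def[symmetric] by (intro G(2)) auto
          moreover have "(u y / l / W) powr r / B1 / C = X powr r"
          proof -
            have "X = (u y / l / W) / B" by (simp add: X_def)
            then have "X powr r = (u y / l / W) powr r / B powr r"
              using u0 l W B by (simp only: powr_divide)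
            then show ?thesis by (simp add: Br)
          qed
          moreover have "(X powr r) powr s x = X powr p x" using r(1) by (simp add: powr_powr s_def)
          ultimately have "X powr p x \<le> \<gamma>" using real by (simp add: ennreal_le_iff)
          then have "(X powr p x) powr (1 / p x) \<le> \<gamma> powr (1 / p x)"
            using p1[of x] by (intro powr_mono2) auto
          moreover have "(X powr p x) powr (1 / p x) = X"
          proof -
            have "p x \<noteq> 0" using p1[of x] by linarith
            then show ?thesis using X by (simp add: powr_powr)
          qed
          ultimately have "X * (B * l) \<le> \<gamma> powr (1 / p x) * (B * l)"
            using B l by (intro mult_right_mono) auto
          moreover have "X * (B * l) = u y / W" using B l by (simp add: X_def)
          ultimately show "ennreal (t powr - \<alpha> y * cmod (conv (dilate g t) f y) / (1 + norm (x - y) / t) powr a)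
              \<le> ennreal (\<gamma> powr (1 / p x) * (B * l))"
            by (intro ennreal_leI) (simp add: W_def u_def F_def)
        qed
        then have "peetre_local g a \<alpha> t f x / ennreal (B * l) \<le> ennreal (\<gamma> powr (1 / p x) * (B * l)) / ennreal (B * l)"
          by (rule divide_right_mono_ennreal)
        also have "\<dots> = ennreal (\<gamma> powr (1 / p x))"
          using B l by (simp add: divide_ennreal)
        finally show ?thesis
          using real p1[of x] by (simp only:) (intro ennpowr_le_of_le; linarith)
      qed simp
      then have "(\<integral>\<^sup>+ x. ennpowr (peetre_local g a \<alpha> t f x / ennreal (B * l)) (p x) \<partial>lebesgue) \<le> (\<integral>\<^sup>+x. G x \<partial>lborel)"
        unfolding nn_integral_completion by (rule nn_integral_mono)
      then show "(\<integral>\<^sup>+ x. ennpowr (peetre_local g a \<alpha> t f x / ennreal (B * l)) (p x) \<partial>lebesgue) \<le> 1"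
        using G(1) by (rule order_trans)
    qed
    then show ?thesis by (simp add: u_def F_def)
  qed
  then show ?thesis using B by (intro that) auto
qed

lemma dilate_one: "dilate g 1 = g"
  by (auto simp: dilate_def)

text \<open>At \<open>t = 1\<close> the weight \<open>t powr (- \<alpha> y)\<close> is 1, so the
  inhomogeneous term falls under the local estimate, whatever \<open>\<alpha>\<close> is.\<close>

lemma peetre_global_eq_local: "peetre_global g a f = peetre_local g a \<alpha> 1 f"
  by (auto simp: peetre_global_def peetre_local_def dilate_one)

theorem theorem3:
  fixes \<alpha> p :: "real ^ 'n \<Rightarrow> real" and q :: "real \<Rightarrow> real" and a :: real
    and \<Phi> \<phi> :: "real ^ 'n \<Rightarrow> complex"
  assumes "\<alpha> \<in> log_holder_loc"
    and "p \<in> var_exponent_log"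
    and "a > real CARD('n) / ess_inf p"
    and "q \<in> var_exponent" and "log_holder_origin q"
    and "resolution_of_unity \<Phi> \<phi>"
  shows "\<exists>c C :: real. c > 0 \<and> C > 0 \<and>
    (\<forall>f \<in> besov_space \<Phi> \<phi> \<alpha> p q.
       ennreal c * besov_norm \<Phi> \<phi> \<alpha> p q f \<le> peetre_norm \<Phi> \<phi> a \<alpha> p q f \<and>
       peetre_norm \<Phi> \<phi> a \<alpha> p q f \<le> ennreal C * besov_norm \<Phi> \<phi> \<alpha> p q f)"
proof -
  have a: "a > real DIM(real ^ 'n) / ess_inf p" using assms(3) by simp
  have ru: "\<Phi> \<in> schwartz" "\<phi> \<in> schwartz"
      "supp (fourier \<Phi>) \<subseteq> {\<xi>. norm \<xi> < 2}" "supp (fourier \<phi>) \<subseteq> {\<xi>. norm \<xi> < 2}"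
    using assms(6) by (auto simp: resolution_of_unity_def)
  have p0: "p x \<ge> 0" for x
    using assms(2) order_trans[OF zero_le_one] by (auto simp: var_exponent_log_def var_exponent_def)
  have q0: "q t \<ge> 0" for t
    using assms(4) order_trans[OF zero_le_one] by (auto simp: var_exponent_def)
  obtain B where B: "B > 0"
    "\<And>f t. f \<in> tempered_distribution \<Longrightarrow> 0 < t \<Longrightarrow> t \<le> 1 \<Longrightarrow>
      var_norm p (peetre_local \<Phi> a \<alpha> t f) \<le>
        ennreal B * var_norm p (\<lambda>x. ennreal (t powr (- \<alpha> x) * cmod (conv (dilate \<Phi> t) f x)))"
    by (rule peetre_local_norm_le[OF assms(1,2) a assms(6) ru(1,3)]) blast
  obtain C where C: "C > 0"
    "\<And>f t. f \<in> tempered_distribution \<Longrightarrow> 0 < t \<Longrightarrow> t \<le> 1 \<Longrightarrow>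
      var_norm p (peetre_local \<phi> a \<alpha> t f) \<le>
        ennreal C * var_norm p (\<lambda>x. ennreal (t powr (- \<alpha> x) * cmod (conv (dilate \<phi> t) f x)))"
    by (rule peetre_local_norm_le[OF assms(1,2) a assms(6) ru(2,4)]) blast
  have lower: "ennreal 1 * besov_norm \<Phi> \<phi> \<alpha> p q f \<le> peetre_norm \<Phi> \<phi> a \<alpha> p q f" for f
  proof -
    have "ennreal (t powr - \<alpha> x * cmod (conv (dilate \<phi> t) f x)) \<le> peetre_local \<phi> a \<alpha> t f x" for t x
      unfolding peetre_local_def by (rule SUP_upper2[of x]) auto
    then have "var_norm_dt q {0<..1} (\<lambda>t. var_norm p (\<lambda>x. ennreal (t powr (- \<alpha> x) * cmod (conv (dilate \<phi> t) f x)))) \<le>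
        ennreal 1 * var_norm_dt q {0<..1} (\<lambda>t. var_norm p (peetre_local \<phi> a \<alpha> t f))"
      by (intro var_norm_dt_le_cmult q0) (auto intro!: var_norm_mono p0)
    moreover have "ennreal (cmod (conv \<Phi> f x)) \<le> peetre_global \<Phi> a f x" for x
      unfolding peetre_global_def by (rule SUP_upper2[of x]) auto
    then have "var_norm p (\<lambda>x. ennreal (cmod (conv \<Phi> f x))) \<le> var_norm p (peetre_global \<Phi> a f)"
      by (intro var_norm_mono p0)
    ultimately show ?thesis unfolding besov_norm_def peetre_norm_def by (simp add: add_mono)
  qed
  have upper: "peetre_norm \<Phi> \<phi> a \<alpha> p q f \<le> ennreal (B + C) * besov_norm \<Phi> \<phi> \<alpha> p q f"
    if f: "f \<in> tempered_distribution" for f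
  proof -
    let ?g = "var_norm p (\<lambda>x. ennreal (cmod (conv \<Phi> f x)))"
    let ?l = "var_norm_dt q {0<..1} (\<lambda>t. var_norm p (\<lambda>x. ennreal (t powr (- \<alpha> x) * cmod (conv (dilate \<phi> t) f x))))"
    have "var_norm p (peetre_global \<Phi> a f) \<le> ennreal B * ?g"
      using B(2)[OF f, of 1] by (simp add: peetre_global_eq_local[of \<Phi> a f \<alpha>] dilate_one)
    moreover have "var_norm_dt q {0<..1} (\<lambda>t. var_norm p (peetre_local \<phi> a \<alpha> t f)) \<le> ennreal C * ?l"
      using C f by (intro var_norm_dt_le_cmult q0) auto
    ultimately have "peetre_norm \<Phi> \<phi> a \<alpha> p q f \<le> ennreal B * ?g + ennreal C * ?l"
      unfolding peetre_norm_def by (rule add_mono)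
    also have "\<dots> \<le> ennreal (B + C) * ?g + ennreal (B + C) * ?l"
      using B(1) C(1) by (intro add_mono mult_right_mono ennreal_leI) auto
    finally show ?thesis by (simp add: besov_norm_def distrib_left)
  qed
  show ?thesis
    using lower upper B(1) C(1) by (intro exI[of _ 1] exI[of _ "B + C"]) (auto simp: besov_space_def)
qed

end
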